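(* Let $n$ be a positive integer and let $S\subset\{1,\dots,n\}$ be a symmetric set of representatives mod $n$ with $n\notin S$. Then for each $k\ge0$, $A_{S,n,k}(q)$ (as a function of $\tau$, $q=e^{2\pi i\tau}$) is a quasi-modular form of (mixed) weight at most $2k$ for some congruence subgroup $\Gamma$ of $SL_2(\mathbb{Z})$, i.e. a sum of quasi-modular forms for $\Gamma$ of pure weights $0,2,\dots,2k$. Its pure weight parts depend only on $S$ and $n$: for each $w$, the weight $2w$ part of $A_{S,n,k}(q)$ is a constant multiple (the constant depending on $k$ and $w$) of \[\sum_{\substack{(i_\ell)_{\ell\in S}\\ \sum_{\ell\in S} i_\ell=2w}}\binom{2w}{(i_\ell)_{\ell\in S}}\prod_{\ell\in S}\frac{\vartheta^{(i_\ell)}_{\alpha(n,\ell)}(q^n)}{\vartheta_{\alpha(n,\ell)}(q^n)}.\]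
   Context: A set $S\subset\{1,\dots,n\}$ is a symmetric set of representatives mod $n$ if for every $\ell\in S$, some element of $S$ is congruent to $-\ell$ mod $n$; "$m\in S\pmod n$" means $m$ is congruent mod $n$ to some element of $S$. Define \[A_{S,n,k}(q)=\sum_{\substack{0<m_1<\cdots<m_k\\ m_i\in S \pmod n}}\frac{q^{m_1+\cdots+m_k}}{(1-q^{m_1})^2\cdots(1-q^{m_k})^2}.\] For $1\le\ell\le n$, $\alpha(n,\ell)=\frac{\ell}{n}-\frac12$. For $r\in\mathbb{Q}$ and integer $t\ge0$, $\vartheta^{(t)}_r(q)=\sum_{m\in\mathbb{Z}+r}e^{\pi i m}m^tq^{\frac12m^2}$, and $\vartheta_r(q)=\vartheta_r^{(0)}(q)$. The sum is over tuples of non-negative integers indexed by $S$, with the multinomial coefficient. *)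

theory Defs
  imports
    "HOL-Complex_Analysis.Complex_Analysis"
    "HOL-Algebra.Group"
    "HOL-Number_Theory.Cong"
begin

definition SL2Z :: "(int^2^2) monoid" where
  "SL2Z = \<lparr>carrier = {A. det A = 1}, mult = (**), one = mat 1\<rparr>"

definition principal_congruence_subgroup :: "nat \<Rightarrow> (int^2^2) set" where
  "principal_congruence_subgroup N =
     {A \<in> carrier SL2Z. \<forall>i j. [A $ i $ j = mat 1 $ i $ j] (mod int N)}"

definition congruence_subgroup :: "(int^2^2) set \<Rightarrow> bool" where
  "congruence_subgroup \<Gamma> \<longleftrightarrow>
     subgroup \<Gamma> SL2Z \<and> (\<exists>N>0. principal_congruence_subgroup N \<subseteq> \<Gamma>)"

definition upper_half_plane :: "complex set" where
  "upper_half_plane = {\<tau>. Im \<tau> > 0}"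

definition automorphy_factor :: "int^2^2 \<Rightarrow> complex \<Rightarrow> complex" where
  "automorphy_factor A \<tau> = of_int (A $ 2 $ 1) * \<tau> + of_int (A $ 2 $ 2)"

definition moebius_action :: "int^2^2 \<Rightarrow> complex \<Rightarrow> complex" where
  "moebius_action A \<tau> = (of_int (A $ 1 $ 1) * \<tau> + of_int (A $ 1 $ 2)) / automorphy_factor A \<tau>"

text \<open>
  For holomorphic functions that are modular for a congruence subgroup, and for the coefficients of
  almost holomorphic modular forms, this growth condition (uniform in the real part) is
  equivalent to holomorphy at all cusps.
\<close>
definition moderate_growth :: "(complex \<Rightarrow> complex) \<Rightarrow> bool" where
  "moderate_growth f \<longleftrightarrow>
     (\<exists>C N. \<forall>\<tau>\<in>upper_half_plane. norm (f \<tau>) \<le> C * (Im \<tau> ^ N + 1 / Im \<tau> ^ N))"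

text \<open>
  The definition of Kaneko and Zagier. An almost holomorphic modular form of weight \<open>k\<close> is a
  function \<open>F = (\<Sum>r\<le>p. f r / y ^ r)\<close>, where \<open>y = Im \<tau>\<close>, with holomorphic coefficients \<open>f r\<close> of
  moderate growth, that transforms like a modular form of weight \<open>k\<close>; a quasi-modular form is the
  coefficient \<open>f 0\<close> of such a function.
\<close>
definition almost_holomorphic_modular_form ::
    "(int^2^2) set \<Rightarrow> nat \<Rightarrow> nat \<Rightarrow> (nat \<Rightarrow> complex \<Rightarrow> complex) \<Rightarrow> bool" where
  "almost_holomorphic_modular_form \<Gamma> k p f \<longleftrightarrow>
     (\<forall>r\<le>p. f r holomorphic_on upper_half_plane \<and> moderate_growth (f r)) \<and>
     (let F = (\<lambda>\<tau>. \<Sum>r\<le>p. f r \<tau> / of_real (Im \<tau>) ^ r) in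
      \<forall>A\<in>\<Gamma>. \<forall>\<tau>\<in>upper_half_plane. F (moebius_action A \<tau>) = automorphy_factor A \<tau> ^ k * F \<tau>)"

definition quasi_modular_form :: "(int^2^2) set \<Rightarrow> nat \<Rightarrow> (complex \<Rightarrow> complex) \<Rightarrow> bool" where
  "quasi_modular_form \<Gamma> k g \<longleftrightarrow>
     (\<exists>p f. almost_holomorphic_modular_form \<Gamma> k p f \<and> (\<forall>\<tau>\<in>upper_half_plane. g \<tau> = f 0 \<tau>))"

definition symmetric_representatives :: "nat \<Rightarrow> nat set \<Rightarrow> bool" where
  "symmetric_representatives n S \<longleftrightarrow>
     S \<subseteq> {1..n} \<and> (\<forall>l\<in>S. \<exists>s\<in>S. [int s = - int l] (mod int n))"

definition A_series :: "nat set \<Rightarrow> nat \<Rightarrow> nat \<Rightarrow> complex \<Rightarrow> complex" where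
  "A_series S n k q =
     (\<Sum>\<^sub>\<infinity>ms\<in>{ms :: nat list. length ms = k \<and> sorted_wrt (<) ms \<and>
                 (\<forall>m\<in>set ms. 0 < m \<and> (\<exists>s\<in>S. [m = s] (mod n)))}.
        q ^ sum_list ms / (\<Prod>m\<leftarrow>ms. (1 - q ^ m)\<^sup>2))"

definition \<alpha> :: "nat \<Rightarrow> nat \<Rightarrow> rat" where
  "\<alpha> n l = of_nat l / of_nat n - 1 / 2"

text \<open>
  Because of the fractional powers of \<open>q = exp (2 * pi * \<i> * \<tau>)\<close>, the theta series is a function
  of \<open>\<tau>\<close>, with \<open>q powr (m\<^sup>2 / 2)\<close> read as \<open>exp (pi * \<i> * m\<^sup>2 * \<tau>)\<close>; substituting \<open>q ^ n\<close> for \<open>q\<close>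
  means substituting \<open>n * \<tau>\<close> for \<open>\<tau>\<close>.
\<close>
definition theta :: "nat \<Rightarrow> rat \<Rightarrow> complex \<Rightarrow> complex" where
  "theta t r \<tau> =
     (\<Sum>\<^sub>\<infinity>m\<in>{of_int j + r | j :: int. True}.
        exp (of_real pi * \<i> * of_rat m) * of_rat m ^ t * exp (of_real pi * \<i> * (of_rat m)\<^sup>2 * \<tau>))"

definition weight_part_form :: "nat set \<Rightarrow> nat \<Rightarrow> nat \<Rightarrow> complex \<Rightarrow> complex" where
  "weight_part_form S n w \<tau> =
     (\<Sum>i\<in>{i \<in> S \<rightarrow>\<^sub>E (UNIV :: nat set). (\<Sum>l\<in>S. i l) = 2 * w}.
        fact (2 * w) / (\<Prod>l\<in>S. fact (i l)) *
        (\<Prod>l\<in>S. theta (i l) (\<alpha> n l) (of_nat n * \<tau>) / theta 0 (\<alpha> n l) (of_nat n * \<tau>)))"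

end

(*
Put x = 2 - exp z - exp (-z). Then 1 + x q^m / (1 - q^m)^2 equals
(1 - exp z q^m) (1 - exp (-z) q^m) / (1 - q^m)^2, so that the generating function of the A_k in x
is a power series H(z) whose coefficients can be computed in two ways.

By the symmetry of S, the Jacobi triple product turns H(z) into the product over l in S of
sum_t theta^(t) z^t / t! divided by theta. Hence the coefficient of z^(2w) is, up to (2w)!, the
claimed form of weight 2w. It is also a combination of A_0, ..., A_w with universal coefficients
and nonzero coefficient at A_w; inverting this triangular system gives the A_k.

On the other hand, the logarithmic derivative of H has as coefficients the Lambert series
sum r^j q^(mr) over m in S mod n, with j odd. By Lipschitz' formula these are Eisenstein series of
weight j + 1 for Gamma(n), quasi-modular if j = 1. The recursion for the coefficients of H thus
shows that the coefficient of z^(2w) is quasi-modular of weight 2w.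

All identities are between formal power series in z; limits are taken coefficientwise.
*)

theory Submission
  imports Defs "HOL-Real_Asymp.Real_Asymp"
begin

text \<open>The obstacle is weight 2, where the double series converges only conditionally and a
  matrix must not permute its terms. If the automorphy factor is omega, the telescoping correction
  is taken with step omega instead of 1. The resulting terms omega / (u^2 * (u + omega)) are
  absolutely summable, and the permutation of the lattice carries them exactly to the step 1 series
  at the transformed point. The two corrections differ by a sum of differences of pi * cot (pi * m *
  tau). In each residue class of m this sum telescopes from i * pi to - i * pi, whence 2 * pi * i
  per class, the anomaly that a 1 / y term absorbs.

  On the theta side nothing is assumed about zeros of theta. One scalar kappa relates all
  coefficients of the product to the theta moments, and the constant term of the product has a
  nonzero limit; so theta itself is nonzero and kappa cancels in the quotients. The shift l/n - 1/2
  comes from completing the square, and its sum over the symmetric set S is 0.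

  Since n is not in S, no lattice row with m = 0 occurs and the Lambert series need no constant
  term.\<close>

no_notation fps_nth (infixl "$" 75)

subsection \<open>Quasi-modular forms\<close>

text \<open>With a single base \<open>max y (1 / y)\<close>, which is at least 1, exponents may be
  raised freely and add under multiplication. This makes closure under sums and products
  immediate.\<close>

lemma moderate_growth_iff:
  "moderate_growth f \<longleftrightarrow>
     (\<exists>C\<ge>0. \<exists>N. \<forall>\<tau>\<in>upper_half_plane. norm (f \<tau>) \<le> C * max (Im \<tau>) (1 / Im \<tau>) ^ N)"
proof -
  have lower: "max y (1 / y) ^ N \<le> y ^ N + 1 / y ^ N" if "y > 0" for y :: real and N
    using that by (cases "y \<le> 1 / y") (auto simp: max_def power_divide)
  have upper: "y ^ N + 1 / y ^ N \<le> 2 * max y (1 / y) ^ N" if "y > 0" for y :: real and N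
  proof -
    have "y ^ N \<le> max y (1 / y) ^ N" "(1 / y) ^ N \<le> max y (1 / y) ^ N"
      using that by (intro power_mono; simp)+
    thus ?thesis by (simp add: power_divide)
  qed
  show ?thesis
  proof
    assume "moderate_growth f"
    then obtain C N where C: "\<And>\<tau>. \<tau> \<in> upper_half_plane \<Longrightarrow> norm (f \<tau>) \<le> C * (Im \<tau> ^ N + 1 / Im \<tau> ^ N)"
      unfolding moderate_growth_def by blast
    have "norm (f \<tau>) \<le> (2 * \<bar>C\<bar>) * max (Im \<tau>) (1 / Im \<tau>) ^ N" if "\<tau> \<in> upper_half_plane" for \<tau>
    proof -
      have y: "Im \<tau> > 0" using that by (simp add: upper_half_plane_def)
      have "C * (Im \<tau> ^ N + 1 / Im \<tau> ^ N) \<le> \<bar>C\<bar> * (Im \<tau> ^ N + 1 / Im \<tau> ^ N)"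
        using y by (intro mult_right_mono) auto
      also have "\<dots> \<le> \<bar>C\<bar> * (2 * max (Im \<tau>) (1 / Im \<tau>) ^ N)"
        using upper[OF y] by (intro mult_left_mono) auto
      finally show ?thesis using C[OF that] by simp
    qed
    thus "\<exists>C\<ge>0. \<exists>N. \<forall>\<tau>\<in>upper_half_plane. norm (f \<tau>) \<le> C * max (Im \<tau>) (1 / Im \<tau>) ^ N"
      by (intro exI[of _ "2 * \<bar>C\<bar>"] conjI exI[of _ N] ballI) auto
  next
    assume "\<exists>C\<ge>0. \<exists>N. \<forall>\<tau>\<in>upper_half_plane. norm (f \<tau>) \<le> C * max (Im \<tau>) (1 / Im \<tau>) ^ N"
    then obtain C N where C: "C \<ge> 0" "\<And>\<tau>. \<tau> \<in> upper_half_plane \<Longrightarrow> norm (f \<tau>) \<le> C * max (Im \<tau>) (1 / Im \<tau>) ^ N"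
      by blast
    have "norm (f \<tau>) \<le> C * (Im \<tau> ^ N + 1 / Im \<tau> ^ N)" if "\<tau> \<in> upper_half_plane" for \<tau>
      using C(2)[OF that] mult_left_mono[OF lower[of "Im \<tau>" N] C(1)] that
      by (auto simp: upper_half_plane_def)
    thus "moderate_growth f" unfolding moderate_growth_def by blast
  qed
qed

lemma max_inverse_ge_1: "max y (1 / y) \<ge> 1" if "y > 0" for y :: real
  using that by (cases "y \<ge> 1") (auto simp: le_max_iff_disj)

lemma moderate_growth_const [intro]: "moderate_growth (\<lambda>_. c)"
  unfolding moderate_growth_iff by (intro exI[of _ "norm c"] conjI exI[of _ 0]) auto

lemma moderate_growth_add [intro]:
  assumes "moderate_growth f" "moderate_growth g"
  shows   "moderate_growth (\<lambda>\<tau>. f \<tau> + g \<tau>)"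
proof -
  from assms obtain C N D M where C: "C \<ge> 0" "D \<ge> 0"
    "\<And>\<tau>. \<tau> \<in> upper_half_plane \<Longrightarrow> norm (f \<tau>) \<le> C * max (Im \<tau>) (1 / Im \<tau>) ^ N"
    "\<And>\<tau>. \<tau> \<in> upper_half_plane \<Longrightarrow> norm (g \<tau>) \<le> D * max (Im \<tau>) (1 / Im \<tau>) ^ M"
    unfolding moderate_growth_iff by metis
  have "norm (f \<tau> + g \<tau>) \<le> (C + D) * max (Im \<tau>) (1 / Im \<tau>) ^ (max N M)" if \<tau>: "\<tau> \<in> upper_half_plane" for \<tau>
  proof -
    have m: "max (Im \<tau>) (1 / Im \<tau>) \<ge> 1" using \<tau> by (intro max_inverse_ge_1) (auto simp: upper_half_plane_def)
    have "norm (f \<tau> + g \<tau>) \<le> C * max (Im \<tau>) (1 / Im \<tau>) ^ N + D * max (Im \<tau>) (1 / Im \<tau>) ^ M"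
      by (intro order.trans[OF norm_triangle_ineq] add_mono C \<tau>)
    also have "\<dots> \<le> C * max (Im \<tau>) (1 / Im \<tau>) ^ (max N M) + D * max (Im \<tau>) (1 / Im \<tau>) ^ (max N M)"
      using m C by (intro add_mono mult_left_mono power_increasing) auto
    finally show ?thesis by (simp add: algebra_simps)
  qed
  thus ?thesis unfolding moderate_growth_iff using C by (intro exI[of _ "C + D"]) auto
qed

lemma moderate_growth_mult [intro]:
  assumes "moderate_growth f" "moderate_growth g"
  shows   "moderate_growth (\<lambda>\<tau>. f \<tau> * g \<tau>)"
proof -
  from assms obtain C N D M where C: "C \<ge> 0" "D \<ge> 0"
    "\<And>\<tau>. \<tau> \<in> upper_half_plane \<Longrightarrow> norm (f \<tau>) \<le> C * max (Im \<tau>) (1 / Im \<tau>) ^ N"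
    "\<And>\<tau>. \<tau> \<in> upper_half_plane \<Longrightarrow> norm (g \<tau>) \<le> D * max (Im \<tau>) (1 / Im \<tau>) ^ M"
    unfolding moderate_growth_iff by metis
  have "norm (f \<tau> * g \<tau>) \<le> (C * D) * max (Im \<tau>) (1 / Im \<tau>) ^ (N + M)" if \<tau>: "\<tau> \<in> upper_half_plane" for \<tau>
  proof -
    have "norm (f \<tau> * g \<tau>) \<le> (C * max (Im \<tau>) (1 / Im \<tau>) ^ N) * (D * max (Im \<tau>) (1 / Im \<tau>) ^ M)"
      unfolding norm_mult using max_inverse_ge_1[of "Im \<tau>"] \<tau>
      by (intro mult_mono C \<tau>) (auto simp: upper_half_plane_def C)
    thus ?thesis by (simp add: power_add mult_ac)
  qed
  thus ?thesis unfolding moderate_growth_iff using C by (intro exI[of _ "C * D"]) auto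
qed

lemma moderate_growth_sum [intro]:
  "(\<And>i. i \<in> I \<Longrightarrow> moderate_growth (f i)) \<Longrightarrow> moderate_growth (\<lambda>\<tau>. \<Sum>i\<in>I. f i \<tau>)"
  by (induction I rule: infinite_finite_induct) auto

text \<open>The coefficients are continued by 0 beyond the depth \<open>p\<close>. The
  transformation law then holds at every depth \<open>q \<ge> p\<close>, so two forms can be brought
  to a common depth and convolved without range conditions.\<close>

lemma quasi_modular_formE:
  assumes "quasi_modular_form \<Gamma> k g"
  obtains p f where "\<And>r. f r holomorphic_on upper_half_plane" "\<And>r. moderate_growth (f r)"
    "\<And>r \<tau>. r > p \<Longrightarrow> f r \<tau> = 0" "\<And>\<tau>. \<tau> \<in> upper_half_plane \<Longrightarrow> g \<tau> = f 0 \<tau>"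
    "\<And>q A \<tau>. q \<ge> p \<Longrightarrow> A \<in> \<Gamma> \<Longrightarrow> \<tau> \<in> upper_half_plane \<Longrightarrow>
        (\<Sum>r\<le>q. f r (moebius_action A \<tau>) / of_real (Im (moebius_action A \<tau>)) ^ r) =
        automorphy_factor A \<tau> ^ k * (\<Sum>r\<le>q. f r \<tau> / of_real (Im \<tau>) ^ r)"
proof -
  from assms obtain p f where f: "almost_holomorphic_modular_form \<Gamma> k p f"
      "\<And>\<tau>. \<tau> \<in> upper_half_plane \<Longrightarrow> g \<tau> = f 0 \<tau>"
    unfolding quasi_modular_form_def by blast
  define f' where "f' r = (if r \<le> p then f r else (\<lambda>_. 0))" for r
  have extend: "(\<Sum>r\<le>q. f' r \<tau> / of_real (Im \<tau>) ^ r) = (\<Sum>r\<le>p. f r \<tau> / of_real (Im \<tau>) ^ r)"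
    if "q \<ge> p" for q \<tau>
    using that by (intro sum.mono_neutral_cong_right) (auto simp: f'_def)
  show ?thesis
  proof (rule that[of f' p])
    show "f' r holomorphic_on upper_half_plane" "moderate_growth (f' r)" for r
      using f(1) by (auto simp: f'_def almost_holomorphic_modular_form_def)
    show "(\<Sum>r\<le>q. f' r (moebius_action A \<tau>) / of_real (Im (moebius_action A \<tau>)) ^ r) =
          automorphy_factor A \<tau> ^ k * (\<Sum>r\<le>q. f' r \<tau> / of_real (Im \<tau>) ^ r)"
      if "q \<ge> p" "A \<in> \<Gamma>" "\<tau> \<in> upper_half_plane" for q A \<tau>
      using f(1) that by (simp add: extend almost_holomorphic_modular_form_def Let_def)
  qed (use f(2) in \<open>auto simp: f'_def\<close>)
qed

lemma quasi_modular_form_const: "quasi_modular_form \<Gamma> 0 (\<lambda>_. c)"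
  unfolding quasi_modular_form_def almost_holomorphic_modular_form_def
  by (intro exI[of _ 0] exI[of _ "\<lambda>_ _. c"]) auto

lemma quasi_modular_form_0: "quasi_modular_form \<Gamma> k (\<lambda>_. 0)"
  unfolding quasi_modular_form_def almost_holomorphic_modular_form_def
  by (intro exI[of _ 0] exI[of _ "\<lambda>_ _. 0"]) auto

lemma quasi_modular_form_cong:
  "(\<And>\<tau>. \<tau> \<in> upper_half_plane \<Longrightarrow> f \<tau> = g \<tau>) \<Longrightarrow> quasi_modular_form \<Gamma> k f \<longleftrightarrow> quasi_modular_form \<Gamma> k g"
  by (auto simp: quasi_modular_form_def)

lemma quasi_modular_form_add:
  assumes "quasi_modular_form \<Gamma> k g" "quasi_modular_form \<Gamma> k h"
  shows   "quasi_modular_form \<Gamma> k (\<lambda>\<tau>. g \<tau> + h \<tau>)"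
  using assms(1)
proof (rule quasi_modular_formE)
  fix p f
  assume f: "\<And>r. f r holomorphic_on upper_half_plane" "\<And>r. moderate_growth (f r)"
    "\<And>r \<tau>. r > p \<Longrightarrow> f r \<tau> = 0" "\<And>\<tau>. \<tau> \<in> upper_half_plane \<Longrightarrow> g \<tau> = f 0 \<tau>"
    "\<And>q A \<tau>. q \<ge> p \<Longrightarrow> A \<in> \<Gamma> \<Longrightarrow> \<tau> \<in> upper_half_plane \<Longrightarrow>
        (\<Sum>r\<le>q. f r (moebius_action A \<tau>) / of_real (Im (moebius_action A \<tau>)) ^ r) =
        automorphy_factor A \<tau> ^ k * (\<Sum>r\<le>q. f r \<tau> / of_real (Im \<tau>) ^ r)"
  from assms(2) show ?thesis
  proof (rule quasi_modular_formE)
    fix p' f'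
    assume f': "\<And>r. f' r holomorphic_on upper_half_plane" "\<And>r. moderate_growth (f' r)"
      "\<And>r \<tau>. r > p' \<Longrightarrow> f' r \<tau> = 0" "\<And>\<tau>. \<tau> \<in> upper_half_plane \<Longrightarrow> h \<tau> = f' 0 \<tau>"
      "\<And>q A \<tau>. q \<ge> p' \<Longrightarrow> A \<in> \<Gamma> \<Longrightarrow> \<tau> \<in> upper_half_plane \<Longrightarrow>
          (\<Sum>r\<le>q. f' r (moebius_action A \<tau>) / of_real (Im (moebius_action A \<tau>)) ^ r) =
          automorphy_factor A \<tau> ^ k * (\<Sum>r\<le>q. f' r \<tau> / of_real (Im \<tau>) ^ r)"
    define F where "F = (\<lambda>r \<tau>. f r \<tau> + f' r \<tau>)"
    have "almost_holomorphic_modular_form \<Gamma> k (max p p') F"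
      unfolding almost_holomorphic_modular_form_def Let_def
    proof (intro conjI allI impI ballI)
      fix A \<tau> assume A: "A \<in> \<Gamma>" "\<tau> \<in> upper_half_plane"
      show "(\<Sum>r\<le>max p p'. F r (moebius_action A \<tau>) / of_real (Im (moebius_action A \<tau>)) ^ r) =
            automorphy_factor A \<tau> ^ k * (\<Sum>r\<le>max p p'. F r \<tau> / of_real (Im \<tau>) ^ r)"
        unfolding F_def add_divide_distrib sum.distrib distrib_left
        by (simp only: f(5)[OF max.cobounded1 A] f'(5)[OF max.cobounded2 A])
    qed (use f(1,2) f'(1,2) in \<open>auto simp: F_def intro!: holomorphic_intros\<close>)
    thus ?thesis unfolding quasi_modular_form_def
      using f(4) f'(4) by (intro exI[of _ "max p p'"] exI[of _ F]) (auto simp: F_def)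
  qed
qed

lemma quasi_modular_form_mult:
  assumes "quasi_modular_form \<Gamma> k g" "quasi_modular_form \<Gamma> l h"
  shows   "quasi_modular_form \<Gamma> (k + l) (\<lambda>\<tau>. g \<tau> * h \<tau>)"
  using assms(1)
proof (rule quasi_modular_formE)
  fix p f
  assume f: "\<And>r. f r holomorphic_on upper_half_plane" "\<And>r. moderate_growth (f r)"
    "\<And>r \<tau>. r > p \<Longrightarrow> f r \<tau> = 0" "\<And>\<tau>. \<tau> \<in> upper_half_plane \<Longrightarrow> g \<tau> = f 0 \<tau>"
    "\<And>q A \<tau>. q \<ge> p \<Longrightarrow> A \<in> \<Gamma> \<Longrightarrow> \<tau> \<in> upper_half_plane \<Longrightarrow>
        (\<Sum>r\<le>q. f r (moebius_action A \<tau>) / of_real (Im (moebius_action A \<tau>)) ^ r) =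
        automorphy_factor A \<tau> ^ k * (\<Sum>r\<le>q. f r \<tau> / of_real (Im \<tau>) ^ r)"
  from assms(2) show ?thesis
  proof (rule quasi_modular_formE)
    fix p' f'
    assume f': "\<And>r. f' r holomorphic_on upper_half_plane" "\<And>r. moderate_growth (f' r)"
      "\<And>r \<tau>. r > p' \<Longrightarrow> f' r \<tau> = 0" "\<And>\<tau>. \<tau> \<in> upper_half_plane \<Longrightarrow> h \<tau> = f' 0 \<tau>"
      "\<And>q A \<tau>. q \<ge> p' \<Longrightarrow> A \<in> \<Gamma> \<Longrightarrow> \<tau> \<in> upper_half_plane \<Longrightarrow>
          (\<Sum>r\<le>q. f' r (moebius_action A \<tau>) / of_real (Im (moebius_action A \<tau>)) ^ r) =
          automorphy_factor A \<tau> ^ l * (\<Sum>r\<le>q. f' r \<tau> / of_real (Im \<tau>) ^ r)"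
    \<comment> \<open>The completed forms are polynomials in \<open>1 / Im \<tau>\<close>, so the
      product has the Cauchy convolution as coefficients; its coefficient 0 is the product of the
      coefficients 0.\<close>
    define F where "F = (\<lambda>r \<tau>. (\<Sum>i\<le>r. f i \<tau> * f' (r - i) \<tau>))"
    have F: "(\<Sum>r\<le>p + p'. F r \<tau> / of_real (Im \<tau>) ^ r) =
             (\<Sum>r\<le>p. f r \<tau> / of_real (Im \<tau>) ^ r) * (\<Sum>r\<le>p'. f' r \<tau> / of_real (Im \<tau>) ^ r)" for \<tau>
      using polynomial_product[of p "\<lambda>i. f i \<tau>" p' "\<lambda>i. f' i \<tau>" "1 / of_real (Im \<tau>)"] f(3) f'(3)
      by (simp add: F_def power_divide)
    have "almost_holomorphic_modular_form \<Gamma> (k + l) (p + p') F"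
      unfolding almost_holomorphic_modular_form_def Let_def
    proof (intro conjI allI impI ballI)
      fix A \<tau> assume A: "A \<in> \<Gamma>" "\<tau> \<in> upper_half_plane"
      show "(\<Sum>r\<le>p + p'. F r (moebius_action A \<tau>) / of_real (Im (moebius_action A \<tau>)) ^ r) =
            automorphy_factor A \<tau> ^ (k + l) * (\<Sum>r\<le>p + p'. F r \<tau> / of_real (Im \<tau>) ^ r)"
        unfolding F f(5)[OF order.refl A] f'(5)[OF order.refl A] by (simp add: power_add)
    qed (use f(1,2) f'(1,2) in \<open>auto simp: F_def intro!: holomorphic_intros moderate_growth_sum moderate_growth_mult\<close>)
    thus ?thesis unfolding quasi_modular_form_def
      using f(4) f'(4) by (intro exI[of _ "p + p'"] exI[of _ F]) (auto simp: F_def)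
  qed
qed

lemma quasi_modular_form_cmult:
  "quasi_modular_form \<Gamma> k g \<Longrightarrow> quasi_modular_form \<Gamma> k (\<lambda>\<tau>. c * g \<tau>)"
  using quasi_modular_form_mult[OF quasi_modular_form_const] by simp

lemma quasi_modular_form_sum:
  "(\<And>i. i \<in> I \<Longrightarrow> quasi_modular_form \<Gamma> k (g i)) \<Longrightarrow> quasi_modular_form \<Gamma> k (\<lambda>\<tau>. \<Sum>i\<in>I. g i \<tau>)"
  by (induction I rule: infinite_finite_induct)
     (auto intro: quasi_modular_form_0 quasi_modular_form_add)

section \<open>The principal congruence subgroup of level n\<close>

definition adjugate2 :: "int^2^2 \<Rightarrow> int^2^2" where
  "adjugate2 A = (\<chi> i j. if i = 1 then (if j = 1 then A $ 2 $ 2 else - A $ 1 $ 2)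
                                  else (if j = 1 then - A $ 2 $ 1 else A $ 1 $ 1))"

lemma congruence_subgroup_principal:
  assumes "n > 0"
  shows   "congruence_subgroup (principal_congruence_subgroup n)"
proof -
  have neq: "(2::2) \<noteq> 1" by simp
  have adj: "adjugate2 A ** A = mat 1" "A ** adjugate2 A = mat 1" "det (adjugate2 A) = 1" if "det A = 1" for A
    using that by (simp_all add: vec_eq_iff forall_2 matrix_matrix_mult_def sum_2 mat_def adjugate2_def det_2 algebra_simps)
  have grp: "group SL2Z"
  proof (rule groupI)
    fix A assume "A \<in> carrier SL2Z"
    thus "\<exists>B\<in>carrier SL2Z. B \<otimes>\<^bsub>SL2Z\<^esub> A = \<one>\<^bsub>SL2Z\<^esub>"
      by (intro bexI[of _ "adjugate2 A"]) (auto simp: SL2Z_def adj)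
  qed (auto simp: SL2Z_def det_mul matrix_mul_assoc)
  \<comment> \<open>The inverse in the monoid record is abstract; uniqueness of inverses identifies
    it with an explicit matrix, whose entries can be reduced mod n.\<close>
  have inv: "inv\<^bsub>SL2Z\<^esub> A = adjugate2 A" if "det A = 1" for A
    using that by (intro group.inv_equality[OF grp]) (auto simp: SL2Z_def adj)
  have "subgroup (principal_congruence_subgroup n) SL2Z"
  proof
    fix A B assume AB: "A \<in> principal_congruence_subgroup n" "B \<in> principal_congruence_subgroup n"
    have "[(A ** B) $ i $ j = mat 1 $ i $ j] (mod int n)" for i j
    proof -
      have "[(A ** B) $ i $ j = (\<Sum>k\<in>UNIV. mat 1 $ i $ k * mat 1 $ k $ j)] (mod int n)"
        unfolding matrix_matrix_mult_def using AB
        by (auto intro!: cong_sum cong_mult simp: principal_congruence_subgroup_def)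
      also have "(\<Sum>k\<in>UNIV. mat 1 $ i $ k * mat 1 $ k $ j) = (mat 1 ** mat 1 :: int^2^2) $ i $ j"
        unfolding matrix_matrix_mult_def by simp
      finally show ?thesis by simp
    qed
    thus "A \<otimes>\<^bsub>SL2Z\<^esub> B \<in> principal_congruence_subgroup n"
      using AB by (auto simp: principal_congruence_subgroup_def SL2Z_def det_mul)
  next
    fix A assume A: "A \<in> principal_congruence_subgroup n"
    have "[adjugate2 A $ i $ j = mat 1 $ i $ j] (mod int n)" for i j
      using A exhaust_2[of i] exhaust_2[of j] cong_minus_minus_iff[of "A $ i $ j" 0 "int n"]
      by (auto simp: adjugate2_def principal_congruence_subgroup_def mat_def forall_2)
    thus "inv\<^bsub>SL2Z\<^esub> A \<in> principal_congruence_subgroup n"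
      using A inv[of A] adj(3)[of A] by (auto simp: principal_congruence_subgroup_def) (auto simp: SL2Z_def)
  qed (auto simp: principal_congruence_subgroup_def SL2Z_def)
  with assms show ?thesis unfolding congruence_subgroup_def by blast
qed

subsection \<open>Sums over the integers and the cotangent\<close>

text \<open>The negative integers are enumerated as - 1 - k. For terms in z + d this produces series
  in 1 - z + k, which is the shape of the reflection formulas.\<close>

lemma has_sum_int_split:
  fixes f :: "int \<Rightarrow> 'a :: {topological_comm_monoid_add, t3_space}"
  assumes "((\<lambda>k. f (int k)) has_sum a) UNIV" "((\<lambda>k. f (- 1 - int k)) has_sum b) UNIV"
  shows   "(f has_sum (a + b)) UNIV"
proof -
  have "(f has_sum a) {0..}"
    using assms(1) by (subst has_sum_reindex_bij_witness[of _ int nat UNIV "\<lambda>k. f (int k)"]) auto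
  moreover have "(f has_sum b) {..<0}"
    using assms(2)
    by (subst has_sum_reindex_bij_witness[of _ "\<lambda>k. - 1 - int k" "\<lambda>d. nat (- 1 - d)" UNIV "\<lambda>k. f (- 1 - int k)"]) auto
  ultimately have "(f has_sum (a + b)) ({0..} \<union> {..<0})"
    by (intro has_sum_Un_disjoint) auto
  also have "{0..} \<union> {..<0} = (UNIV :: int set)" by auto
  finally show ?thesis .
qed

text \<open>Once unconditional summability is known, the value may be computed from any ordered
  series, such as a telescoping one or the series of \<open>Digamma\<close>.\<close>

lemma has_sum_comp_inj_sums:
  fixes f :: "'b \<Rightarrow> complex" and g :: "nat \<Rightarrow> 'b"
  assumes "f summable_on UNIV" "inj g" "(\<lambda>k. f (g k)) sums a"
  shows   "((\<lambda>k. f (g k)) has_sum a) UNIV"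
proof -
  have "f summable_on range g" by (rule summable_on_subset[OF assms(1)]) auto
  hence "(\<lambda>k. f (g k)) summable_on UNIV"
    using assms(2) by (subst (asm) summable_on_reindex) (auto simp: o_def)
  thus ?thesis using assms(3) by (metis has_sum_imp_sums has_sum_infsum sums_unique2)
qed

lemma cot_add_of_int_mult_pi:
  fixes x :: complex
  shows "cot (x + of_int d * of_real pi) = cot x"
proof -
  have s: "sin (of_int d * of_real pi :: complex) = 0" by (simp add: sin_eq_0)
  hence "cos (of_int d * of_real pi :: complex) \<noteq> 0"
    using sin_cos_squared_add[of "of_int d * of_real pi :: complex"] by auto
  thus ?thesis by (simp add: cot_def sin_add cos_add s)
qed

lemma summable_on_int_abs_nonneg:
  fixes g :: "nat \<Rightarrow> real"
  assumes "summable g" "\<And>n. g n \<ge> 0"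
  shows   "(\<lambda>d::int. g (nat \<bar>d\<bar>)) summable_on UNIV"
proof -
  have "(g has_sum suminf g) UNIV"
    using assms by (intro sums_nonneg_imp_has_sum) (auto simp: summable_sums)
  moreover have "((\<lambda>k. g (Suc k)) has_sum (\<Sum>k. g (Suc k))) UNIV"
    using assms by (intro sums_nonneg_imp_has_sum summable_sums) (auto simp: summable_Suc_iff)
  moreover have "nat \<bar>- 1 - int k\<bar> = Suc k" for k by linarith
  ultimately show ?thesis
    by (intro has_sum_imp_summable[OF has_sum_int_split]) auto
qed

lemma summable_on_int_powr:
  assumes "s > 1"
  shows   "(\<lambda>d::int. (1 + \<bar>real_of_int d\<bar>) powr (- s)) summable_on UNIV"
proof -
  have "summable (\<lambda>n. real (Suc n) powr (- s))"
    using assms by (subst summable_Suc_iff) (auto simp: summable_real_powr_iff)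
  hence "summable (\<lambda>n. (1 + real n) powr (- s))" by (simp add: add_ac)
  from summable_on_int_abs_nonneg[OF this] show ?thesis by simp
qed

lemma summable_on_prod_nonneg:
  fixes f :: "'a \<Rightarrow> real" and g :: "'b \<Rightarrow> real"
  assumes "f summable_on A" "g summable_on B" "\<And>x. x \<in> A \<Longrightarrow> f x \<ge> 0" "\<And>y. y \<in> B \<Longrightarrow> g y \<ge> 0"
  shows   "(\<lambda>(x, y). f x * g y) summable_on A \<times> B"
proof (rule summable_on_SigmaI)
  show "((\<lambda>y. case (x, y) of (x, y) \<Rightarrow> f x * g y) has_sum f x * infsum g B) B" for x
    using assms(2) by (auto intro!: has_sum_cmult_right)
  show "(\<lambda>x. f x * infsum g B) summable_on A"
    by (intro summable_on_cmult_left assms)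
qed (use assms in auto)

text \<open>The exponent 3 is split as 3/2 + 3/2: from (1 + |m|) * (1 + |d|) <= (1 + |m| + |d|)^2
  the term is at most a product of two convergent one-dimensional terms.\<close>

lemma summable_on_lattice:
  "(\<lambda>(m, d). 1 / (1 + \<bar>real_of_int m\<bar> + \<bar>real_of_int d\<bar>) ^ 3) summable_on UNIV"
proof (rule summable_on_comparison_test)
  let ?w = "\<lambda>d::int. (1 + \<bar>real_of_int d\<bar>) powr (- (3 / 2))"
  show "(\<lambda>(m, d). ?w m * ?w d) summable_on UNIV"
    using summable_on_prod_nonneg[of ?w UNIV ?w UNIV] summable_on_int_powr[of "3 / 2"] by simp
  fix x :: "int \<times> int" assume "x \<in> UNIV"
  obtain m d where x: "x = (m, d)" by force
  define s where "s = 1 + \<bar>real_of_int m\<bar> + \<bar>real_of_int d\<bar>"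
  have s: "s > 0" by (simp add: s_def add_pos_nonneg)
  have "1 / s ^ 3 = s powr (-3)"
    using s by (simp add: powr_minus powr_numeral divide_inverse)
  also have "\<dots> = (s ^ 2) powr (- (3 / 2))"
    using s by (simp add: powr_powr flip: powr_numeral)
  also have "(1 + \<bar>real_of_int m\<bar>) * (1 + \<bar>real_of_int d\<bar>) \<le> s ^ 2"
    by (simp add: s_def power2_eq_square algebra_simps)
  hence "(s ^ 2) powr (- (3 / 2)) \<le> ((1 + \<bar>real_of_int m\<bar>) * (1 + \<bar>real_of_int d\<bar>)) powr (- (3 / 2))"
    by (intro powr_mono2') (auto intro!: mult_pos_pos add_pos_nonneg)
  also have "\<dots> = ?w m * ?w d" by (simp add: powr_mult)
  finally show "(case x of (m, d) \<Rightarrow> 1 / (1 + \<bar>real_of_int m\<bar> + \<bar>real_of_int d\<bar>) ^ 3) \<le> (case x of (m, d) \<Rightarrow> ?w m * ?w d)"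
    by (simp add: x s_def)
qed (auto intro!: divide_nonneg_pos zero_less_power add_pos_nonneg)

text \<open>The imaginary part controls m, the triangle inequality then controls d, and m being a
  nonzero integer absorbs the summand 1.\<close>

lemma lattice_norm_lower_bound:
  assumes "Im \<tau> > 0"
  obtains \<delta> where "\<delta> > 0"
    "\<And>m d :: int. m \<noteq> 0 \<Longrightarrow> norm (of_int m * \<tau> + of_int d) \<ge> \<delta> * (1 + \<bar>real_of_int m\<bar> + \<bar>real_of_int d\<bar>)"
proof -
  \<comment> \<open>2 / Im tau pays for 1 + |m| <= 2 * |m|, and 1 + |tau| / Im tau pays for
    |d|.\<close>
  define K where "K = 2 / Im \<tau> + 1 + norm \<tau> / Im \<tau>"
  have K: "K > 0" using assms by (auto simp: K_def intro!: add_pos_nonneg)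
  have "1 + \<bar>real_of_int m\<bar> + \<bar>real_of_int d\<bar> \<le> norm (of_int m * \<tau> + of_int d) * K"
    if m: "m \<noteq> 0" for m d :: int
  proof -
    define N where "N = norm (of_int m * \<tau> + of_int d)"
    have "\<bar>Im (of_int m * \<tau> + of_int d)\<bar> \<le> N" unfolding N_def by (rule abs_Im_le_cmod)
    hence *: "\<bar>real_of_int m\<bar> \<le> N / Im \<tau>" using assms by (simp add: abs_mult field_simps)
    have "of_int d = (of_int m * \<tau> + of_int d) - of_int m * \<tau>" by simp
    hence "\<bar>real_of_int d\<bar> = norm ((of_int m * \<tau> + of_int d) - of_int m * \<tau>)" by (metis norm_of_int)
    also have "\<dots> \<le> N + \<bar>real_of_int m\<bar> * norm \<tau>"
      unfolding N_def by (rule order.trans[OF norm_triangle_ineq4]) (simp add: norm_mult)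
    also have "\<dots> \<le> N + N / Im \<tau> * norm \<tau>" using * by (intro add_left_mono mult_right_mono) auto
    finally have **: "\<bar>real_of_int d\<bar> \<le> N + N / Im \<tau> * norm \<tau>" .
    have "1 \<le> \<bar>real_of_int m\<bar>" using m by linarith
    hence "1 + \<bar>real_of_int m\<bar> + \<bar>real_of_int d\<bar> \<le> 2 * \<bar>real_of_int m\<bar> + \<bar>real_of_int d\<bar>" by linarith
    also have "\<dots> \<le> 2 * (N / Im \<tau>) + (N + N / Im \<tau> * norm \<tau>)" using * ** by linarith
    also have "\<dots> = N * K" by (simp add: K_def algebra_simps)
    finally show ?thesis by (simp add: N_def)
  qed
  with K show ?thesis
    by (intro that[of "1 / K"]) (auto simp: field_simps)
qed

text \<open>Both sides of \<open>rGamma z * rGamma (1 - z) = sin (pi * z) / pi\<close> are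
  differentiated; the sine can be cancelled because z is not an integer.\<close>

lemma Digamma_reflection_complex:
  fixes z :: complex
  assumes "z \<notin> \<int>"
  shows   "Digamma (1 - z) - Digamma z = of_real pi * cot (of_real pi * z)"
proof -
  have z: "z \<notin> \<int>\<^sub>\<le>\<^sub>0" "1 - z \<notin> \<int>\<^sub>\<le>\<^sub>0"
    using assms Ints_diff[of 1 "1 - z"] nonpos_Ints_subset_Ints by auto
  have "((\<lambda>z. rGamma z * rGamma (1 - z)) has_field_derivative
          (rGamma z * rGamma (1 - z)) * (Digamma (1 - z) - Digamma z)) (at z)"
    using z by (auto intro!: derivative_eq_intros simp: algebra_simps)
  also have "(\<lambda>z. rGamma z * rGamma (1 - z)) = (\<lambda>z::complex. sin (of_real pi * z) / of_real pi)"
    by (simp add: rGamma_reflection_complex)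
  finally have "((\<lambda>z. sin (of_real pi * z) / of_real pi) has_field_derivative
      (sin (of_real pi * z) / of_real pi) * (Digamma (1 - z) - Digamma z)) (at z)" .
  moreover have "((\<lambda>z. sin (of_real pi * z) / of_real pi) has_field_derivative cos (of_real pi * z)) (at z)"
    by (auto intro!: derivative_eq_intros)
  ultimately have "(sin (of_real pi * z) / of_real pi) * (Digamma (1 - z) - Digamma z) = cos (of_real pi * z)"
    by (rule DERIV_unique)
  moreover have "sin (of_real pi * z) \<noteq> 0"
    using assms by (auto simp: sin_eq_0)
  ultimately show ?thesis by (auto simp: cot_def field_simps)
qed

text \<open>The row m = 1 of the lattice bound; the lower half-plane follows by negating z and
  d.\<close>

lemma norm_add_int_lower_bound:
  fixes z :: complex
  assumes "Im z \<noteq> 0"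
  obtains \<delta> where "\<delta> > 0" "\<And>d :: int. norm (z + of_int d) \<ge> \<delta> * (1 + \<bar>real_of_int d\<bar>)"
proof -
  have bound: "\<exists>\<delta>>0. \<forall>d :: int. norm (z + of_int d) \<ge> \<delta> * (1 + \<bar>real_of_int d\<bar>)" if z: "Im z > 0" for z
  proof -
    obtain \<delta> where \<delta>: "\<delta> > 0" 
      "\<And>m d :: int. m \<noteq> 0 \<Longrightarrow> norm (of_int m * z + of_int d) \<ge> \<delta> * (1 + \<bar>real_of_int m\<bar> + \<bar>real_of_int d\<bar>)"
      by (rule lattice_norm_lower_bound[OF z]) blast
    have "\<delta> * (1 + \<bar>real_of_int d\<bar>) \<le> norm (z + of_int d)" for d
      using \<delta>(2)[of 1 d] \<delta>(1) by (simp add: distrib_left)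
    with \<delta>(1) show ?thesis by blast
  qed
  show ?thesis
  proof (cases "Im z > 0")
    case True
    thus ?thesis using bound that by metis
  next
    case False
    hence "Im (-z) > 0" using assms by simp
    then obtain \<delta> where \<delta>: "\<delta> > 0" "\<And>d :: int. norm (-z + of_int d) \<ge> \<delta> * (1 + \<bar>real_of_int d\<bar>)"
      using bound by metis
    have "norm (z + of_int d) \<ge> \<delta> * (1 + \<bar>real_of_int d\<bar>)" for d
      using \<delta>(2)[of "-d"] norm_minus_cancel[of "z + of_int d"] by (simp add: algebra_simps)
    thus ?thesis using that \<delta>(1) by blast
  qed
qed

lemma summable_on_int_inverse_products:
  fixes z w :: complex
  assumes "Im z \<noteq> 0" "Im w \<noteq> 0"
  shows   "(\<lambda>d::int. norm (1 / ((z + of_int d) * (w + of_int d)))) summable_on UNIV"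
proof -
  obtain \<delta> where \<delta>: "\<delta> > 0" "\<And>d :: int. norm (z + of_int d) \<ge> \<delta> * (1 + \<bar>real_of_int d\<bar>)"
    using norm_add_int_lower_bound[OF assms(1)] by metis
  obtain \<epsilon> where \<epsilon>: "\<epsilon> > 0" "\<And>d :: int. norm (w + of_int d) \<ge> \<epsilon> * (1 + \<bar>real_of_int d\<bar>)"
    using norm_add_int_lower_bound[OF assms(2)] by metis
  show ?thesis
  proof (rule Infinite_Sum.abs_summable_on_comparison_test')
    show "(\<lambda>d::int. 1 / (\<delta> * \<epsilon>) * (1 + \<bar>real_of_int d\<bar>) powr (- 2)) summable_on UNIV"
      by (intro summable_on_cmult_right summable_on_int_powr) auto
    fix d :: int
    have "norm (1 / ((z + of_int d) * (w + of_int d))) \<le> 1 / ((\<delta> * (1 + \<bar>real_of_int d\<bar>)) * (\<epsilon> * (1 + \<bar>real_of_int d\<bar>)))"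
      unfolding norm_divide norm_mult norm_one using \<delta> \<epsilon>
      by (intro frac_le mult_mono) (auto intro!: mult_pos_pos add_pos_nonneg)
    also have "\<dots> = 1 / (\<delta> * \<epsilon>) * (1 + \<bar>real_of_int d\<bar>) powr (- 2)"
    proof -
      have "(1 + \<bar>real_of_int d\<bar>) powr (- 2) = 1 / (1 + \<bar>real_of_int d\<bar>)\<^sup>2"
        by (simp add: powr_minus_divide powr_numeral add_pos_nonneg)
      thus ?thesis by (simp add: power2_eq_square mult_ac)
    qed
    finally show "norm (1 / ((z + of_int d) * (w + of_int d))) \<le> 1 / (\<delta> * \<epsilon>) * (1 + \<bar>real_of_int d\<bar>) powr (- 2)" .
  qed
qed

lemma Im_neq_0_imp_not_Ints: "Im z \<noteq> 0 \<Longrightarrow> z \<notin> \<int>"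
  by (auto elim!: Ints_cases)

text \<open>The partial fraction expansion of the cotangent. Only differences are summed, since 1 /
  (z + d) alone is not summable. The terms with d >= 0 give \<open>Digamma w - Digamma z\<close>,
  those with d < 0 give \<open>Digamma (1 - z) - Digamma (1 - w)\<close>, and reflection combines
  them.\<close>

lemma has_sum_cot_difference:
  fixes z w :: complex
  assumes z: "Im z \<noteq> 0" and w: "Im w \<noteq> 0"
  shows   "((\<lambda>d::int. 1 / (z + of_int d) - 1 / (w + of_int d)) has_sum
             (of_real pi * cot (of_real pi * z) - of_real pi * cot (of_real pi * w))) UNIV"
proof -
  have nz: "z + of_int d \<noteq> 0" "w + of_int d \<noteq> 0" for d :: int
    using assms by (auto simp: complex_eq_iff)
  have "(\<lambda>d::int. (w - z) * (1 / ((z + of_int d) * (w + of_int d)))) summable_on UNIV"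
    by (rule summable_on_cmult_right[OF abs_summable_summable[OF summable_on_int_inverse_products[OF assms]]])
  also have "(\<lambda>d::int. (w - z) * (1 / ((z + of_int d) * (w + of_int d)))) = (\<lambda>d::int. 1 / (z + of_int d) - 1 / (w + of_int d))"
    using nz by (auto simp: fun_eq_iff field_simps)
  finally have summ: "(\<lambda>d::int. 1 / (z + of_int d) - 1 / (w + of_int d)) summable_on UNIV" .
  have Digamma_diff: "(\<lambda>k. 1 / (x + of_nat k) - 1 / (y + of_nat k)) sums (Digamma y - Digamma x)"
    if "x \<noteq> 0" "y \<noteq> 0" for x y :: complex
    using sums_diff[OF summable_sums[OF summable_Digamma[OF that(2)]] summable_sums[OF summable_Digamma[OF that(1)]]]
    by (simp add: Digamma_def divide_inverse)
  have "((\<lambda>k. 1 / (z + of_int (int k)) - 1 / (w + of_int (int k))) has_sum (Digamma w - Digamma z)) UNIV"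
    by (rule has_sum_comp_inj_sums[OF summ]) (use Digamma_diff[of z w] nz[of 0] in \<open>auto simp: inj_def\<close>)
  moreover have "((\<lambda>k. 1 / (z + of_int (- 1 - int k)) - 1 / (w + of_int (- 1 - int k))) has_sum
                   (Digamma (1 - z) - Digamma (1 - w))) UNIV"
  proof (rule has_sum_comp_inj_sums[OF summ])
    have "1 / (1 - w + of_nat k) - 1 / (1 - z + of_nat k) = 1 / (z + of_int (- 1 - int k)) - 1 / (w + of_int (- 1 - int k))" for k
    proof -
      have "z + of_int (- 1 - int k) = - (1 - z + of_nat k)" "w + of_int (- 1 - int k) = - (1 - w + of_nat k)"
        by simp_all
      thus ?thesis by (simp only: divide_minus_right) simp
    qed
    moreover have "1 - w \<noteq> 0" "1 - z \<noteq> 0" using nz[of "-1"] by auto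
    ultimately show "(\<lambda>k. 1 / (z + of_int (- 1 - int k)) - 1 / (w + of_int (- 1 - int k))) sums (Digamma (1 - z) - Digamma (1 - w))"
      using Digamma_diff[of "1 - w" "1 - z"] by simp
  qed (auto simp: inj_def)
  ultimately have "((\<lambda>d::int. 1 / (z + of_int d) - 1 / (w + of_int d)) has_sum
       (Digamma w - Digamma z + (Digamma (1 - z) - Digamma (1 - w)))) UNIV"
    by (rule has_sum_int_split)
  also have "Digamma w - Digamma z + (Digamma (1 - z) - Digamma (1 - w)) =
             (Digamma (1 - z) - Digamma z) - (Digamma (1 - w) - Digamma w)"
    by simp
  also have "\<dots> = of_real pi * cot (of_real pi * z) - of_real pi * cot (of_real pi * w)"
    by (simp only: Digamma_reflection_complex[OF Im_neq_0_imp_not_Ints[OF z]]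
                   Digamma_reflection_complex[OF Im_neq_0_imp_not_Ints[OF w]])
  finally show ?thesis .
qed

subsection \<open>Lipschitz' formula\<close>

text \<open>The polylogarithm of order -k, except that 0^0 = 1 keeps the term r = 0 when k = 0; the
  series is then 1 / (1 - x).\<close>

definition moment_series :: "nat \<Rightarrow> complex \<Rightarrow> complex" where
  "moment_series k x = (\<Sum>r. of_nat r ^ k * x ^ r)"

text \<open>The operator x * d/dx, read termwise, raises k by one.\<close>

lemma moment_series_diffs:
  "x * (diffs (\<lambda>r. of_nat r ^ k) r * x ^ r) = of_nat (Suc r) ^ Suc k * x ^ Suc r" for x :: complex
  by (simp add: diffs_def)

lemma summable_moment_series: "norm x < 1 \<Longrightarrow> summable (\<lambda>r. of_nat r ^ k * x ^ r :: complex)"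
proof (induction k arbitrary: x)
  case (Suc k)
  have "summable (\<lambda>r. diffs (\<lambda>r. of_nat r ^ k) r * x ^ r)"
    by (rule termdiff_converges[OF Suc.prems]) (use Suc.IH in auto)
  hence "summable (\<lambda>r. x * (diffs (\<lambda>r. of_nat r ^ k) r * x ^ r))"
    by (rule summable_mult)
  hence "summable (\<lambda>r. of_nat (Suc r) ^ Suc k * x ^ Suc r)"
    unfolding moment_series_diffs .
  thus ?case by (subst (asm) summable_Suc_iff)
qed (auto intro: summable_geometric)

lemma summable_norm_moment_series:
  assumes "norm x < 1"
  shows   "summable (\<lambda>r. norm (of_nat r ^ k * x ^ r :: complex))"
proof -
  have "summable (\<lambda>r. of_nat r ^ k * of_real (norm x) ^ r :: complex)"
    by (rule summable_moment_series) (use assms in simp)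
  also have "(\<lambda>r. of_nat r ^ k * of_real (norm x) ^ r :: complex) = (\<lambda>r. of_real (norm (of_nat r ^ k * x ^ r)))"
    by (simp add: norm_mult norm_power)
  finally show ?thesis by (simp only: summable_of_real_iff)
qed

lemma has_field_derivative_moment_series:
  assumes "norm x < 1" "x \<noteq> 0"
  shows   "(moment_series k has_field_derivative (moment_series (Suc k) x / x)) (at x)"
proof -
  have "((\<lambda>x. \<Sum>r. of_nat r ^ k * x ^ r) has_field_derivative (\<Sum>r. diffs (\<lambda>r. of_nat r ^ k) r * x ^ r)) (at x)"
    by (rule termdiffs_strong'[of 1]) (use assms summable_moment_series in auto)
  moreover have "(\<Sum>r. diffs (\<lambda>r. of_nat r ^ k) r * x ^ r) = moment_series (Suc k) x / x"
  proof -
    have "summable (\<lambda>r. diffs (\<lambda>r. of_nat r ^ k) r * x ^ r)"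
      by (rule termdiff_converges[OF assms(1)]) (use summable_moment_series in auto)
    hence "x * (\<Sum>r. diffs (\<lambda>r. of_nat r ^ k) r * x ^ r) = (\<Sum>r. of_nat (Suc r) ^ Suc k * x ^ Suc r)"
      unfolding moment_series_diffs[symmetric] by (rule suminf_mult[symmetric])
    also have "\<dots> = moment_series (Suc k) x"
      unfolding moment_series_def using suminf_split_head[OF summable_moment_series[OF assms(1), of "Suc k"]] by simp
    finally show ?thesis using assms by (simp add: field_simps)
  qed
  ultimately show ?thesis by (simp add: moment_series_def[abs_def])
qed

lemma cot_pi_upper_half_plane:
  assumes "Im z > 0"
  shows   "of_real pi * cot (of_real pi * z) = of_real pi * \<i> - 2 * of_real pi * \<i> / (1 - exp (2 * of_real pi * \<i> * z))"
proof -
  define u where "u = exp (\<i> * (of_real pi * z))"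
  have u2: "exp (2 * of_real pi * \<i> * z) = u * u"
    by (simp add: u_def exp_add[symmetric] mult_ac)
  have "norm (u * u) < 1"
    unfolding u2[symmetric] using assms by (simp add: norm_exp_eq_Re)
  hence nz: "u * u \<noteq> 1" "u \<noteq> 0" by (auto simp: u_def)
  have "cos (of_real pi * z) = (u + 1 / u) / 2" "sin (of_real pi * z) = (u - 1 / u) / (2 * \<i>)"
    unfolding cos_exp_eq sin_exp_eq u_def by (simp_all add: exp_minus inverse_eq_divide)
  hence "cot (of_real pi * z) = ((u + 1 / u) / 2) / ((u - 1 / u) / (2 * \<i>))"
    by (simp only: cot_def)
  also have "\<dots> = \<i> - 2 * \<i> / (1 - u * u)"
  proof -
    have "u - 1 / u \<noteq> 0" using nz by (simp add: field_simps)
    thus ?thesis using nz by (simp add: field_simps)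
  qed
  finally have c: "cot (of_real pi * z) = \<i> - 2 * \<i> / (1 - u * u)" .
  show ?thesis unfolding u2 c by (simp add: algebra_simps)
qed

lemma norm_exp_2pi_i: "Im z > 0 \<Longrightarrow> norm (exp (2 * of_real pi * \<i> * z)) < 1"
  by (simp add: norm_exp_eq_Re)

text \<open>The cotangent reflection formula is differentiated k times. Each differentiation needs
  the previous identity on a neighbourhood, hence the induction for all z; the constant pi * i
  survives only at k = 0.\<close>

lemma Polygamma_reflection_upper_half_plane:
  assumes "Im z > 0"
  shows "(-1) ^ k * Polygamma k (1 - z) - Polygamma k z =
           (if k = 0 then of_real pi * \<i> else 0) -
             (2 * of_real pi * \<i>) ^ Suc k * moment_series k (exp (2 * of_real pi * \<i> * z))"
  using assms
proof (induction k arbitrary: z)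
  case 0
  have "moment_series 0 (exp (2 * of_real pi * \<i> * z)) = 1 / (1 - exp (2 * of_real pi * \<i> * z))"
    using norm_exp_2pi_i[OF 0] by (simp add: moment_series_def suminf_geometric)
  thus ?case using 0 Im_neq_0_imp_not_Ints[of z]
    by (simp add: Digamma_reflection_complex cot_pi_upper_half_plane)
next
  case (Suc k)
  let ?c = "2 * of_real pi * \<i> :: complex"
  have z: "z \<notin> \<int>\<^sub>\<le>\<^sub>0" "1 - z \<notin> \<int>\<^sub>\<le>\<^sub>0"
    using Suc.prems Im_neq_0_imp_not_Ints[of z] Im_neq_0_imp_not_Ints[of "1 - z"] nonpos_Ints_subset_Ints by auto
  define F where "F = (\<lambda>z::complex. (-1) ^ k * Polygamma k (1 - z) - Polygamma k z)"
  define H where "H = (\<lambda>z. (if k = 0 then of_real pi * \<i> else 0) - ?c ^ Suc k * moment_series k (exp (?c * z)))"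
  have "(F has_field_derivative ((-1) ^ Suc k * Polygamma (Suc k) (1 - z) - Polygamma (Suc k) z)) (at z)"
    unfolding F_def using z by (auto intro!: derivative_eq_intros)
  moreover have "(H has_field_derivative (- (?c ^ Suc (Suc k) * moment_series (Suc k) (exp (?c * z))))) (at z)"
    unfolding H_def using norm_exp_2pi_i[OF Suc.prems]
    by (auto intro!: derivative_eq_intros DERIV_chain2[OF has_field_derivative_moment_series])
  moreover have "eventually (\<lambda>z. z \<in> {z. Im z > 0}) (nhds z)"
    using Suc.prems by (intro eventually_nhds_in_open) (auto simp: open_halfspace_Im_gt)
  hence "eventually (\<lambda>z. F z = H z) (nhds z)"
    by eventually_elim (use Suc.IH in \<open>auto simp: F_def H_def\<close>)
  ultimately have "(-1) ^ Suc k * Polygamma (Suc k) (1 - z) - Polygamma (Suc k) z =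
     - (?c ^ Suc (Suc k) * moment_series (Suc k) (exp (?c * z)))"
    using DERIV_cong_ev[OF refl _ refl, of F H z] by (blast intro: DERIV_unique)
  thus ?case by simp
qed

lemma abs_summable_int_inverse_power:
  assumes "Im z \<noteq> 0" "k \<ge> 2"
  shows   "(\<lambda>d::int. norm (1 / (z + of_int d) ^ k)) summable_on UNIV"
proof -
  obtain \<delta> where \<delta>: "\<delta> > 0" "\<And>d :: int. norm (z + of_int d) \<ge> \<delta> * (1 + \<bar>real_of_int d\<bar>)"
    using norm_add_int_lower_bound[OF assms(1)] by metis
  show ?thesis
  proof (rule Infinite_Sum.abs_summable_on_comparison_test')
    show "(\<lambda>d::int. 1 / \<delta> ^ k * (1 + \<bar>real_of_int d\<bar>) powr (- real k)) summable_on UNIV"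
      using assms by (intro summable_on_cmult_right summable_on_int_powr) auto
    fix d :: int
    have "norm (1 / (z + of_int d) ^ k) \<le> 1 / (\<delta> * (1 + \<bar>real_of_int d\<bar>)) ^ k"
      unfolding norm_divide norm_power norm_one using \<delta>
      by (intro frac_le power_mono) (auto intro!: zero_less_power mult_pos_pos add_pos_nonneg)
    also have "\<dots> = 1 / \<delta> ^ k * (1 + \<bar>real_of_int d\<bar>) powr (- real k)"
    proof -
      have "(1 + \<bar>real_of_int d\<bar>) powr (- real k) = 1 / (1 + \<bar>real_of_int d\<bar>) ^ k"
        by (simp add: powr_minus_divide powr_realpow add_pos_nonneg)
      thus ?thesis by (simp add: power_mult_distrib)
    qed
    finally show "norm (1 / (z + of_int d) ^ k) \<le> 1 / \<delta> ^ k * (1 + \<bar>real_of_int d\<bar>) powr (- real k)" .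
  qed
qed

text \<open>The halves d >= 0 and d < 0 are the series of \<open>Polygamma k\<close> at z and at 1 -
  z, and the reflection formula adds them up. The condition k > 0 gives absolute convergence and
  removes the constant of the case k = 0.\<close>

lemma Lipschitz_formula:
  assumes z: "Im z > 0" and k: "k > 0"
  shows   "((\<lambda>d::int. 1 / (z + of_int d) ^ Suc k) has_sum
              ((- 2 * of_real pi * \<i>) ^ Suc k / fact k * moment_series k (exp (2 * of_real pi * \<i> * z)))) UNIV"
proof -
  have summ: "(\<lambda>d::int. 1 / (z + of_int d) ^ Suc k) summable_on UNIV"
    by (rule abs_summable_summable, rule abs_summable_int_inverse_power) (use z k in auto)
  have nz: "z \<noteq> 0" "1 - z \<noteq> 0" using z by (auto simp: complex_eq_iff)
  have "((\<lambda>i. 1 / (z + of_int (int i)) ^ Suc k) has_sum ((-1) ^ Suc k * Polygamma k z / fact k)) UNIV"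
    by (rule has_sum_comp_inj_sums[OF summ])
       (use Polygamma_LIMSEQ[OF nz(1) k] in \<open>auto simp: divide_inverse inj_def\<close>)
  moreover have "((\<lambda>i. 1 / (z + of_int (- 1 - int i)) ^ Suc k) has_sum (Polygamma k (1 - z) / fact k)) UNIV"
  proof (rule has_sum_comp_inj_sums[OF summ])
    have "(\<lambda>i. (-1) ^ Suc k * inverse ((1 - z + of_nat i) ^ Suc k)) sums ((-1) ^ Suc k * ((-1) ^ Suc k * Polygamma k (1 - z) / fact k))"
      by (rule sums_mult[OF Polygamma_LIMSEQ[OF nz(2) k]])
    also have "(-1) ^ Suc k * ((-1) ^ Suc k * Polygamma k (1 - z) / fact k) = Polygamma k (1 - z) / fact k"
      by (simp add: power_mult_distrib[symmetric])
    also have "(\<lambda>i. (-1) ^ Suc k * inverse ((1 - z + of_nat i) ^ Suc k)) = (\<lambda>i. 1 / (z + of_int (- 1 - int i)) ^ Suc k)"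
    proof
      fix i
      have "z + of_int (- 1 - int i) = (-1) * (1 - z + of_nat i)" by simp
      thus "(-1) ^ Suc k * inverse ((1 - z + of_nat i) ^ Suc k) = 1 / (z + of_int (- 1 - int i)) ^ Suc k"
        by (cases "even (Suc k)") (simp_all only: power_mult_distrib, simp_all add: inverse_eq_divide)
    qed
    finally show "(\<lambda>i. 1 / (z + of_int (- 1 - int i)) ^ Suc k) sums (Polygamma k (1 - z) / fact k)" .
  qed (auto simp: inj_def)
  ultimately have "((\<lambda>d::int. 1 / (z + of_int d) ^ Suc k) has_sum
      ((-1) ^ Suc k * Polygamma k z / fact k + Polygamma k (1 - z) / fact k)) UNIV"
    by (rule has_sum_int_split)
  also have "(-1) ^ Suc k * Polygamma k z / fact k + Polygamma k (1 - z) / fact k =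
             (-1) ^ k / fact k * ((-1) ^ k * Polygamma k (1 - z) - Polygamma k z)"
    by (simp add: field_simps minus_one_power_iff)
  also have "\<dots> = (- 2 * of_real pi * \<i>) ^ Suc k / fact k * moment_series k (exp (2 * of_real pi * \<i> * z))"
    using k by (subst Polygamma_reflection_upper_half_plane[OF z]) (simp add: minus_one_power_iff)
  finally show ?thesis .
qed

subsection \<open>Lattice sums and Eisenstein series\<close>

text \<open>Z collects the admissible first coordinates of lattice points (m, d), while d is
  arbitrary. Periodicity makes the set of these points stable under the principal congruence
  subgroup; excluding 0 keeps m * tau + d away from 0.\<close>

locale periodic_set =
  fixes n :: nat and Z :: "int set"
  assumes n_pos: "n > 0"
  assumes zero_notin: "0 \<notin> Z"
  assumes shift: "m \<in> Z \<Longrightarrow> m + int n * t \<in> Z"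
begin

lemma shift_dvd: "m \<in> Z \<Longrightarrow> int n dvd c \<Longrightarrow> m + c \<in> Z"
  using shift by (auto elim!: dvdE)

lemma bij_shift: "int n dvd c \<Longrightarrow> bij_betw (\<lambda>m. m + c) Z Z"
  using shift_dvd[of _ c] shift_dvd[of _ "- c"] by (intro bij_betwI[of _ _ _ "\<lambda>m. m - c"]) auto

lemma nonzero: "m \<in> Z \<Longrightarrow> Im \<tau> \<noteq> 0 \<Longrightarrow> of_int m * \<tau> + of_int d \<noteq> 0"
  using zero_notin by (auto simp: complex_eq_iff)

text \<open>A fixed translation changes the size 1 + |m| + |d| by at most the factor M = 1 + |c| +
  |e|. As n divides c, the translated row stays in Z and is therefore not row 0.\<close>

lemma lattice_bound:
  assumes "Im \<tau> > 0" "int n dvd c"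
  obtains K where "K > 0"
    "\<And>m d. m \<in> Z \<Longrightarrow> norm (1 / (of_int (m + c) * \<tau> + of_int (d + e))) \<le> K / (1 + \<bar>real_of_int m\<bar> + \<bar>real_of_int d\<bar>)"
proof -
  obtain \<delta> where \<delta>: "\<delta> > 0"
    "\<And>m d :: int. m \<noteq> 0 \<Longrightarrow> norm (of_int m * \<tau> + of_int d) \<ge> \<delta> * (1 + \<bar>real_of_int m\<bar> + \<bar>real_of_int d\<bar>)"
    by (rule lattice_norm_lower_bound[OF assms(1)]) blast
  define M where "M = 1 + \<bar>real_of_int c\<bar> + \<bar>real_of_int e\<bar>"
  have M: "M > 0" by (simp add: M_def add_pos_nonneg)
  have "norm (1 / (of_int (m + c) * \<tau> + of_int (d + e))) \<le> (M / \<delta>) / (1 + \<bar>real_of_int m\<bar> + \<bar>real_of_int d\<bar>)"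
    if m: "m \<in> Z" for m d
  proof -
    define s s' where "s = 1 + \<bar>real_of_int m\<bar> + \<bar>real_of_int d\<bar>"
      and "s' = 1 + \<bar>real_of_int (m + c)\<bar> + \<bar>real_of_int (d + e)\<bar>"
    have s: "s > 0" "s' \<ge> 1" by (auto simp: s_def s'_def intro: add_pos_nonneg)
    have "m + c \<in> Z" using m assms(2) by (rule shift_dvd)
    hence "m + c \<noteq> 0" using zero_notin by metis
    hence "\<delta> * s' \<le> norm (of_int (m + c) * \<tau> + of_int (d + e))"
      unfolding s'_def by (rule \<delta>(2))
    hence le: "norm (1 / (of_int (m + c) * \<tau> + of_int (d + e))) \<le> 1 / (\<delta> * s')"
      unfolding norm_divide norm_one using s \<delta>(1) by (intro frac_le mult_pos_pos) auto
    have "s \<le> s' + (M - 1)" unfolding s_def s'_def M_def by simp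
    also have "\<dots> \<le> s' + (M - 1) * s'"
      using s mult_left_mono[of 1 s' "M - 1"] by (simp add: M_def)
    finally have "s \<le> M * s'" by (simp add: algebra_simps)
    hence "1 / (\<delta> * s') \<le> (M / \<delta>) / s"
      using s \<delta>(1) by (simp add: field_simps)
    with le show ?thesis by (simp add: s_def)
  qed
  thus ?thesis using that[of "M / \<delta>"] M \<delta>(1) by auto
qed

text \<open>Three linear factors are just enough for convergence, and each gets its own translation,
  because the weight 2 argument meets denominators u * (u + 1) * (u + omega).\<close>

lemma abs_summable_lattice:
  assumes \<tau>: "Im \<tau> > 0" and c: "int n dvd c\<^sub>1" "int n dvd c\<^sub>2" "int n dvd c\<^sub>3"
  shows "(\<lambda>(m, d). norm (1 / ((of_int (m + c\<^sub>1) * \<tau> + of_int (d + e\<^sub>1)) *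
            (of_int (m + c\<^sub>2) * \<tau> + of_int (d + e\<^sub>2)) *
            (of_int (m + c\<^sub>3) * \<tau> + of_int (d + e\<^sub>3))))) summable_on (Z \<times> UNIV)"
proof -
  obtain K1 where K1: "K1 > 0" "\<And>m d. m \<in> Z \<Longrightarrow> norm (1 / (of_int (m + c\<^sub>1) * \<tau> + of_int (d + e\<^sub>1))) \<le> K1 / (1 + \<bar>real_of_int m\<bar> + \<bar>real_of_int d\<bar>)"
    by (rule lattice_bound[OF \<tau> c(1), where e = e\<^sub>1]) blast
  obtain K2 where K2: "K2 > 0" "\<And>m d. m \<in> Z \<Longrightarrow> norm (1 / (of_int (m + c\<^sub>2) * \<tau> + of_int (d + e\<^sub>2))) \<le> K2 / (1 + \<bar>real_of_int m\<bar> + \<bar>real_of_int d\<bar>)"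
    by (rule lattice_bound[OF \<tau> c(2), where e = e\<^sub>2]) blast
  obtain K3 where K3: "K3 > 0" "\<And>m d. m \<in> Z \<Longrightarrow> norm (1 / (of_int (m + c\<^sub>3) * \<tau> + of_int (d + e\<^sub>3))) \<le> K3 / (1 + \<bar>real_of_int m\<bar> + \<bar>real_of_int d\<bar>)"
    by (rule lattice_bound[OF \<tau> c(3), where e = e\<^sub>3]) blast
  show ?thesis
  proof (rule summable_on_comparison_test)
    show "(\<lambda>x. (K1 * K2 * K3) * (case x of (m, d) \<Rightarrow> 1 / (1 + \<bar>real_of_int m\<bar> + \<bar>real_of_int d\<bar>) ^ 3)) summable_on (Z \<times> UNIV)"
      by (rule summable_on_cmult_right[OF summable_on_subset[OF summable_on_lattice]]) auto
    fix x assume "x \<in> Z \<times> (UNIV :: int set)"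
    then obtain m d where x: "x = (m, d)" "m \<in> Z" by auto
    define s where "s = 1 + \<bar>real_of_int m\<bar> + \<bar>real_of_int d\<bar>"
    have s: "s > 0" by (simp add: s_def add_pos_nonneg)
    have "norm (1 / (of_int (m + c\<^sub>1) * \<tau> + of_int (d + e\<^sub>1))) *
            norm (1 / (of_int (m + c\<^sub>2) * \<tau> + of_int (d + e\<^sub>2))) *
            norm (1 / (of_int (m + c\<^sub>3) * \<tau> + of_int (d + e\<^sub>3))) \<le> (K1 / s) * (K2 / s) * (K3 / s)"
      unfolding s_def using K1 K2 K3 x(2) by (intro mult_mono) (auto intro!: add_nonneg_nonneg)
    also have "\<dots> = (K1 * K2 * K3) * (1 / s ^ 3)" by (simp add: power3_eq_cube)
    finally show "(case x of (m, d) \<Rightarrow> norm (1 / ((of_int (m + c\<^sub>1) * \<tau> + of_int (d + e\<^sub>1)) *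
            (of_int (m + c\<^sub>2) * \<tau> + of_int (d + e\<^sub>2)) *
            (of_int (m + c\<^sub>3) * \<tau> + of_int (d + e\<^sub>3))))) \<le>
          (K1 * K2 * K3) * (case x of (m, d) \<Rightarrow> 1 / (1 + \<bar>real_of_int m\<bar> + \<bar>real_of_int d\<bar>) ^ 3)"
      by (simp add: x norm_mult norm_divide s_def)
  qed auto
qed

lemma summable_lattice:
  assumes "Im \<tau> > 0" "int n dvd c\<^sub>1" "int n dvd c\<^sub>2" "int n dvd c\<^sub>3"
  assumes eq: "\<And>m d. m \<in> Z \<Longrightarrow> f (m, d) =
            K * (1 / ((of_int (m + c\<^sub>1) * \<tau> + of_int (d + e\<^sub>1)) *
            (of_int (m + c\<^sub>2) * \<tau> + of_int (d + e\<^sub>2)) *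
            (of_int (m + c\<^sub>3) * \<tau> + of_int (d + e\<^sub>3))))"
  shows "f summable_on (Z \<times> UNIV)"
proof -
  let ?g = "\<lambda>(m, d). 1 / ((of_int (m + c\<^sub>1) * \<tau> + of_int (d + e\<^sub>1)) *
            (of_int (m + c\<^sub>2) * \<tau> + of_int (d + e\<^sub>2)) *
            (of_int (m + c\<^sub>3) * \<tau> + of_int (d + e\<^sub>3)))"
  have "(\<lambda>x. norm (?g x)) summable_on (Z \<times> UNIV)"
    using abs_summable_lattice[OF assms(1-4), of e\<^sub>1 e\<^sub>2 e\<^sub>3] unfolding case_prod_unfold .
  hence "(\<lambda>x. K * ?g x) summable_on (Z \<times> UNIV)"
    by (rule summable_on_cmult_right[OF abs_summable_summable])
  also have "(\<lambda>x. K * ?g x) summable_on (Z \<times> UNIV) \<longleftrightarrow> f summable_on (Z \<times> UNIV)"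
  proof (rule summable_on_cong)
    fix x assume "x \<in> Z \<times> (UNIV :: int set)"
    thus "K * ?g x = f x" by (cases x) (simp only: eq mem_Sigma_iff prod.case)
  qed
  finally show ?thesis .
qed

text \<open>An iterated sum, with d innermost, so that the definition also has the intended meaning
  for k = 2, where the order of summation matters.\<close>

definition eisenstein :: "nat \<Rightarrow> complex \<Rightarrow> complex" where
  "eisenstein k \<tau> = (\<Sum>\<^sub>\<infinity>m\<in>Z. \<Sum>\<^sub>\<infinity>d\<in>UNIV. 1 / (of_int m * \<tau> + of_int d) ^ k)"

lemma eisenstein_has_sum:
  assumes \<tau>: "Im \<tau> > 0" and k: "k \<ge> 3"
  shows   "((\<lambda>(m, d). 1 / (of_int m * \<tau> + of_int d) ^ k) has_sum eisenstein k \<tau>) (Z \<times> UNIV)"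
proof -
  obtain K where K: "K > 0" "\<And>m d. m \<in> Z \<Longrightarrow> norm (1 / (of_int (m + 0) * \<tau> + of_int (d + 0))) \<le> K / (1 + \<bar>real_of_int m\<bar> + \<bar>real_of_int d\<bar>)"
    by (rule lattice_bound[OF \<tau>, of 0 0]) auto
  have "(\<lambda>x. norm (case x of (m, d) \<Rightarrow> 1 / (of_int m * \<tau> + of_int d) ^ k)) summable_on (Z \<times> UNIV)"
  proof (rule Infinite_Sum.abs_summable_on_comparison_test')
    show "(\<lambda>x. K ^ k * (case x of (m, d) \<Rightarrow> 1 / (1 + \<bar>real_of_int m\<bar> + \<bar>real_of_int d\<bar>) ^ 3)) summable_on (Z \<times> UNIV)"
      by (rule summable_on_cmult_right[OF summable_on_subset[OF summable_on_lattice]]) auto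
    fix x assume "x \<in> Z \<times> (UNIV :: int set)"
    then obtain m d where x: "x = (m, d)" "m \<in> Z" by auto
    define s where "s = 1 + \<bar>real_of_int m\<bar> + \<bar>real_of_int d\<bar>"
    have s: "s \<ge> 1" by (simp add: s_def)
    have "norm (1 / (of_int m * \<tau> + of_int d)) ^ k \<le> (K / s) ^ k"
      using K(2)[OF x(2), of d] by (intro power_mono) (auto simp: s_def)
    also have "\<dots> = K ^ k * (1 / s ^ k)" by (simp add: power_divide)
    also have "\<dots> \<le> K ^ k * (1 / s ^ 3)"
      using K(1) s k by (intro mult_left_mono frac_le power_increasing) auto
    finally show "norm (case x of (m, d) \<Rightarrow> 1 / (of_int m * \<tau> + of_int d) ^ k) \<le>
                   K ^ k * (case x of (m, d) \<Rightarrow> 1 / (1 + \<bar>real_of_int m\<bar> + \<bar>real_of_int d\<bar>) ^ 3)"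
      by (simp add: x s_def norm_divide norm_power power_divide)
  qed
  hence summ: "(\<lambda>x. case x of (m, d) \<Rightarrow> 1 / (of_int m * \<tau> + of_int d) ^ k) summable_on (Z \<times> UNIV)"
    by (rule abs_summable_summable)
  have "eisenstein k \<tau> = infsum (\<lambda>x. case x of (m, d) \<Rightarrow> 1 / (of_int m * \<tau> + of_int d) ^ k) (Z \<times> UNIV)"
    unfolding eisenstein_def by (subst infsum_Sigma'_banach[OF summ]) simp
  with summ show ?thesis by (simp add: has_sum_infsum)
qed

text \<open>In weight 2 the double series converges only conditionally. Subtracting a telescoping
  series makes it absolutely convergent; the anomaly in the transformation behaviour is then the
  difference between two such telescoping series.\<close>

lemma eisenstein2_has_sum:
  assumes \<tau>: "Im \<tau> > 0"
  shows   "((\<lambda>(m, d). 1 / ((of_int m * \<tau> + of_int d)\<^sup>2 * (of_int m * \<tau> + of_int d + 1))) has_sum eisenstein 2 \<tau>) (Z \<times> UNIV)"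
proof -
  have summ: "(\<lambda>(m, d). 1 / ((of_int m * \<tau> + of_int d)\<^sup>2 * (of_int m * \<tau> + of_int d + 1))) summable_on (Z \<times> UNIV)"
    by (rule summable_lattice[OF \<tau> dvd_0_right dvd_0_right dvd_0_right, of _ 1 0 0 1])
       (simp add: power2_eq_square add_ac)
  have inner: "((\<lambda>d. 1 / ((of_int m * \<tau> + of_int d)\<^sup>2 * (of_int m * \<tau> + of_int d + 1))) has_sum
                 (\<Sum>\<^sub>\<infinity>d\<in>UNIV. 1 / (of_int m * \<tau> + of_int d) ^ 2)) UNIV" if m: "m \<in> Z" for m
  proof -
    let ?z = "of_int m * \<tau>"
    have z: "Im ?z \<noteq> 0" using m \<tau> zero_notin by auto
    \<comment> \<open>Since the cotangent has period pi, each row of the telescoping series sums to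
      0. Subtracting it leaves the row sum unchanged and turns 1 / u^2 into 1 / (u^2 * (u +
      1)).\<close>
    have "((\<lambda>d::int. 1 / (?z + of_int d) - 1 / (?z + 1 + of_int d)) has_sum
             (of_real pi * cot (of_real pi * ?z) - of_real pi * cot (of_real pi * (?z + 1)))) UNIV"
      by (rule has_sum_cot_difference) (use z in auto)
    also have "cot (of_real pi * (?z + 1)) = cot (of_real pi * ?z)"
      using cot_add_of_int_mult_pi[of "of_real pi * ?z" 1] by (simp add: distrib_left)
    finally have "((\<lambda>d::int. 1 / (?z + of_int d) - 1 / (?z + 1 + of_int d)) has_sum 0) UNIV" by simp
    moreover have "((\<lambda>d::int. 1 / (?z + of_int d) ^ 2) has_sum (\<Sum>\<^sub>\<infinity>d::int\<in>UNIV. 1 / (?z + of_int d) ^ 2)) UNIV"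
      using abs_summable_summable[OF abs_summable_int_inverse_power[OF z, of 2]] by (simp add: has_sum_infsum)
    ultimately have "((\<lambda>d::int. 1 / (?z + of_int d) ^ 2 + (-1) * (1 / (?z + of_int d) - 1 / (?z + 1 + of_int d))) has_sum
      (\<Sum>\<^sub>\<infinity>d::int\<in>UNIV. 1 / (?z + of_int d) ^ 2) + (-1) * 0) UNIV"
      by (intro has_sum_add has_sum_cmult_right)
    moreover have "1 / (?z + of_int d) ^ 2 + (-1) * (1 / (?z + of_int d) - 1 / (?z + 1 + of_int d)) =
                   1 / ((?z + of_int d)\<^sup>2 * (?z + of_int d + 1))" for d :: int
    proof -
      define u where "u = ?z + of_int d"
      have "u \<noteq> 0" "u + 1 \<noteq> 0" 
        using nonzero[OF m, of \<tau> d] nonzero[OF m, of \<tau> "d + 1"] \<tau> by (auto simp: u_def add_ac)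
      hence "1 / u ^ 2 + (-1) * (1 / u - 1 / (u + 1)) = 1 / (u\<^sup>2 * (u + 1))"
        by (simp add: divide_simps power2_eq_square)
      thus ?thesis by (simp add: u_def add_ac)
    qed
    ultimately show ?thesis by simp
  qed
  have "eisenstein 2 \<tau> = infsum (\<lambda>(m, d). 1 / ((of_int m * \<tau> + of_int d)\<^sup>2 * (of_int m * \<tau> + of_int d + 1))) (Z \<times> UNIV)"
    unfolding eisenstein_def
    by (subst infsum_Sigma'_banach[OF summ, symmetric], rule infsum_cong)
       (use infsumI[OF inner] in simp)
  with summ show ?thesis by (simp add: has_sum_infsum)
qed

end

section \<open>The anomaly in weight 2\<close>

lemma tendsto_cot_pi_Im_at_top:
  assumes "\<And>k. Im (z k) > 0" "filterlim (\<lambda>k. Im (z k)) at_top F"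
  shows   "((\<lambda>k. of_real pi * cot (of_real pi * z k)) \<longlongrightarrow> - (of_real pi * \<i>)) F"
proof -
  have "((\<lambda>k. exp (- (2 * pi) * Im (z k))) \<longlongrightarrow> 0) F"
    by (rule filterlim_compose[OF exp_at_bot] filterlim_tendsto_neg_mult_at_bot tendsto_const assms)+
       (use assms in auto)
  hence "((\<lambda>k. exp (2 * of_real pi * \<i> * z k)) \<longlongrightarrow> 0) F"
    by (subst tendsto_norm_zero_iff[symmetric]) (simp add: norm_exp_eq_Re)
  hence "((\<lambda>k. of_real pi * \<i> - 2 * of_real pi * \<i> / (1 - exp (2 * of_real pi * \<i> * z k))) \<longlongrightarrow>
           of_real pi * \<i> - 2 * of_real pi * \<i> / (1 - 0)) F"
    by (intro tendsto_intros) auto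
  thus ?thesis by (simp add: cot_pi_upper_half_plane[OF assms(1)] algebra_simps)
qed

lemma has_sum_int_telescope:
  fixes f :: "int \<Rightarrow> complex"
  assumes summ: "(\<lambda>k. f k - f (k + 1)) summable_on UNIV"
  assumes "(\<lambda>k. f (int k)) \<longlonglongrightarrow> a" "(\<lambda>k. f (- int k)) \<longlonglongrightarrow> b"
  shows   "((\<lambda>k. f k - f (k + 1)) has_sum (b - a)) UNIV"
proof -
  have "(\<lambda>k. f (int k) - f (int (Suc k))) sums (f (int 0) - a)"
    by (rule telescope_sums'[OF assms(2)])
  hence "((\<lambda>k. f (int k) - f (int k + 1)) has_sum (f 0 - a)) UNIV"
    using has_sum_comp_inj_sums[OF summ, of int] by (simp add: add_ac)
  moreover have "(\<lambda>k. f (- int (Suc k)) - f (- int k)) sums (b - f (- int 0))"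
    by (rule telescope_sums[OF assms(3)])
  hence "((\<lambda>k. f (- 1 - int k) - f (- 1 - int k + 1)) has_sum (b - f 0)) UNIV"
    using has_sum_comp_inj_sums[OF summ, of "\<lambda>k. - 1 - int k"] by (simp add: algebra_simps inj_def)
  ultimately have "((\<lambda>k. f k - f (k + 1)) has_sum (f 0 - a + (b - f 0))) UNIV"
    by (rule has_sum_int_split)
  thus ?thesis by simp
qed

context periodic_set
begin

text \<open>Exchanges the telescoping step 1 for a lattice vector omega. Rowwise, the exchange costs
  the cotangent difference divided by omega, so the total cost is V / omega. Here only the existence
  of V is obtained, from absolute summability; its value is computed afterwards.\<close>

lemma has_sum_cot_shift:
  assumes \<tau>: "Im \<tau> > 0" and c: "int n dvd c" and \<omega>: "(c, e) \<noteq> (0, 0)"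
  defines "f \<equiv> (\<lambda>m::int. of_real pi * cot (of_real pi * (of_int m * \<tau>)))"
  defines "\<omega> \<equiv> of_int c * \<tau> + of_int e"
  obtains V where "((\<lambda>m. f m - f (m + c)) has_sum V) Z"
    "((\<lambda>(m, d). \<omega> / ((of_int m * \<tau> + of_int d)\<^sup>2 * (of_int m * \<tau> + of_int d + \<omega>))) has_sum (eisenstein 2 \<tau> - V / \<omega>)) (Z \<times> UNIV)"
proof -
  have \<omega>_nz: "\<omega> \<noteq> 0" using \<omega> \<tau> by (auto simp: \<omega>_def complex_eq_iff)
  define u where "u = (\<lambda>m d. of_int m * \<tau> + of_int d :: complex)"
  have u_nz: "u m d \<noteq> 0" "u m d + 1 \<noteq> 0" "u m d + \<omega> \<noteq> 0" if m: "m \<in> Z" for m d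
    using nonzero[OF m, of \<tau> d] nonzero[OF m, of \<tau> "d + 1"] nonzero[OF shift_dvd[OF m c], of \<tau> "d + e"] \<tau>
    by (auto simp: u_def \<omega>_def algebra_simps)
  \<comment> \<open>Added to 1 / (u^2 * (u + 1)), this gives 1 / u^2 - 1 / (u * (u + omega)) = omega
    / (u^2 * (u + omega)). Over a common denominator it has three linear factors, hence is
    absolutely summable.\<close>
  define D where "D = (\<lambda>(m, d). 1 / (u m d * (u m d + 1)) - 1 / (u m d * (u m d + \<omega>)))"
  have "D summable_on (Z \<times> UNIV)"
  proof (rule summable_lattice[OF \<tau> dvd_0_right dvd_0_right c, of _ "\<omega> - 1" 0 1 e])
    fix m d :: int assume m: "m \<in> Z"
    have "D (m, d) = (\<omega> - 1) * (1 / (u m d * (u m d + 1) * (u m d + \<omega>)))"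
      using u_nz[OF m, of d] by (simp add: D_def divide_simps)
    also have "u m d + 1 = of_int (m + 0) * \<tau> + of_int (d + 1)" by (simp add: u_def)
    also have "u m d + \<omega> = of_int (m + c) * \<tau> + of_int (d + e)" by (simp add: u_def \<omega>_def algebra_simps)
    also have "u m d = of_int (m + 0) * \<tau> + of_int (d + 0)" by (simp add: u_def)
    finally show "D (m, d) = (\<omega> - 1) * (1 / ((of_int (m + 0) * \<tau> + of_int (d + 0)) *
       (of_int (m + 0) * \<tau> + of_int (d + 1)) * (of_int (m + c) * \<tau> + of_int (d + e))))" .
  qed
  then obtain s where s: "(D has_sum s) (Z \<times> UNIV)" by (auto simp: summable_on_def)
  have inner: "((\<lambda>d. D (m, d)) has_sum (- 1 / \<omega>) * (f m - f (m + c))) UNIV" if m: "m \<in> Z" for m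
  proof -
    let ?z = "of_int m * \<tau>"
    have z: "Im ?z \<noteq> 0" "Im (?z + \<omega>) \<noteq> 0"
      using nonzero[OF m, of \<tau> 0] nonzero[OF shift_dvd[OF m c], of \<tau> 0] \<tau>
      by (auto simp: complex_eq_iff \<omega>_def simp flip: distrib_right of_int_add)
    have "((\<lambda>d::int. 1 / (?z + of_int d) - 1 / (?z + 1 + of_int d)) has_sum
             (of_real pi * cot (of_real pi * ?z) - of_real pi * cot (of_real pi * (?z + 1)))) UNIV"
      by (rule has_sum_cot_difference) (use z in auto)
    also have "cot (of_real pi * (?z + 1)) = cot (of_real pi * ?z)"
      using cot_add_of_int_mult_pi[of "of_real pi * ?z" 1] by (simp add: distrib_left)
    finally have 1: "((\<lambda>d::int. 1 / (?z + of_int d) - 1 / (?z + 1 + of_int d)) has_sum 0) UNIV" by simp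
    have "cot (of_real pi * (?z + \<omega>)) = cot (of_real pi * (of_int (m + c) * \<tau>) + of_int e * of_real pi)"
      by (simp add: \<omega>_def algebra_simps)
    also have "\<dots> = cot (of_real pi * (of_int (m + c) * \<tau>))"
      by (rule cot_add_of_int_mult_pi)
    finally have "of_real pi * cot (of_real pi * (?z + \<omega>)) = f (m + c)" by (simp add: f_def)
    with has_sum_cot_difference[OF z] 
    have 2: "((\<lambda>d::int. 1 / (?z + of_int d) - 1 / (?z + \<omega> + of_int d)) has_sum (f m - f (m + c))) UNIV"
      by (simp add: f_def)
    have "((\<lambda>d::int. (1 / (?z + of_int d) - 1 / (?z + 1 + of_int d)) + (- 1 / \<omega>) * (1 / (?z + of_int d) - 1 / (?z + \<omega> + of_int d))) has_sum
            (0 + (- 1 / \<omega>) * (f m - f (m + c)))) UNIV"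
      by (intro has_sum_add has_sum_cmult_right 1 2)
    moreover have "(1 / (?z + of_int d) - 1 / (?z + 1 + of_int d)) + (- 1 / \<omega>) * (1 / (?z + of_int d) - 1 / (?z + \<omega> + of_int d)) = D (m, d)"
      for d :: int
    proof -
      have "?z + 1 + of_int d = u m d + 1" "?z + \<omega> + of_int d = u m d + \<omega>" "?z + of_int d = u m d"
        by (simp_all add: u_def)
      moreover have "1 / u m d - 1 / (u m d + 1) + (- 1 / \<omega>) * (1 / u m d - 1 / (u m d + \<omega>)) = D (m, d)"
        using u_nz[OF m, of d] \<omega>_nz by (simp add: D_def divide_simps)
      ultimately show ?thesis by (simp only:)
    qed
    ultimately show ?thesis by simp
  qed
  have "((\<lambda>m. (- 1 / \<omega>) * (f m - f (m + c))) has_sum s) Z"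
    by (rule has_sum_SigmaD[OF s inner])
  hence "((\<lambda>m. (- \<omega>) * ((- 1 / \<omega>) * (f m - f (m + c)))) has_sum (- \<omega>) * s) Z"
    by (rule has_sum_cmult_right)
  hence V: "((\<lambda>m. f m - f (m + c)) has_sum (- \<omega> * s)) Z"
    using \<omega>_nz by simp
  have "((\<lambda>x. (case x of (m, d) \<Rightarrow> 1 / ((u m d)\<^sup>2 * (u m d + 1))) + D x) has_sum (eisenstein 2 \<tau> + s)) (Z \<times> UNIV)"
    by (intro has_sum_add s) (use eisenstein2_has_sum[OF \<tau>] in \<open>simp add: u_def\<close>)
  also have "?this \<longleftrightarrow> ((\<lambda>(m, d). \<omega> / ((u m d)\<^sup>2 * (u m d + \<omega>))) has_sum (eisenstein 2 \<tau> + s)) (Z \<times> UNIV)"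
  proof (rule has_sum_cong)
    fix x assume "x \<in> Z \<times> (UNIV :: int set)"
    then obtain m d where x: "x = (m, d)" "m \<in> Z" by auto
    show "(case x of (m, d) \<Rightarrow> 1 / ((u m d)\<^sup>2 * (u m d + 1))) + D x = (case x of (m, d) \<Rightarrow> \<omega> / ((u m d)\<^sup>2 * (u m d + \<omega>)))"
      using u_nz[OF x(2), of d] unfolding x(1) D_def prod.case
      by (simp add: divide_simps power2_eq_square) (simp add: algebra_simps)
  qed
  also have "eisenstein 2 \<tau> + s = eisenstein 2 \<tau> - (- \<omega> * s) / \<omega>" using \<omega>_nz by simp
  finally show ?thesis using that[OF V] by (simp add: u_def)
qed

text \<open>In each residue class r + n * k the differences telescope in k. The function pi * cot
  tends to pi * i as k tends to minus infinity and to - pi * i as k tends to infinity, so every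
  class contributes 2 * pi * i.\<close>

lemma has_sum_cot_shift_period:
  assumes \<tau>: "Im \<tau> > 0"
  defines "f \<equiv> (\<lambda>m::int. of_real pi * cot (of_real pi * (of_int m * \<tau>)))"
  shows "((\<lambda>m. f m - f (m + int n)) has_sum (2 * of_real pi * \<i> * of_nat (card (Z \<inter> {0..<int n})))) Z"
proof -
  let ?R = "Z \<inter> {0..<int n}"
  let ?g = "\<lambda>m. f m - f (m + int n)"
  let ?h = "\<lambda>(r, k). r + int n * k"
  have bij: "bij_betw ?h (?R \<times> UNIV) Z"
  proof (rule bij_betwI[of _ _ _ "\<lambda>m. (m mod int n, m div int n)"])
    show "(\<lambda>m. (m mod int n, m div int n)) \<in> Z \<rightarrow> ?R \<times> UNIV"
    proof
      fix m assume m: "m \<in> Z"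
      have "m mod int n = m + int n * (- (m div int n))"
        using mult_div_mod_eq[of "int n" m] by (simp add: algebra_simps)
      hence "m mod int n \<in> Z" using shift[OF m, of "- (m div int n)"] by (simp only:)
      with n_pos show "(m mod int n, m div int n) \<in> ?R \<times> UNIV" by simp
    qed
  qed (use shift n_pos in auto)
  obtain V where V: "(?g has_sum V) Z"
    using has_sum_cot_shift[OF \<tau>, of "int n" 0] n_pos unfolding f_def by auto
  hence V': "((\<lambda>x. ?g (?h x)) has_sum V) (?R \<times> UNIV)"
    using has_sum_reindex_bij_betw[OF bij, of ?g V] by simp
  have inner: "((\<lambda>k. ?g (?h (r, k))) has_sum (2 * of_real pi * \<i>)) UNIV" if r: "r \<in> ?R" for r
  proof -
    let ?F = "\<lambda>k. f (r + int n * k)"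
    have "(\<lambda>(r, k). ?g (r + int n * k)) summable_on ?R \<times> UNIV"
      using has_sum_imp_summable[OF V'] by (simp add: case_prod_unfold)
    hence "(\<lambda>k. ?g (r + int n * k)) summable_on UNIV"
      using r by (rule summable_on_SigmaD1)
    also have "(\<lambda>k. ?g (r + int n * k)) = (\<lambda>k. ?F k - ?F (k + 1))"
      by (simp add: algebra_simps)
    finally have summ: "(\<lambda>k. ?F k - ?F (k + 1)) summable_on UNIV" .
    have r': "r > 0" "r < int n" using r zero_notin by (cases "r = 0"; force)+
    have "(\<lambda>k. ?F (int k)) \<longlonglongrightarrow> - (of_real pi * \<i>)"
      unfolding f_def
    proof (rule tendsto_cot_pi_Im_at_top)
      show "Im (of_int (r + int n * int k) * \<tau>) > 0" for k
        using r' \<tau> by (auto intro!: mult_pos_pos add_pos_nonneg)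
      have "filterlim (\<lambda>k. real k * (real n * Im \<tau>) + real_of_int r * Im \<tau>) at_top sequentially"
        using n_pos \<tau> by real_asymp
      thus "filterlim (\<lambda>k. Im (of_int (r + int n * int k) * \<tau>)) at_top sequentially"
        by (simp add: algebra_simps)
    qed
    moreover have "(\<lambda>k. ?F (- int k)) \<longlonglongrightarrow> of_real pi * \<i>"
    proof -
      \<comment> \<open>Oddness of the cotangent moves the negative rows to the upper half-plane.
        The index starts at \<open>Suc k\<close> because r - n * Suc k is negative for all k,
        whereas r itself is positive.\<close>
      have "(\<lambda>k. - of_real pi * cot (of_real pi * (of_int (- (r + int n * (- int (Suc k)))) * \<tau>))) \<longlonglongrightarrow> - (- (of_real pi * \<i>))"
        unfolding mult_minus_left
      proof (rule tendsto_minus, rule tendsto_cot_pi_Im_at_top)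
        show "Im (of_int (- (r + int n * (- int (Suc k)))) * \<tau>) > 0" for k
        proof -
          have "- (r + int n * (- int (Suc k))) = (int n - r) + int n * int k" by (simp add: algebra_simps)
          also have "\<dots> > 0" using r' by (intro add_pos_nonneg) auto
          finally have "real_of_int (- (r + int n * (- int (Suc k)))) * Im \<tau> > 0"
            using \<tau> by (intro mult_pos_pos) linarith+
          thus ?thesis by simp
        qed
        have "filterlim (\<lambda>k. real k * (real n * Im \<tau>) + (real n - real_of_int r) * Im \<tau>) at_top sequentially"
          using n_pos \<tau> by real_asymp
        thus "filterlim (\<lambda>k. Im (of_int (- (r + int n * (- int (Suc k)))) * \<tau>)) at_top sequentially"
          by (simp add: algebra_simps)
      qed
      also have "(\<lambda>k. - of_real pi * cot (of_real pi * (of_int (- (r + int n * (- int (Suc k)))) * \<tau>))) =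
                 (\<lambda>k. ?F (- int (Suc k)))"
      proof
        fix k
        have "of_real pi * (of_int (- (r + int n * (- int (Suc k)))) * \<tau>) =
              - (of_real pi * (of_int (r + int n * (- int (Suc k))) * \<tau>))" by (simp only: of_int_minus mult_minus_left mult_minus_right)
        thus "- of_real pi * cot (of_real pi * (of_int (- (r + int n * (- int (Suc k)))) * \<tau>)) = ?F (- int (Suc k))"
          unfolding f_def by (simp only: cot_minus minus_mult_minus)
      qed
      finally show ?thesis by (subst (asm) filterlim_sequentially_Suc) simp
    qed
    ultimately have "((\<lambda>k. ?F k - ?F (k + 1)) has_sum (of_real pi * \<i> - (- (of_real pi * \<i>)))) UNIV"
      by (rule has_sum_int_telescope[OF summ])
    thus ?thesis by (simp add: algebra_simps)
  qed
  have "((\<lambda>r. 2 * of_real pi * \<i>) has_sum V) ?R"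
    by (rule has_sum_SigmaD[OF V' inner])
  moreover have "((\<lambda>r. 2 * of_real pi * \<i>) has_sum (\<Sum>r\<in>?R. 2 * of_real pi * \<i>)) ?R"
    by (rule has_sum_finite) auto
  ultimately have "V = 2 * of_real pi * \<i> * of_nat (card ?R)"
    by (auto dest: has_sum_unique simp: mult_ac)
  with V show ?thesis by simp
qed

text \<open>A translation by a multiple of n permutes Z, so the sum over one period has the same
  value wherever it starts; t periods add up, in either direction.\<close>

lemma has_sum_cot_shift_multiple:
  assumes \<tau>: "Im \<tau> > 0"
  defines "f \<equiv> (\<lambda>m::int. of_real pi * cot (of_real pi * (of_int m * \<tau>)))"
  defines "V \<equiv> 2 * of_real pi * \<i> * of_nat (card (Z \<inter> {0..<int n}))"
  shows "((\<lambda>m. f m - f (m + int n * t)) has_sum (of_int t * V)) Z"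
proof -
  have shifted: "((\<lambda>m. f (m + int n * t) - f (m + int n * t + int n)) has_sum V) Z" for t
    using has_sum_reindex_bij_betw[OF bij_shift[of "int n * t"], of "\<lambda>m. f m - f (m + int n)" V]
          has_sum_cot_shift_period[OF \<tau>] unfolding f_def V_def by simp
  show ?thesis
  proof (induction t rule: int_induct[of _ 0])
    case (step1 t)
    have "((\<lambda>m. (f m - f (m + int n * t)) + (f (m + int n * t) - f (m + int n * t + int n))) has_sum (of_int t * V + V)) Z"
      by (intro has_sum_add step1 shifted)
    thus ?case by (simp add: algebra_simps)
  next
    case (step2 t)
    have "((\<lambda>m. (f m - f (m + int n * t)) + (-1) * (f (m + int n * (t - 1)) - f (m + int n * (t - 1) + int n))) has_sum
            (of_int t * V + (-1) * V)) Z"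
      by (intro has_sum_add step2 has_sum_cmult_right shifted)
    thus ?case by (simp add: algebra_simps)
  qed auto
qed

lemma eisenstein2_shifted_has_sum:
  assumes \<tau>: "Im \<tau> > 0" and c: "int n dvd c" and nz: "(c, e) \<noteq> (0, 0)"
  defines "\<omega> \<equiv> of_int c * \<tau> + of_int e"
  shows "((\<lambda>(m, d). \<omega> / ((of_int m * \<tau> + of_int d)\<^sup>2 * (of_int m * \<tau> + of_int d + \<omega>))) has_sum
    (eisenstein 2 \<tau> - 2 * of_real pi * \<i> * of_nat (card (Z \<inter> {0..<int n})) / of_nat n * of_int c / \<omega>)) (Z \<times> UNIV)"
proof -
  from c obtain t where t: "c = int n * t" by (elim dvdE)
  obtain V where V: "((\<lambda>m. of_real pi * cot (of_real pi * (of_int m * \<tau>)) - of_real pi * cot (of_real pi * (of_int (m + c) * \<tau>))) has_sum V) Z"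
    and sum: "((\<lambda>(m, d). \<omega> / ((of_int m * \<tau> + of_int d)\<^sup>2 * (of_int m * \<tau> + of_int d + \<omega>))) has_sum (eisenstein 2 \<tau> - V / \<omega>)) (Z \<times> UNIV)"
    unfolding \<omega>_def by (rule has_sum_cot_shift[OF \<tau> c nz])
  have "V = of_int t * (2 * of_real pi * \<i> * of_nat (card (Z \<inter> {0..<int n})))"
    using has_sum_unique[OF V] has_sum_cot_shift_multiple[OF \<tau>, of t] unfolding t by simp
  also have "\<dots> = 2 * of_real pi * \<i> * of_nat (card (Z \<inter> {0..<int n})) / of_nat n * of_int c"
    using n_pos by (simp add: t)
  finally show ?thesis using sum by simp
qed

end

section \<open>Transformation of the lattice sums under matrices\<close>

lemma principal_congruence_subgroupD:
  assumes "A \<in> principal_congruence_subgroup n"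
  shows "A $ 1 $ 1 * A $ 2 $ 2 - A $ 1 $ 2 * A $ 2 $ 1 = 1"
        "int n dvd A $ 1 $ 1 - 1" "int n dvd A $ 2 $ 2 - 1" "int n dvd A $ 1 $ 2" "int n dvd A $ 2 $ 1"
  using assms by (auto simp: principal_congruence_subgroup_def SL2Z_def det_2 forall_2 mat_def cong_iff_dvd_diff)

lemma automorphy_factor_nonzero:
  assumes "A $ 1 $ 1 * A $ 2 $ 2 - A $ 1 $ 2 * A $ 2 $ 1 = 1" "Im \<tau> > 0"
  shows   "automorphy_factor A \<tau> \<noteq> 0"
  using assms by (auto simp: automorphy_factor_def complex_eq_iff)

lemma Im_moebius_action:
  assumes "A $ 1 $ 1 * A $ 2 $ 2 - A $ 1 $ 2 * A $ 2 $ 1 = 1" "Im \<tau> > 0"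
  shows   "Im (moebius_action A \<tau>) = Im \<tau> / (norm (automorphy_factor A \<tau>))\<^sup>2"
proof -
  define a b c d where "a = real_of_int (A $ 1 $ 1)" "b = real_of_int (A $ 1 $ 2)"
    "c = real_of_int (A $ 2 $ 1)" "d = real_of_int (A $ 2 $ 2)"
  have det: "a * d - b * c = 1" unfolding a_b_c_d_def using assms(1) by (metis of_int_1 of_int_diff of_int_mult)
  have "moebius_action A \<tau> = (of_real a * \<tau> + of_real b) / (of_real c * \<tau> + of_real d)"
    by (simp add: moebius_action_def automorphy_factor_def a_b_c_d_def)
  also have "Im \<dots> = ((a * d - b * c) * Im \<tau>) / (norm (of_real c * \<tau> + of_real d))\<^sup>2"
    by (simp add: Im_divide cmod_power2 algebra_simps)
  finally show ?thesis
    unfolding det by (simp add: automorphy_factor_def a_b_c_d_def)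
qed

context periodic_set
begin

text \<open>The row vector (m, d) is multiplied by A. As the first column of A is (1, 0) mod n, the
  new first coordinate differs from m by a multiple of n and stays in Z; the adjugate matrix gives
  the inverse map.\<close>

lemma bij_lattice:
  assumes A: "A \<in> principal_congruence_subgroup n"
  shows "bij_betw (\<lambda>(m, d). (m * A $ 1 $ 1 + d * A $ 2 $ 1, m * A $ 1 $ 2 + d * A $ 2 $ 2)) (Z \<times> UNIV) (Z \<times> UNIV)"
proof -
  obtain a b c d where abcd: "A $ 1 $ 1 = a" "A $ 1 $ 2 = b" "A $ 2 $ 1 = c" "A $ 2 $ 2 = d" by auto
  note A' = principal_congruence_subgroupD[OF A, unfolded abcd]
  have mem: "m * x + k * y \<in> Z" if "m \<in> Z" "int n dvd x - 1" "int n dvd y" for m k x y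
  proof -
    have "m + (m * (x - 1) + k * y) \<in> Z" using that by (intro shift_dvd) auto
    thus ?thesis by (simp add: algebra_simps)
  qed
  have det: "d * a = 1 + b * c" "a * d = 1 + b * c" using A'(1) by (auto simp: algebra_simps)
  show ?thesis unfolding abcd
  proof (rule bij_betwI[of _ _ _ "\<lambda>(m, k). (m * d + k * (- c), m * (- b) + k * a)"])
    show "(\<lambda>(m, k). (m * a + k * c, m * b + k * d)) \<in> Z \<times> UNIV \<rightarrow> Z \<times> UNIV"
      using mem[of _ a c] A' by auto
    show "(\<lambda>(m, k). (m * d + k * (- c), m * (- b) + k * a)) \<in> Z \<times> UNIV \<rightarrow> Z \<times> UNIV"
      using mem[of _ d "- c"] A' by auto
  qed (auto simp: algebra_simps det)
qed

lemma lattice_moebius_action: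
  assumes "A \<in> principal_congruence_subgroup n" "Im \<tau> > 0"
  shows "of_int m * moebius_action A \<tau> + of_int k =
           (of_int (m * A $ 1 $ 1 + k * A $ 2 $ 1) * \<tau> + of_int (m * A $ 1 $ 2 + k * A $ 2 $ 2)) / automorphy_factor A \<tau>"
  using automorphy_factor_nonzero[OF principal_congruence_subgroupD(1)[OF assms(1)] assms(2)]
  by (simp add: moebius_action_def field_simps) (simp add: automorphy_factor_def algebra_simps)

lemma moebius_action_in_upper:
  assumes "A \<in> principal_congruence_subgroup n" "Im \<tau> > 0"
  shows "Im (moebius_action A \<tau>) > 0"
  using Im_moebius_action[OF principal_congruence_subgroupD(1)[OF assms(1)] assms(2)]
    automorphy_factor_nonzero[OF principal_congruence_subgroupD(1)[OF assms(1)] assms(2)] assms(2) by simp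

lemma eisenstein_transform:
  assumes A: "A \<in> principal_congruence_subgroup n" and \<tau>: "Im \<tau> > 0" and k: "k \<ge> 3"
  shows "eisenstein k (moebius_action A \<tau>) = automorphy_factor A \<tau> ^ k * eisenstein k \<tau>"
proof -
  let ?g = "\<lambda>(m, d). (m * A $ 1 $ 1 + d * A $ 2 $ 1, m * A $ 1 $ 2 + d * A $ 2 $ 2)"
  let ?f = "\<lambda>(m, d). 1 / (of_int m * \<tau> + of_int d) ^ k"
  have "((\<lambda>x. ?f (?g x)) has_sum eisenstein k \<tau>) (Z \<times> UNIV)"
    using has_sum_reindex_bij_betw[OF bij_lattice[OF A], of ?f "eisenstein k \<tau>"] eisenstein_has_sum[OF \<tau> k] by simp
  hence "((\<lambda>x. automorphy_factor A \<tau> ^ k * ?f (?g x)) has_sum (automorphy_factor A \<tau> ^ k * eisenstein k \<tau>)) (Z \<times> UNIV)"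
    by (rule has_sum_cmult_right)
  also have "(\<lambda>x. automorphy_factor A \<tau> ^ k * ?f (?g x)) = (\<lambda>(m, d). 1 / (of_int m * moebius_action A \<tau> + of_int d) ^ k)"
    unfolding lattice_moebius_action[OF A \<tau>] by (auto simp: fun_eq_iff power_divide)
  finally show ?thesis
    using eisenstein_has_sum[OF moebius_action_in_upper[OF A \<tau>] k] has_sum_unique by blast
qed

text \<open>For omega the automorphy factor, omega^2 * omega / (u^2 * (u + omega)) equals 1 / (v^2 *
  (v + 1)) with v = u / omega. So the series with step omega at tau is, after reindexing by A, the
  series with step 1 at the image of tau, and the anomaly is the one already computed for step
  omega.\<close>

lemma eisenstein2_transform:
  assumes A: "A \<in> principal_congruence_subgroup n" and \<tau>: "Im \<tau> > 0"
  shows "eisenstein 2 (moebius_action A \<tau>) = automorphy_factor A \<tau> ^ 2 * eisenstein 2 \<tau> -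
     2 * of_real pi * \<i> * of_nat (card (Z \<inter> {0..<int n})) / of_nat n * of_int (A $ 2 $ 1) * automorphy_factor A \<tau>"
proof -
  define \<omega> where "\<omega> = automorphy_factor A \<tau>"
  have \<omega>: "\<omega> = of_int (A $ 2 $ 1) * \<tau> + of_int (A $ 2 $ 2)" by (simp add: \<omega>_def automorphy_factor_def)
  have \<omega>_nz: "\<omega> \<noteq> 0"
    unfolding \<omega>_def by (rule automorphy_factor_nonzero[OF principal_congruence_subgroupD(1)[OF A] \<tau>])
  let ?E = "eisenstein 2 \<tau> - 2 * of_real pi * \<i> * of_nat (card (Z \<inter> {0..<int n})) / of_nat n * of_int (A $ 2 $ 1) / \<omega>"
  let ?g = "\<lambda>(m, d). (m * A $ 1 $ 1 + d * A $ 2 $ 1, m * A $ 1 $ 2 + d * A $ 2 $ 2)"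
  let ?f = "\<lambda>(m, d). \<omega> / ((of_int m * \<tau> + of_int d)\<^sup>2 * (of_int m * \<tau> + of_int d + \<omega>))"
  have "(?f has_sum ?E) (Z \<times> UNIV)"
    unfolding \<omega> using principal_congruence_subgroupD(1,5)[OF A] \<tau> by (intro eisenstein2_shifted_has_sum) auto
  hence "((\<lambda>x. ?f (?g x)) has_sum ?E) (Z \<times> UNIV)"
    using has_sum_reindex_bij_betw[OF bij_lattice[OF A], of ?f ?E] by simp
  hence "((\<lambda>x. \<omega>\<^sup>2 * ?f (?g x)) has_sum (\<omega>\<^sup>2 * ?E)) (Z \<times> UNIV)"
    by (rule has_sum_cmult_right)
  also have "(\<lambda>x. \<omega>\<^sup>2 * ?f (?g x)) = (\<lambda>(m, d). 1 / ((of_int m * moebius_action A \<tau> + of_int d)\<^sup>2 *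
                (of_int m * moebius_action A \<tau> + of_int d + 1)))"
  proof
    fix x :: "int \<times> int"
    obtain m d where x: "x = (m, d)" by force
    define u where "u = of_int (m * A $ 1 $ 1 + d * A $ 2 $ 1) * \<tau> + of_int (m * A $ 1 $ 2 + d * A $ 2 $ 2)"
    have "\<omega>\<^sup>2 * (\<omega> / (u\<^sup>2 * (u + \<omega>))) = 1 / ((u / \<omega>)\<^sup>2 * ((u + \<omega>) / \<omega>))"
      using \<omega>_nz by (simp add: power2_eq_square)
    also have "(u + \<omega>) / \<omega> = u / \<omega> + 1" using \<omega>_nz by (simp add: add_divide_distrib)
    finally show "\<omega>\<^sup>2 * ?f (?g x) = (case x of (m, d) \<Rightarrow> 1 / ((of_int m * moebius_action A \<tau> + of_int d)\<^sup>2 *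
                (of_int m * moebius_action A \<tau> + of_int d + 1)))"
      unfolding x prod.case lattice_moebius_action[OF A \<tau>] u_def \<omega>_def .
  qed
  finally have "eisenstein 2 (moebius_action A \<tau>) = \<omega>\<^sup>2 * ?E"
    using eisenstein2_has_sum[OF moebius_action_in_upper[OF A \<tau>]] has_sum_unique by blast
  also have "\<dots> = \<omega>\<^sup>2 * eisenstein 2 \<tau> -
     2 * of_real pi * \<i> * of_nat (card (Z \<inter> {0..<int n})) / of_nat n * of_int (A $ 2 $ 1) * \<omega>"
    using \<omega>_nz by (simp add: algebra_simps power2_eq_square)
  finally show ?thesis by (simp add: \<omega>_def)
qed

end

subsection \<open>Lambert series\<close>

lemma norm_infsum_diff_sum_le:
  fixes f :: "'a \<Rightarrow> complex"
  assumes M: "M summable_on I" "\<And>i. i \<in> I \<Longrightarrow> norm (f i) \<le> M i" and F: "finite F" "F \<subseteq> I"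
  shows "norm (infsum f I - sum f F) \<le> infsum M I - sum M F"
proof -
  have f: "(\<lambda>i. norm (f i)) summable_on I"
    by (rule Infinite_Sum.abs_summable_on_comparison_test'[OF M])
  have summ: "f summable_on I" "f summable_on F" "M summable_on F"
    using abs_summable_summable[OF f] F by (auto intro: summable_on_finite)
  have "infsum f I - sum f F = infsum f (I - F)"
    using infsum_Diff[OF summ(1,2) F(2)] F(1) by simp
  also have "norm \<dots> \<le> infsum M (I - F)"
    by (rule norm_infsum_le[OF has_sum_infsum[OF summable_on_subset[OF summ(1)]]
          has_sum_infsum[OF summable_on_subset[OF M(1)]]]) (use M(2) in auto)
  also have "\<dots> = infsum M I - sum M F"
    using infsum_Diff[OF M(1) summ(3) F(2)] F(1) by simp
  finally show ?thesis .
qed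

text \<open>The Weierstrass M-test along the filter of finite subsets: the tail of the majorant
  bounds all remainders at once.\<close>

lemma uniform_limit_infsum:
  fixes f :: "'a \<Rightarrow> 'b \<Rightarrow> complex"
  assumes M: "M summable_on I" "\<And>i x. i \<in> I \<Longrightarrow> x \<in> A \<Longrightarrow> norm (f i x) \<le> M i"
  shows "uniform_limit A (\<lambda>F x. \<Sum>i\<in>F. f i x) (\<lambda>x. infsum (\<lambda>i. f i x) I) (finite_subsets_at_top I)"
proof (rule uniform_limitI)
  fix e :: real assume e: "e > 0"
  have "eventually (\<lambda>F. dist (sum M F) (infsum M I) < e) (finite_subsets_at_top I)"
    using infsum_tendsto[OF M(1)] e by (rule tendstoD)
  moreover have "eventually (\<lambda>F. finite F \<and> F \<subseteq> I) (finite_subsets_at_top I)"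
    by (rule eventually_finite_subsets_at_top_weakI) auto
  ultimately show "eventually (\<lambda>F. \<forall>x\<in>A. dist (\<Sum>i\<in>F. f i x) (infsum (\<lambda>i. f i x) I) < e) (finite_subsets_at_top I)"
  proof eventually_elim
    case (elim F)
    show ?case
    proof
      fix x assume "x \<in> A"
      hence "norm (infsum (\<lambda>i. f i x) I - (\<Sum>i\<in>F. f i x)) \<le> infsum M I - sum M F"
        using elim M by (intro norm_infsum_diff_sum_le) auto
      also have "\<dots> < e" using elim by (auto simp: dist_norm abs_if split: if_splits)
      finally show "dist (\<Sum>i\<in>F. f i x) (infsum (\<lambda>i. f i x) I) < e"
        by (simp add: dist_norm norm_minus_commute)
    qed
  qed
qed

text \<open>By the M-test, convergence of the finite partial sums is uniform in N, so the limit in N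
  may be exchanged with the sum.\<close>

lemma tendsto_infsum_dominated:
  fixes f :: "nat \<Rightarrow> 'a \<Rightarrow> complex"
  assumes M: "M summable_on I" "\<And>N i. i \<in> I \<Longrightarrow> norm (f N i) \<le> M i"
  assumes lim: "\<And>i. i \<in> I \<Longrightarrow> (\<lambda>N. f N i) \<longlonglongrightarrow> g i"
  shows "(\<lambda>N. infsum (f N) I) \<longlonglongrightarrow> infsum g I"
proof (rule swap_uniform_limit'[where F = "finite_subsets_at_top I" and S = UNIV and f = "\<lambda>F N. sum (f N) F" and g = "\<lambda>F. sum g F"])
  show "\<forall>\<^sub>F F in finite_subsets_at_top I. ((\<lambda>N. sum (f N) F) \<longlongrightarrow> sum g F) sequentially"
    using lim by (intro eventually_finite_subsets_at_top_weakI tendsto_sum) auto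
  have "norm (g i) \<le> M i" if "i \<in> I" for i
    using LIMSEQ_le_const2[OF tendsto_norm[OF lim[OF that]]] M(2)[OF that] by blast
  hence "g summable_on I"
    by (rule abs_summable_summable[OF Infinite_Sum.abs_summable_on_comparison_test'[OF M(1)]])
  thus "(sum g \<longlongrightarrow> infsum g I) (finite_subsets_at_top I)" by (rule infsum_tendsto)
  show "uniform_limit UNIV (\<lambda>F N. sum (f N) F) (\<lambda>N. infsum (f N) I) (finite_subsets_at_top I)"
    by (rule uniform_limit_infsum[OF M(1)]) (use M(2) in auto)
qed auto

lemma holomorphic_on_infsum:
  assumes "open S" "\<And>i. i \<in> I \<Longrightarrow> f i holomorphic_on S"
  assumes bound: "\<And>x. x \<in> S \<Longrightarrow> \<exists>d>0. \<exists>M. cball x d \<subseteq> S \<and> M summable_on I \<and>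
                     (\<forall>i\<in>I. \<forall>z\<in>cball x d. norm (f i z) \<le> M i)"
  shows "(\<lambda>z. infsum (\<lambda>i. f i z) I) holomorphic_on S"
proof -
  have "(\<lambda>z. infsum (\<lambda>i. f i z) I) field_differentiable (at x)" if x: "x \<in> S" for x
  proof -
    obtain d M where d: "d > 0" "cball x d \<subseteq> S" "M summable_on I" "\<forall>i\<in>I. \<forall>z\<in>cball x d. norm (f i z) \<le> M i"
      using bound[OF x] by blast
    have lim: "uniform_limit (cball x d) (\<lambda>F z. \<Sum>i\<in>F. f i z) (\<lambda>z. infsum (\<lambda>i. f i z) I) (finite_subsets_at_top I)"
      by (rule uniform_limit_infsum[OF d(3)]) (use d(4) in auto)
    have "eventually (\<lambda>F. continuous_on (cball x d) (\<lambda>z. \<Sum>i\<in>F. f i z) \<and> (\<lambda>z. \<Sum>i\<in>F. f i z) holomorphic_on ball x d) (finite_subsets_at_top I)"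
    proof (rule eventually_finite_subsets_at_top_weakI)
      fix F assume F: "finite F" "F \<subseteq> I"
      have "(\<lambda>z. \<Sum>i\<in>F. f i z) holomorphic_on cball x d"
        using F d(2) assms(2) by (intro holomorphic_intros) (meson holomorphic_on_subset subsetD)
      thus "continuous_on (cball x d) (\<lambda>z. \<Sum>i\<in>F. f i z) \<and> (\<lambda>z. \<Sum>i\<in>F. f i z) holomorphic_on ball x d"
        using holomorphic_on_imp_continuous_on holomorphic_on_subset[OF _ ball_subset_cball] by auto
    qed
    hence "(\<lambda>z. infsum (\<lambda>i. f i z) I) holomorphic_on ball x d"
      by (rule holomorphic_uniform_limit[OF _ lim finite_subsets_at_top_neq_bot])
    thus ?thesis using d(1) by (auto intro!: holomorphic_on_imp_differentiable_at)
  qed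
  thus ?thesis by (auto simp: holomorphic_on_def intro: field_differentiable_at_within)
qed

text \<open>The exponential series is bounded below by its single term of order j.\<close>

lemma exp_minus_le_fact_divide_power:
  fixes u :: real
  assumes "u > 0"
  shows "exp (- u) \<le> fact j / u ^ j"
proof -
  have "(\<Sum>i\<in>{j}. u ^ i /\<^sub>R fact i) \<le> (\<Sum>i. u ^ i /\<^sub>R fact i)"
    using assms by (intro sum_le_suminf summable_exp_generic) auto
  hence "u ^ j / fact j \<le> exp u" by (simp add: exp_def divide_inverse mult_ac)
  hence "1 / exp u \<le> 1 / (u ^ j / fact j)" using assms by (intro frac_le) auto
  thus ?thesis by (simp add: exp_minus inverse_eq_divide)
qed

text \<open>The coefficient of q^N is the sum of r^k over the divisors r of N with N / r in T: the
  q-expansion of an Eisenstein series without constant term.\<close>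

definition lambert :: "nat set \<Rightarrow> nat \<Rightarrow> complex \<Rightarrow> complex" where
  "lambert T k \<tau> = (\<Sum>\<^sub>\<infinity>(m, r)\<in>T \<times> {1..}. of_nat r ^ k * exp (2 * of_real pi * \<i> * \<tau>) ^ (m * r))"

text \<open>Exponential decay is traded for the power k + 2 of 1 / (m * r * Im tau): k powers of r
  cancel r^k and two remain for convergence. The explicit power of Im tau yields both moderate
  growth and local uniformity.\<close>

lemma norm_lambert_term_le:
  fixes m r k :: nat
  assumes "Im \<tau> > 0" "m > 0" "r > 0"
  shows "norm (of_nat r ^ k * exp (2 * of_real pi * \<i> * \<tau>) ^ (m * r)) \<le>
           fact (k + 2) / (2 * pi) ^ (k + 2) / Im \<tau> ^ (k + 2) * (1 / real m ^ 2 * (1 / real r ^ 2))"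
proof -
  have "norm (of_nat r ^ k * exp (2 * of_real pi * \<i> * \<tau>) ^ (m * r)) = real r ^ k * exp (- (2 * pi * Im \<tau> * m * r))"
    by (simp add: norm_mult norm_power norm_exp_eq_Re exp_of_nat_mult[symmetric] mult_ac)
  also have "\<dots> \<le> real r ^ k * (fact (k + 2) / (2 * pi * Im \<tau> * m * r) ^ (k + 2))"
    using assms by (intro mult_left_mono exp_minus_le_fact_divide_power) auto
  also have "\<dots> = fact (k + 2) / (2 * pi) ^ (k + 2) / Im \<tau> ^ (k + 2) * (1 / real m ^ (k + 2) * (1 / real r ^ 2))"
    using assms by (simp add: power_mult_distrib power_add power2_eq_square)
  also have "\<dots> \<le> fact (k + 2) / (2 * pi) ^ (k + 2) / Im \<tau> ^ (k + 2) * (1 / real m ^ 2 * (1 / real r ^ 2))"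
    using assms by (intro mult_left_mono mult_right_mono frac_le power_increasing) auto
  finally show ?thesis .
qed

lemma summable_on_inverse_squares:
  assumes "0 \<notin> T"
  shows "(\<lambda>(m, r). 1 / real m ^ 2 * (1 / real r ^ 2)) summable_on T \<times> {1..}"
proof -
  have *: "(\<lambda>r::nat. 1 / real r ^ 2) summable_on A" for A
  proof (rule summable_on_subset)
    show "(\<lambda>r::nat. 1 / real r ^ 2) summable_on UNIV"
      using inverse_power_summable[of 2, where 'a = real]
      by (subst summable_on_UNIV_nonneg_real_iff) (auto simp: divide_inverse)
  qed auto
  show ?thesis by (intro summable_on_prod_nonneg *) auto
qed

context
  fixes T :: "nat set"
  assumes T: "0 \<notin> T"
begin

lemma abs_summable_lambert:
  assumes "Im \<tau> > 0"
  shows "(\<lambda>x. norm (case x of (m, r) \<Rightarrow> of_nat r ^ k * exp (2 * of_real pi * \<i> * \<tau>) ^ (m * r))) summable_on T \<times> {1..}"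
proof -
  let ?C = "fact (k + 2) / (2 * pi) ^ (k + 2) / Im \<tau> ^ (k + 2)"
  show ?thesis
  proof (rule Infinite_Sum.abs_summable_on_comparison_test')
    show "(\<lambda>x. ?C * (case x of (m, r) \<Rightarrow> 1 / real m ^ 2 * (1 / real r ^ 2))) summable_on T \<times> {1..}"
      by (rule summable_on_cmult_right[OF summable_on_inverse_squares[OF T]])
    fix x assume x: "x \<in> T \<times> {1::nat..}"
    obtain m r where "x = (m, r)" by force
    with x T show "norm (case x of (m, r) \<Rightarrow> of_nat r ^ k * exp (2 * of_real pi * \<i> * \<tau>) ^ (m * r)) \<le>
        ?C * (case x of (m, r) \<Rightarrow> 1 / real m ^ 2 * (1 / real r ^ 2))"
      using norm_lambert_term_le[OF assms, of m r k] by (auto simp: Suc_le_eq intro!: Nat.gr0I)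
  qed
qed

lemma lambert_has_sum:
  assumes "Im \<tau> > 0"
  shows "((\<lambda>(m, r). of_nat r ^ k * exp (2 * of_real pi * \<i> * \<tau>) ^ (m * r)) has_sum lambert T k \<tau>) (T \<times> {1..})"
  unfolding lambert_def by (rule has_sum_infsum[OF abs_summable_summable[OF abs_summable_lambert[OF assms]]])

lemma lambert_inner_has_sum:
  assumes "Im \<tau> > 0" "m > 0" "k > 0"
  shows "((\<lambda>r. of_nat r ^ k * exp (2 * of_real pi * \<i> * \<tau>) ^ (m * r)) has_sum
            moment_series k (exp (2 * of_real pi * \<i> * (of_nat m * \<tau>)))) {1..}"
proof -
  let ?x = "exp (2 * of_real pi * \<i> * (of_nat m * \<tau>))"
  have x: "norm ?x < 1" using assms by (intro norm_exp_2pi_i) auto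
  have "?x = exp (2 * of_real pi * \<i> * \<tau>) ^ m" by (simp add: exp_of_nat_mult[symmetric] mult_ac)
  hence eq: "of_nat r ^ k * exp (2 * of_real pi * \<i> * \<tau>) ^ (m * r) = of_nat r ^ k * ?x ^ r" for r
    by (simp add: power_mult)
  have "summable (\<lambda>r. norm (of_nat r ^ k * ?x ^ r))"
    using summable_norm_moment_series[OF x] .
  hence "((\<lambda>r. of_nat r ^ k * ?x ^ r) has_sum moment_series k ?x) UNIV"
    unfolding moment_series_def using summable_moment_series[OF x]
    by (intro norm_summable_imp_has_sum summable_sums)
  \<comment> \<open>The extra term r = 0 of the moment series is 0^k, which vanishes because k >
    0.\<close>
  also have "?this \<longleftrightarrow> ((\<lambda>r. of_nat r ^ k * ?x ^ r) has_sum moment_series k ?x) {1..}"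
    using assms by (intro has_sum_cong_neutral) (auto simp: not_le)
  finally show ?thesis unfolding eq .
qed

lemma lambert_outer_has_sum:
  assumes "Im \<tau> > 0" "k > 0"
  shows "((\<lambda>m. moment_series k (exp (2 * of_real pi * \<i> * (of_nat m * \<tau>)))) has_sum lambert T k \<tau>) T"
proof (rule has_sum_SigmaD[OF lambert_has_sum[OF assms(1)]])
  fix m assume "m \<in> T"
  with T have "m > 0" by (auto intro!: Nat.gr0I)
  thus "((\<lambda>r. case (m, r) of (m, r) \<Rightarrow> of_nat r ^ k * exp (2 * of_real pi * \<i> * \<tau>) ^ (m * r)) has_sum
          moment_series k (exp (2 * of_real pi * \<i> * (of_nat m * \<tau>)))) {1..}"
    unfolding prod.case by (rule lambert_inner_has_sum[OF assms(1) _ assms(2)])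
qed

lemma norm_lambert_le:
  assumes "Im \<tau> > 0"
  shows "norm (lambert T k \<tau>) \<le> fact (k + 2) / (2 * pi) ^ (k + 2) / Im \<tau> ^ (k + 2) *
           (\<Sum>\<^sub>\<infinity>(m, r)\<in>T \<times> {1..}. 1 / real m ^ 2 * (1 / real r ^ 2))"
proof (rule norm_infsum_le[OF lambert_has_sum[OF assms]])
  show "((\<lambda>x. fact (k + 2) / (2 * pi) ^ (k + 2) / Im \<tau> ^ (k + 2) * (case x of (m, r) \<Rightarrow> 1 / real m ^ 2 * (1 / real r ^ 2))) has_sum
        (fact (k + 2) / (2 * pi) ^ (k + 2) / Im \<tau> ^ (k + 2) *
           (\<Sum>\<^sub>\<infinity>(m, r)\<in>T \<times> {1..}. 1 / real m ^ 2 * (1 / real r ^ 2)))) (T \<times> {1..})"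
    by (rule has_sum_cmult_right[OF has_sum_infsum[OF summable_on_inverse_squares[OF T]]])
  fix x assume x: "x \<in> T \<times> {1::nat..}"
  obtain m r where "x = (m, r)" by force
  with x T show "norm (case x of (m, r) \<Rightarrow> of_nat r ^ k * exp (2 * of_real pi * \<i> * \<tau>) ^ (m * r)) \<le>
      fact (k + 2) / (2 * pi) ^ (k + 2) / Im \<tau> ^ (k + 2) * (case x of (m, r) \<Rightarrow> 1 / real m ^ 2 * (1 / real r ^ 2))"
    using norm_lambert_term_le[OF assms, of m r k] by (auto simp: Suc_le_eq intro!: Nat.gr0I)
qed

lemma moderate_growth_lambert: "moderate_growth (lambert T k)"
proof -
  define C where "C = fact (k + 2) / (2 * pi) ^ (k + 2) * (\<Sum>\<^sub>\<infinity>(m, r)\<in>T \<times> {1..}. 1 / real m ^ 2 * (1 / real r ^ 2))"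
  have C: "C \<ge> 0" unfolding C_def by (intro mult_nonneg_nonneg infsum_nonneg) auto
  have "norm (lambert T k \<tau>) \<le> C * (Im \<tau> ^ (k + 2) + 1 / Im \<tau> ^ (k + 2))" if "\<tau> \<in> upper_half_plane" for \<tau>
  proof -
    have \<tau>: "Im \<tau> > 0" using that by (simp add: upper_half_plane_def)
    have "norm (lambert T k \<tau>) \<le> C * (1 / Im \<tau> ^ (k + 2))"
      using norm_lambert_le[OF \<tau>, of k] by (simp add: C_def)
    also have "\<dots> \<le> C * (Im \<tau> ^ (k + 2) + 1 / Im \<tau> ^ (k + 2))"
      using \<tau> C by (intro mult_left_mono) auto
    finally show ?thesis .
  qed
  thus ?thesis unfolding moderate_growth_def by blast
qed

lemma holomorphic_lambert: "lambert T k holomorphic_on upper_half_plane"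
proof -
  have "(\<lambda>\<tau>. infsum (\<lambda>x. case x of (m, r) \<Rightarrow> of_nat r ^ k * exp (2 * of_real pi * \<i> * \<tau>) ^ (m * r)) (T \<times> {1..})) holomorphic_on upper_half_plane"
  proof (rule holomorphic_on_infsum)
    show "open upper_half_plane" by (simp add: upper_half_plane_def open_halfspace_Im_gt)
    show "(\<lambda>\<tau>. case x of (m, r) \<Rightarrow> of_nat r ^ k * exp (2 * of_real pi * \<i> * \<tau>) ^ (m * r)) holomorphic_on upper_half_plane" for x :: "nat \<times> nat"
      by (cases x) (auto intro!: holomorphic_intros)
    fix \<tau> assume "\<tau> \<in> upper_half_plane"
    hence \<tau>: "Im \<tau> > 0" by (simp add: upper_half_plane_def)
    define d where "d = Im \<tau> / 2"
    let ?C = "fact (k + 2) / (2 * pi) ^ (k + 2) / d ^ (k + 2)"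
    have d: "d > 0" using \<tau> by (simp add: d_def)
    have Im_ge: "Im z \<ge> d" if "z \<in> cball \<tau> d" for z
      using that abs_Im_le_cmod[of "\<tau> - z"] by (auto simp: dist_norm d_def)
    show "\<exists>d>0. \<exists>M. cball \<tau> d \<subseteq> upper_half_plane \<and> M summable_on (T \<times> {1..}) \<and>
        (\<forall>x\<in>T \<times> {1..}. \<forall>z\<in>cball \<tau> d. norm (case x of (m, r) \<Rightarrow> of_nat r ^ k * exp (2 * of_real pi * \<i> * z) ^ (m * r)) \<le> M x)"
    proof (intro exI[of _ d] conjI exI[of _ "\<lambda>x. ?C * (case x of (m, r) \<Rightarrow> 1 / real m ^ 2 * (1 / real r ^ 2))"] ballI)
      show "(\<lambda>x. ?C * (case x of (m, r) \<Rightarrow> 1 / real m ^ 2 * (1 / real r ^ 2))) summable_on T \<times> {1..}"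
        by (rule summable_on_cmult_right[OF summable_on_inverse_squares[OF T]])
      fix x z assume x: "x \<in> T \<times> {1::nat..}" and z: "z \<in> cball \<tau> d"
      obtain m r where mr: "x = (m, r)" by force
      have "m > 0" "r > 0" using x T by (auto simp: mr intro!: Nat.gr0I)
      hence "norm (of_nat r ^ k * exp (2 * of_real pi * \<i> * z) ^ (m * r)) \<le>
            fact (k + 2) / (2 * pi) ^ (k + 2) / Im z ^ (k + 2) * (1 / real m ^ 2 * (1 / real r ^ 2))"
        using Im_ge[OF z] d by (intro norm_lambert_term_le) auto
      also have "\<dots> \<le> ?C * (1 / real m ^ 2 * (1 / real r ^ 2))"
        using Im_ge[OF z] d by (intro mult_right_mono divide_left_mono power_mono mult_pos_pos) auto
      finally show "norm (case x of (m, r) \<Rightarrow> of_nat r ^ k * exp (2 * of_real pi * \<i> * z) ^ (m * r)) \<le>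
          ?C * (case x of (m, r) \<Rightarrow> 1 / real m ^ 2 * (1 / real r ^ 2))"
        by (simp add: mr)
    qed (use d Im_ge in \<open>force simp: upper_half_plane_def\<close>)+
  qed
  thus ?thesis by (simp add: lambert_def[abs_def])
qed

end

locale symmetric_periodic_set = periodic_set +
  assumes uminus: "m \<in> Z \<Longrightarrow> - m \<in> Z"
begin

text \<open>Lipschitz' formula evaluates each row m > 0. Row -m has the same sum, by d -> -d and
  evenness of the weight, which explains the factor 2. No row m = 0 is present to contribute a
  constant.\<close>

lemma eisenstein_eq_lambert:
  assumes \<tau>: "Im \<tau> > 0" and k: "odd k"
  shows "eisenstein (Suc k) \<tau> = 2 * (- 2 * of_real pi * \<i>) ^ Suc k / fact k * lambert {m. int m \<in> Z} k \<tau>"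
proof -
  let ?T = "{m. int m \<in> Z}"
  define c where "c = (- 2 * of_real pi * \<i>) ^ Suc k / fact k"
  define L where "L = (\<lambda>m::nat. moment_series k (exp (2 * of_real pi * \<i> * (of_nat m * \<tau>))))"
  have k0: "k > 0" using k by (auto intro!: Nat.gr0I)
  have pos: "((\<lambda>d::int. 1 / (of_int (int m) * \<tau> + of_int d) ^ Suc k) has_sum c * L m) UNIV" if "m > 0" for m
    using Lipschitz_formula[of "of_nat m * \<tau>" k] that \<tau> k0 by (simp add: c_def L_def)
  have neg: "((\<lambda>d::int. 1 / (of_int (- int m) * \<tau> + of_int d) ^ Suc k) has_sum c * L m) UNIV" if "m > 0" for m
  proof -
    have "(of_int (- int m) * \<tau> + of_int d) ^ Suc k = (of_int (int m) * \<tau> + of_int (- d)) ^ Suc k" for d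
    proof -
      have "of_int (- int m) * \<tau> + of_int d = - (of_int (int m) * \<tau> + of_int (- d))" by simp
      moreover have "even (Suc k)" using k by simp
      ultimately show ?thesis by (simp only: power_minus_even)
    qed
    moreover have "((\<lambda>d::int. 1 / (of_int (int m) * \<tau> + of_int (- d)) ^ Suc k) has_sum c * L m) UNIV"
      using pos[OF that] by (subst has_sum_reindex_bij_witness[of _ uminus uminus UNIV "\<lambda>d. 1 / (of_int (int m) * \<tau> + of_int d) ^ Suc k"]) auto
    ultimately show ?thesis by simp
  qed
  have T0: "0 \<notin> ?T" using zero_notin by simp
  have L: "(L has_sum lambert ?T k \<tau>) ?T"
    unfolding L_def by (rule lambert_outer_has_sum[OF T0 \<tau> k0])
  have "((\<lambda>m. c * L (nat \<bar>m\<bar>)) has_sum (c * lambert ?T k \<tau>)) (Z \<inter> {0..})"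
    using has_sum_cmult_right[OF L, of c]
    by (subst has_sum_reindex_bij_witness[of _ int nat ?T "\<lambda>m. c * L m"]) auto
  moreover have "((\<lambda>m. c * L (nat \<bar>m\<bar>)) has_sum (c * lambert ?T k \<tau>)) (Z \<inter> {..<0})"
    using has_sum_cmult_right[OF L, of c] uminus zero_notin
    by (subst has_sum_reindex_bij_witness[of _ "\<lambda>m. - int m" "\<lambda>m. nat (- m)" ?T "\<lambda>m. c * L m"])
       (auto intro!: Nat.gr0I)
  ultimately have "((\<lambda>m. c * L (nat \<bar>m\<bar>)) has_sum (c * lambert ?T k \<tau> + c * lambert ?T k \<tau>)) (Z \<inter> {0..} \<union> Z \<inter> {..<0})"
    by (intro has_sum_Un_disjoint) auto
  also have "Z \<inter> {0..} \<union> Z \<inter> {..<0} = Z" by auto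
  finally have "infsum (\<lambda>m. c * L (nat \<bar>m\<bar>)) Z = 2 * c * lambert ?T k \<tau>" by (simp add: infsumI)
  moreover have "infsum (\<lambda>m. c * L (nat \<bar>m\<bar>)) Z = eisenstein (Suc k) \<tau>"
    unfolding eisenstein_def
  proof (rule infsum_cong)
    fix m assume m: "m \<in> Z"
    hence "m \<noteq> 0" using zero_notin by auto
    thus "c * L (nat \<bar>m\<bar>) = (\<Sum>\<^sub>\<infinity>d\<in>UNIV. 1 / (of_int m * \<tau> + of_int d) ^ Suc k)"
      using infsumI[OF pos[of "nat m"]] infsumI[OF neg[of "nat (- m)"]] by (cases "m > 0") auto
  qed
  ultimately show ?thesis by (simp add: c_def)
qed

text \<open>Each property is taken from the convenient side of the identity: the transformation law
  from the lattice sum, holomorphy and growth from the Lambert series.\<close>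

lemma quasi_modular_form_lambert:
  assumes k: "odd k"
  shows "quasi_modular_form (principal_congruence_subgroup n) (Suc k) (lambert {m. int m \<in> Z} k)"
proof -
  let ?L = "lambert {m. int m \<in> Z} k"
  define c where "c = 2 * (- 2 * of_real pi * \<i>) ^ Suc k / fact k"
  have c: "c \<noteq> 0" by (simp add: c_def)
  have L: "?L \<tau> = eisenstein (Suc k) \<tau> / c" if "Im \<tau> > 0" for \<tau>
    using eisenstein_eq_lambert[OF that k] c by (simp add: c_def)
  have hol: "?L holomorphic_on upper_half_plane" "moderate_growth ?L"
    using zero_notin by (auto intro!: holomorphic_lambert moderate_growth_lambert)
  show ?thesis
  proof (cases "k = 1")
    case False
    with k have k3: "Suc k \<ge> 3" by (cases k) auto
    have "?L (moebius_action A \<tau>) = automorphy_factor A \<tau> ^ Suc k * ?L \<tau>"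
      if "A \<in> principal_congruence_subgroup n" "Im \<tau> > 0" for A \<tau>
      using that by (simp only: L moebius_action_in_upper eisenstein_transform[OF that k3] times_divide_eq_right)
    hence "almost_holomorphic_modular_form (principal_congruence_subgroup n) (Suc k) 0 (\<lambda>_. ?L)"
      using hol by (simp add: almost_holomorphic_modular_form_def Let_def upper_half_plane_def)
    thus ?thesis unfolding quasi_modular_form_def by blast
  next
    case True
    \<comment> \<open>For omega the automorphy factor, C its lower left entry and y = Im tau, the
      conjugate of omega is omega - 2 * i * C * y, so 1 / y becomes omega^2 / y - 2 * i * C * omega.
      This value of kappa makes kappa / y cancel the anomaly 2 * i * kappa * C * omega.\<close>
    define \<kappa> :: complex where "\<kappa> = - of_real pi * of_nat (card (Z \<inter> {0..<int n})) / of_nat n"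
    define f where "f = (\<lambda>r::nat. if r = 0 then ?L else (\<lambda>_. \<kappa> / c))"
    have L2: "?L \<tau> = eisenstein 2 \<tau> / c" if "Im \<tau> > 0" for \<tau>
      using L[OF that] by (simp add: True numeral_2_eq_2)
    have "?L (moebius_action A \<tau>) + \<kappa> / c / of_real (Im (moebius_action A \<tau>)) =
            automorphy_factor A \<tau> ^ 2 * (?L \<tau> + \<kappa> / c / of_real (Im \<tau>))"
      if A: "A \<in> principal_congruence_subgroup n" and \<tau>: "Im \<tau> > 0" for A \<tau>
    proof -
      define \<omega> where "\<omega> = automorphy_factor A \<tau>"
      define y where "y = (of_real (Im \<tau>) :: complex)"
      have y: "y \<noteq> 0" using \<tau> by (simp add: y_def)
      define C where "C = (of_int (A $ 2 $ 1) :: complex)"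
      note det = principal_congruence_subgroupD(1)[OF A]
      have \<omega>: "\<omega> \<noteq> 0" unfolding \<omega>_def by (rule automorphy_factor_nonzero[OF det \<tau>])
      have "cnj \<omega> = \<omega> - 2 * \<i> * C * y"
        by (simp add: \<omega>_def automorphy_factor_def complex_eq_iff C_def y_def)
      moreover have "complex_of_real ((norm \<omega>)\<^sup>2) = \<omega> * cnj \<omega>"
        by (rule complex_norm_square)
      ultimately have "of_real (Im (moebius_action A \<tau>)) = y / (\<omega> * (\<omega> - 2 * \<i> * C * y))"
        by (simp add: Im_moebius_action[OF det \<tau>] y_def \<omega>_def)
      moreover have "eisenstein 2 (moebius_action A \<tau>) = \<omega>\<^sup>2 * eisenstein 2 \<tau> + 2 * \<i> * \<kappa> * C * \<omega>"
        by (simp add: eisenstein2_transform[OF A \<tau>] \<omega>_def C_def \<kappa>_def)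
      ultimately show ?thesis
        unfolding L2[OF \<tau>] L2[OF moebius_action_in_upper[OF A \<tau>]] y_def[symmetric] \<omega>_def[symmetric]
        using c y by (simp add: field_simps power2_eq_square)
    qed
    hence "almost_holomorphic_modular_form (principal_congruence_subgroup n) (Suc k) 1 f"
      using hol by (auto simp: almost_holomorphic_modular_form_def Let_def upper_half_plane_def f_def True numeral_2_eq_2)
    thus ?thesis unfolding quasi_modular_form_def by (intro exI[of _ 1] exI[of _ f]) (auto simp: f_def)
  qed
qed

end

subsection \<open>The generating function\<close>

text \<open>In closed form -4 * sinh (z / 2)^2, hence of order exactly 2 with leading coefficient
  -1.\<close>

definition X_fps :: "complex fps" where
  "X_fps = 2 - fps_exp 1 - fps_exp (- 1)"

text \<open>Factoring z^2 out of \<open>X_fps\<close> shows that its k-th power has order exactly 2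
  * k. This makes coefficient sums finite and the system for the A_k triangular.\<close>

lemma X_fps_power_nth:
  "i < 2 * k \<Longrightarrow> fps_nth (X_fps ^ k) i = 0"
  "fps_nth (X_fps ^ k) (2 * k) = (-1) ^ k"
proof -
  have nth2: "fps_nth X_fps 2 = -1" by (simp add: X_fps_def fps_numeral_nth)
  have "i < 2 \<Longrightarrow> fps_nth X_fps i = 0" for i
    by (cases i) (auto simp: X_fps_def fps_numeral_nth less_Suc_eq)
  hence "2 \<le> subdegree X_fps"
    using nth2 by (intro subdegree_geI) (auto simp: fps_eq_iff intro!: exI[of _ 2])
  hence X: "X_fps = fps_shift 2 X_fps * fps_X ^ 2"
    by (rule fps_shift_times_fps_X_power[symmetric])
  have *: "X_fps ^ k = fps_shift 2 X_fps ^ k * fps_X ^ (2 * k)"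
    by (subst X) (simp add: power_mult_distrib power_mult)
  show "i < 2 * k \<Longrightarrow> fps_nth (X_fps ^ k) i = 0" "fps_nth (X_fps ^ k) (2 * k) = (-1) ^ k"
    unfolding * by (simp_all add: fps_X_power_mult_right_nth fps_nth_power_0 nth2 nth2[unfolded numeral_2_eq_2])
qed

text \<open>The coefficients c are fixed before A and W are given. This order of quantifiers is what
  makes the final constants independent of n, S and tau.\<close>

lemma triangular_inverse:
  fixes M :: "nat \<Rightarrow> nat \<Rightarrow> complex"
  assumes M: "\<And>k. M k k \<noteq> 0"
  obtains c where "\<And>A W k. (\<And>w. W w = (\<Sum>j\<le>w. M w j * A j)) \<Longrightarrow> A k = (\<Sum>w\<le>k. c k w * W w)"
proof -
  have "\<exists>c. \<forall>A W. (\<forall>w. W w = (\<Sum>j\<le>w. M w j * A j)) \<longrightarrow> A k = (\<Sum>w\<le>k. c w * W w)" for k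
  proof (induction k rule: less_induct)
    case (less k)
    then obtain c where c: "\<And>j A W. j < k \<Longrightarrow> (\<forall>w. W w = (\<Sum>j\<le>w. M w j * A j)) \<Longrightarrow> A j = (\<Sum>w\<le>j. c j w * W w)"
      by metis
    \<comment> \<open>Rows of different lengths are padded with zeros so that all of them can be
      summed over w <= k.\<close>
    define c' where "c' = (\<lambda>j w. if w \<le> j then c j w else 0)"
    define d where "d = (\<lambda>w. ((if w = k then 1 else 0) - (\<Sum>j<k. M k j * c' j w)) / M k k)"
    have "A k = (\<Sum>w\<le>k. d w * W w)" if W: "\<forall>w. W w = (\<Sum>j\<le>w. M w j * A j)" for A W
    proof -
      have A: "A j = (\<Sum>w\<le>k. c' j w * W w)" if "j < k" for j
        unfolding c[OF that W] using that
        by (intro sum.mono_neutral_cong_left) (auto simp: c'_def)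
      have "W k = (\<Sum>j<k. M k j * A j) + M k k * A k"
        using W by (simp add: lessThan_Suc_atMost[symmetric])
      also have "(\<Sum>j<k. M k j * A j) = (\<Sum>j<k. \<Sum>w\<le>k. M k j * c' j w * W w)"
        by (intro sum.cong refl) (simp add: A sum_distrib_left mult_ac)
      also have "\<dots> = (\<Sum>w\<le>k. (\<Sum>j<k. M k j * c' j w) * W w)"
        by (subst sum.swap) (simp add: sum_distrib_right)
      finally have "A k = (W k - (\<Sum>w\<le>k. (\<Sum>j<k. M k j * c' j w) * W w)) / M k k"
        using M[of k] by (simp add: field_simps)
      also have "W k = (\<Sum>w\<le>k. (if w = k then 1 else 0) * W w)"
        by (simp add: if_distrib[of "\<lambda>x. x * _"] sum.delta cong: if_cong)
      finally show ?thesis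
        by (simp add: d_def sum_subtractf[symmetric] sum_divide_distrib algebra_simps)
    qed
    thus ?case by blast
  qed
  then obtain c where "\<And>k A W. (\<forall>w. W w = (\<Sum>j\<le>w. M w j * A j)) \<Longrightarrow> A k = (\<Sum>w\<le>k. c k w * W w)"
    by metis
  thus ?thesis using that[of c] by blast
qed

section \<open>Elementary symmetric functions and the series A_k\<close>

definition esym :: "(nat \<Rightarrow> 'a :: comm_ring_1) \<Rightarrow> nat set \<Rightarrow> nat \<Rightarrow> 'a" where
  "esym a T k = (\<Sum>U | U \<subseteq> T \<and> card U = k. \<Prod>m\<in>U. a m)"

lemma prod_fps_const: "(\<Prod>m\<in>U. fps_const (a m)) = fps_const (\<Prod>m\<in>U. a m :: 'a :: comm_ring_1)"
  by (induction U rule: infinite_finite_induct) auto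

text \<open>The product is expanded over subsets U of T and grouped by cardinality. Subsets with
  more than i elements drop out, since the corresponding power of \<open>X_fps\<close> has order
  beyond i.\<close>

lemma fps_nth_prod_one_plus_X:
  assumes "finite T"
  shows "fps_nth (\<Prod>m\<in>T. 1 + fps_const (a m) * X_fps) i = (\<Sum>k\<le>i. fps_nth (X_fps ^ k) i * esym a T k)"
proof -
  have "(\<Prod>m\<in>T. fps_const (a m) * X_fps + 1) = (\<Sum>U\<in>Pow T. (\<Prod>m\<in>U. fps_const (a m) * X_fps) * (\<Prod>m\<in>T - U. 1))"
    by (rule prod_add[OF assms])
  also have "\<dots> = (\<Sum>U\<in>Pow T. fps_const (\<Prod>m\<in>U. a m) * X_fps ^ card U)"
    by (intro sum.cong refl) (simp add: prod.distrib prod_fps_const)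
  finally have "fps_nth (\<Prod>m\<in>T. 1 + fps_const (a m) * X_fps) i =
      (\<Sum>U\<in>Pow T. (\<Prod>m\<in>U. a m) * fps_nth (X_fps ^ card U) i)"
    by (simp add: fps_sum_nth add.commute)
  also have "\<dots> = (\<Sum>U | U \<in> Pow T \<and> card U \<le> i. (\<Prod>m\<in>U. a m) * fps_nth (X_fps ^ card U) i)"
  proof (rule sum.mono_neutral_right)
    have "fps_nth (X_fps ^ card U) i = 0" if "\<not> card U \<le> i" for U :: "nat set"
      using that by (intro X_fps_power_nth) auto
    thus "\<forall>U\<in>Pow T - {U. U \<in> Pow T \<and> card U \<le> i}. (\<Prod>m\<in>U. a m) * fps_nth (X_fps ^ card U) i = 0"
      by auto
  qed (use assms in auto)
  also have "\<dots> = (\<Sum>k\<le>i. \<Sum>U | U \<in> {U. U \<in> Pow T \<and> card U \<le> i} \<and> card U = k. (\<Prod>m\<in>U. a m) * fps_nth (X_fps ^ card U) i)"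
    using assms by (intro sum.group[symmetric]) auto
  also have "\<dots> = (\<Sum>k\<le>i. fps_nth (X_fps ^ k) i * esym a T k)"
    unfolding esym_def sum_distrib_left by (intro sum.cong refl) (auto simp: mult_ac)
  finally show ?thesis .
qed

text \<open>Every finite partial sum is dominated by the sum over all subsets of a finite set, which
  is a product of factors 1 + |a m| and so at most exp of the sum of the |a m|.\<close>

lemma abs_summable_on_card_subsets:
  fixes a :: "nat \<Rightarrow> complex"
  assumes a: "(\<lambda>m. norm (a m)) summable_on T"
  shows "(\<lambda>U. norm (\<Prod>m\<in>U. a m)) summable_on {U. U \<subseteq> T \<and> finite U \<and> card U = k}"
proof (rule nonneg_bdd_above_summable_on)
  let ?K = "{U. U \<subseteq> T \<and> finite U \<and> card U = k}"
  show "bdd_above (sum (\<lambda>U. norm (\<Prod>m\<in>U. a m)) ` {F. F \<subseteq> ?K \<and> finite F})"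
  proof (rule bdd_aboveI2)
    fix F assume F: "F \<in> {F. F \<subseteq> ?K \<and> finite F}"
    hence fin: "finite (\<Union>F)" "\<Union>F \<subseteq> T" by auto
    have "(\<Sum>U\<in>F. norm (\<Prod>m\<in>U. a m)) \<le> (\<Sum>U\<in>Pow (\<Union>F). \<Prod>m\<in>U. norm (a m))"
      using F fin by (simp add: prod_norm[symmetric], intro sum_mono2) (auto intro!: prod_nonneg)
    also have "\<dots> = (\<Prod>m\<in>\<Union>F. norm (a m) + 1)"
      by (subst prod_add[OF fin(1)]) simp
    also have "\<dots> \<le> (\<Prod>m\<in>\<Union>F. exp (norm (a m)))"
      using exp_ge_add_one_self by (intro prod_mono) (auto simp: add.commute)
    also have "\<dots> = exp (\<Sum>m\<in>\<Union>F. norm (a m))" using fin by (simp add: exp_sum)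
    also have "\<dots> \<le> exp (infsum (\<lambda>m. norm (a m)) T)"
      using finite_sum_le_infsum[OF a fin] by simp
    finally show "(\<Sum>U\<in>F. norm (\<Prod>m\<in>U. a m)) \<le> exp (infsum (\<lambda>m. norm (a m)) T)" .
  qed
qed auto

text \<open>Stated for an arbitrary exhaustion of T, because two are needed: initial segments for
  the recursion, and equally many members of each residue class for the theta product.\<close>

lemma esym_tendsto:
  fixes a :: "nat \<Rightarrow> complex"
  assumes a: "(\<lambda>m. norm (a m)) summable_on T"
  assumes lim: "filterlim Ts (finite_subsets_at_top T) sequentially"
  shows "(\<lambda>N. esym a (Ts N) k) \<longlonglongrightarrow> (\<Sum>\<^sub>\<infinity>U\<in>{U. U \<subseteq> T \<and> finite U \<and> card U = k}. \<Prod>m\<in>U. a m)"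
proof -
  let ?K = "{U. U \<subseteq> T \<and> finite U \<and> card U = k}"
  have "(\<lambda>U. \<Prod>m\<in>U. a m) summable_on ?K"
    by (rule abs_summable_summable[OF abs_summable_on_card_subsets[OF a]])
  hence "((\<lambda>F. \<Sum>U\<in>F. \<Prod>m\<in>U. a m) \<longlongrightarrow> (\<Sum>\<^sub>\<infinity>U\<in>?K. \<Prod>m\<in>U. a m)) (finite_subsets_at_top ?K)"
    by (rule infsum_tendsto)
  moreover have "filterlim (\<lambda>N. {U. U \<subseteq> Ts N \<and> card U = k}) (finite_subsets_at_top ?K) sequentially"
    unfolding filterlim_finite_subsets_at_top
  proof safe
    fix F assume F: "finite F" "F \<subseteq> ?K"
    have "finite (\<Union>F)" "\<Union>F \<subseteq> T" using F by auto
    with lim have "eventually (\<lambda>N. finite (Ts N) \<and> \<Union>F \<subseteq> Ts N \<and> Ts N \<subseteq> T) sequentially"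
      unfolding filterlim_finite_subsets_at_top by blast
    thus "\<forall>\<^sub>F N in sequentially. finite {U. U \<subseteq> Ts N \<and> card U = k} \<and> F \<subseteq> {U. U \<subseteq> Ts N \<and> card U = k} \<and>
              {U. U \<subseteq> Ts N \<and> card U = k} \<subseteq> ?K"
      by eventually_elim (use F in \<open>auto intro: finite_subset\<close>)
  qed
  ultimately show ?thesis unfolding esym_def by (rule filterlim_compose)
qed

text \<open>Strictly increasing lists correspond to finite sets. Finiteness must be demanded
  explicitly since infinite sets have \<open>card\<close> 0 and would spoil k = 0.\<close>

lemma A_series_eq_infsum_sets:
  assumes "T = {m. 0 < m \<and> (\<exists>s\<in>S. [m = s] (mod n))}"
  shows "A_series S n k q =
           (\<Sum>\<^sub>\<infinity>U\<in>{U. U \<subseteq> T \<and> finite U \<and> card U = k}. \<Prod>m\<in>U. q ^ m / (1 - q ^ m)\<^sup>2)"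
  unfolding A_series_def
proof (rule infsum_reindex_bij_witness[of _ sorted_list_of_set set])
  fix ms :: "nat list" assume "ms \<in> {ms. length ms = k \<and> sorted_wrt (<) ms \<and> (\<forall>m\<in>set ms. 0 < m \<and> (\<exists>s\<in>S. [m = s] (mod n)))}"
  hence ms: "length ms = k" "sorted_wrt (<) ms" "set ms \<subseteq> T" by (auto simp: assms)
  hence d: "sorted ms" "distinct ms" by (auto simp: strict_sorted_iff)
  show "sorted_list_of_set (set ms) = ms" using d by (rule sorted_list_of_set.idem_if_sorted_distinct)
  show "set ms \<in> {U. U \<subseteq> T \<and> finite U \<and> card U = k}" using ms d by (auto simp: distinct_card)
  have "q ^ sum_list ms = (\<Prod>m\<leftarrow>ms. q ^ m)" by (induction ms) (auto simp: power_add)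
  thus "(\<Prod>m\<in>set ms. q ^ m / (1 - q ^ m)\<^sup>2) = q ^ sum_list ms / (\<Prod>m\<leftarrow>ms. (1 - q ^ m)\<^sup>2)"
    using d by (simp add: prod_dividef prod.distinct_set_conv_list)
qed (auto simp: assms)

lemma abs_summable_A_factor:
  fixes q :: complex
  assumes "norm q < 1" "0 \<notin> T"
  shows "(\<lambda>m. norm (q ^ m / (1 - q ^ m)\<^sup>2)) summable_on T"
proof (rule Infinite_Sum.abs_summable_on_comparison_test')
  have "(\<lambda>m. norm q ^ m) summable_on UNIV"
    using assms by (subst summable_on_UNIV_nonneg_real_iff) (auto intro: summable_geometric)
  hence "(\<lambda>m. norm q ^ m) summable_on T" by (rule summable_on_subset) auto
  thus "(\<lambda>m. norm q ^ m * (1 / (1 - norm q)\<^sup>2)) summable_on T" by (rule summable_on_cmult_left)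
  fix m assume "m \<in> T"
  with assms have m: "m > 0" by (auto intro!: Nat.gr0I)
  have "norm q ^ m \<le> norm q ^ 1" using assms m by (intro power_decreasing) auto
  hence "1 - norm q \<le> 1 - norm (q ^ m)" by (simp add: norm_power)
  also have "\<dots> \<le> norm (1 - q ^ m)" using norm_triangle_ineq2[of 1 "q ^ m"] by simp
  finally have "norm (q ^ m) / (norm (1 - q ^ m))\<^sup>2 \<le> norm (q ^ m) / (1 - norm q)\<^sup>2"
    using assms by (intro divide_left_mono power_mono) (auto intro!: mult_pos_pos)
  thus "norm (q ^ m / (1 - q ^ m)\<^sup>2) \<le> norm q ^ m * (1 / (1 - norm q)\<^sup>2)"
    by (simp add: norm_divide norm_power)
qed

section \<open>The logarithmic derivative of the generating function\<close>

definition moment_fps :: "complex \<Rightarrow> complex \<Rightarrow> complex fps" where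
  "moment_fps b \<epsilon> = Abs_fps (\<lambda>i. \<epsilon> ^ i / fact i * moment_series i b)"

text \<open>\<open>moment_fps b \<epsilon>\<close> is 1 / (1 - b * exp (epsilon * z)).
  Multiplication by the exponential turns r^n into (r + 1)^n by the binomial theorem, and
  multiplication by b shifts the series by one; only the term r = 0 is lost, which is 1 for n = 0
  and 0 otherwise.\<close>

lemma moment_fps_geometric:
  assumes b: "norm b < 1"
  shows "(1 - fps_const b * fps_exp \<epsilon>) * moment_fps b \<epsilon> = 1"
proof -
  have "fps_nth (fps_const b * (fps_exp \<epsilon> * moment_fps b \<epsilon>)) n = fps_nth (moment_fps b \<epsilon> - 1) n" for n
  proof -
    have summ: "summable (\<lambda>r. of_nat r ^ i * b ^ r)" for i
      by (rule summable_moment_series[OF b])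
    have "fps_nth (moment_fps b \<epsilon> * fps_exp \<epsilon>) n =
          (\<Sum>i=0..n. (\<epsilon> ^ i / fact i * moment_series i b) * (\<epsilon> ^ (n - i) / fact (n - i)))"
      by (simp add: fps_mult_nth moment_fps_def)
    also have "\<dots> = \<epsilon> ^ n / fact n * (\<Sum>i\<le>n. of_nat (n choose i) * moment_series i b)"
      unfolding sum_distrib_left atLeast0AtMost
      by (intro sum.cong refl) (simp add: binomial_fact power_add[symmetric] field_simps)
    also have "(\<Sum>i\<le>n. of_nat (n choose i) * moment_series i b) = (\<Sum>i\<le>n. \<Sum>r. of_nat (n choose i) * (of_nat r ^ i * b ^ r))"
      unfolding moment_series_def by (intro sum.cong refl suminf_mult[symmetric] summ)
    also have "\<dots> = (\<Sum>r. \<Sum>i\<le>n. of_nat (n choose i) * (of_nat r ^ i * b ^ r))"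
      by (intro suminf_sum[symmetric] summable_mult summ)
    also have "\<dots> = (\<Sum>r. (of_nat r + 1) ^ n * b ^ r)"
      by (simp add: binomial_ring sum_distrib_right mult.assoc)
    finally have "fps_nth (fps_const b * (fps_exp \<epsilon> * moment_fps b \<epsilon>)) n = \<epsilon> ^ n / fact n * (b * (\<Sum>r. (of_nat r + 1) ^ n * b ^ r))"
      by (simp add: mult_ac)
    also have "b * (\<Sum>r. (of_nat r + 1) ^ n * b ^ r) = (\<Sum>r. of_nat (Suc r) ^ n * b ^ Suc r)"
    proof (cases "b = 0")
      case False
      have "summable (\<lambda>r. of_nat (Suc r) ^ n * b ^ Suc r)"
        using summ[of n] by (subst summable_Suc_iff)
      hence "summable (\<lambda>r. (1 / b) * (of_nat (Suc r) ^ n * b ^ Suc r))" by (rule summable_mult)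
      hence "summable (\<lambda>r. (of_nat r + 1) ^ n * b ^ r)" using False by (simp add: add_ac)
      thus ?thesis by (subst suminf_mult[symmetric]) (simp_all add: mult_ac add_ac)
    qed auto
    also have "\<dots> = moment_series n b - (if n = 0 then 1 else 0)"
      unfolding moment_series_def using suminf_split_head[OF summ[of n]] by simp
    also have "\<epsilon> ^ n / fact n * (moment_series n b - (if n = 0 then 1 else 0)) = fps_nth (moment_fps b \<epsilon> - 1) n"
      by (auto simp: moment_fps_def algebra_simps)
    finally show ?thesis .
  qed
  hence "fps_const b * (fps_exp \<epsilon> * moment_fps b \<epsilon>) = moment_fps b \<epsilon> - 1" by (rule fps_ext)
  thus ?thesis by (simp add: algebra_simps)
qed

lemma X_factor_product:
  assumes "b \<noteq> 1"
  shows "fps_const ((1 - b)\<^sup>2) * (1 + fps_const (b / (1 - b)\<^sup>2) * X_fps) =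
           (1 - fps_const b * fps_exp 1) * (1 - fps_const b * fps_exp (- 1))"
proof -
  have "fps_exp 1 * fps_exp (-1) = (1 :: complex fps)" by (simp add: fps_exp_add_mult[symmetric])
  hence e: "fps_const b * fps_exp 1 * (fps_const b * fps_exp (- 1)) = fps_const (b\<^sup>2)"
    by (simp add: power2_eq_square mult_ac flip: fps_const_mult)
  have sq: "fps_const ((1 - b)\<^sup>2) = 1 - 2 * fps_const b + fps_const (b\<^sup>2)"
    by (simp add: fps_eq_iff fps_numeral_nth power2_eq_square algebra_simps fps_numeral_fps_const)
  have "fps_const ((1 - b)\<^sup>2) * (1 + fps_const (b / (1 - b)\<^sup>2) * X_fps) = fps_const ((1 - b)\<^sup>2) + fps_const b * X_fps"
    using assms by (simp add: distrib_left mult.assoc[symmetric])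
  also have "\<dots> = 1 - 2 * fps_const b + fps_const (b\<^sup>2) + fps_const b * X_fps"
    unfolding sq ..
  also have "1 - 2 * fps_const b + fps_const (b\<^sup>2) + fps_const b * X_fps =
             1 - fps_const b * fps_exp 1 - fps_const b * fps_exp (- 1) + fps_const (b\<^sup>2)"
    by (simp add: X_fps_def algebra_simps)
  also have "\<dots> = (1 - fps_const b * fps_exp 1) * (1 - fps_const b * fps_exp (- 1))"
    unfolding e[symmetric] by (simp add: algebra_simps)
  finally show ?thesis .
qed

text \<open>Up to a constant the factor is (1 - b * exp z) * (1 - b * exp (-z)). Its logarithmic
  derivative is a difference of two geometric series; it is written without division by first
  multiplying with (1 - b)^2.\<close>

lemma fps_deriv_X_factor:
  assumes b: "norm b < 1"
  shows "fps_deriv (1 + fps_const (b / (1 - b)\<^sup>2) * X_fps) =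
           - ((1 + fps_const (b / (1 - b)\<^sup>2) * X_fps) * (moment_fps b 1 - moment_fps b (- 1)))"
proof -
  have b1: "b \<noteq> 1" using b by auto
  let ?p = "1 + fps_const (b / (1 - b)\<^sup>2) * X_fps"
  let ?E = "1 - fps_const b * fps_exp 1" and ?F = "1 - fps_const b * fps_exp (- 1)"
  have "fps_const ((1 - b)\<^sup>2) * (?p * (moment_fps b 1 - moment_fps b (- 1))) =
        (?E * moment_fps b 1) * ?F - ?E * (?F * moment_fps b (- 1))"
    unfolding mult.assoc[symmetric] X_factor_product[OF b1] by (simp add: algebra_simps)
  also have "\<dots> = fps_const b * (fps_exp 1 - fps_exp (- 1))"
    unfolding moment_fps_geometric[OF b] by (simp add: algebra_simps)
  also have "\<dots> = - (fps_const b * fps_deriv X_fps)"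
  proof -
    have "fps_const (- 1) * f = - f" for f :: "complex fps" by (simp add: fps_eq_iff)
    thus ?thesis by (simp add: X_fps_def ring_distribs)
  qed
  also have "fps_const b = fps_const ((1 - b)\<^sup>2) * fps_const (b / (1 - b)\<^sup>2)" using b1 by simp
  also have "- (fps_const ((1 - b)\<^sup>2) * fps_const (b / (1 - b)\<^sup>2) * fps_deriv X_fps) =
             fps_const ((1 - b)\<^sup>2) * (- fps_deriv ?p)" by (simp add: mult.assoc)
  finally have "?p * (moment_fps b 1 - moment_fps b (- 1)) = - fps_deriv ?p"
    using b1 by (subst (asm) mult_left_cancel) auto
  thus ?thesis by simp
qed

lemma fps_deriv_prod_logarithmic:
  fixes p l :: "'b \<Rightarrow> 'a :: comm_ring_1 fps"
  assumes "finite T" "\<And>m. m \<in> T \<Longrightarrow> fps_deriv (p m) = - (p m * l m)"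
  shows "fps_deriv (\<Prod>m\<in>T. p m) = - ((\<Prod>m\<in>T. p m) * (\<Sum>m\<in>T. l m))"
  using assms by (induction T rule: finite_induct) (auto simp: algebra_simps)

text \<open>Coefficient i of the summed differences of geometric series; the two exponents 1 and -1
  contribute 1 - (-1)^i, so even orders cancel and odd ones double. The minus sign of the
  logarithmic derivative is kept outside.\<close>

definition log_deriv_coeff :: "nat set \<Rightarrow> nat \<Rightarrow> complex \<Rightarrow> complex" where
  "log_deriv_coeff T i \<tau> = (if odd i then 2 / fact i * lambert T i \<tau> else 0)"

text \<open>The recursion holds for finite products and survives the limit. The second claim allows
  any exhaustion, so that the same coefficients can later be computed as limits of theta
  products.\<close>

lemma A_generating_recursion:
  assumes \<tau>: "Im \<tau> > 0" and T: "T = {m. 0 < m \<and> (\<exists>s\<in>S. [m = s] (mod n))}"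
  defines "q \<equiv> exp (2 * of_real pi * \<i> * \<tau>)"
  defines "h \<equiv> (\<lambda>i. \<Sum>k\<le>i. fps_nth (X_fps ^ k) i * A_series S n k q)"
  shows "of_nat (Suc i) * h (Suc i) = - (\<Sum>j\<le>i. h j * log_deriv_coeff T (i - j) \<tau>)"
    and "\<And>Ts. filterlim Ts (finite_subsets_at_top T) sequentially \<Longrightarrow>
           (\<lambda>N. fps_nth (\<Prod>m\<in>Ts N. 1 + fps_const (q ^ m / (1 - q ^ m)\<^sup>2) * X_fps) i) \<longlonglongrightarrow> h i"
proof -
  let ?a = "\<lambda>m. q ^ m / (1 - q ^ m)\<^sup>2"
  let ?p = "\<lambda>m. 1 + fps_const (?a m) * X_fps"
  let ?l = "\<lambda>m. moment_fps (q ^ m) 1 - moment_fps (q ^ m) (- 1)"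
  have q: "norm q < 1" unfolding q_def by (rule norm_exp_2pi_i[OF \<tau>])
  have T0: "0 \<notin> T" by (simp add: T)
  have lim_h: "(\<lambda>N. fps_nth (\<Prod>m\<in>Ts N. ?p m) i) \<longlonglongrightarrow> h i"
    if lim: "filterlim Ts (finite_subsets_at_top T) sequentially" for Ts i
  proof -
    have "(\<lambda>N. \<Sum>k\<le>i. fps_nth (X_fps ^ k) i * esym ?a (Ts N) k) \<longlonglongrightarrow> h i"
      unfolding h_def A_series_eq_infsum_sets[OF T]
      by (intro tendsto_sum tendsto_mult tendsto_const esym_tendsto abs_summable_A_factor q T0 lim)
    moreover have "eventually (\<lambda>N. finite (Ts N)) sequentially"
      using lim unfolding filterlim_finite_subsets_at_top by (auto elim!: eventually_mono dest!: spec[of _ "{}"])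
    hence "eventually (\<lambda>N. (\<Sum>k\<le>i. fps_nth (X_fps ^ k) i * esym ?a (Ts N) k) = fps_nth (\<Prod>m\<in>Ts N. ?p m) i) sequentially"
      by eventually_elim (simp add: fps_nth_prod_one_plus_X)
    ultimately show ?thesis by (rule Lim_transform_eventually)
  qed
  thus "\<And>Ts. filterlim Ts (finite_subsets_at_top T) sequentially \<Longrightarrow> (\<lambda>N. fps_nth (\<Prod>m\<in>Ts N. ?p m) i) \<longlonglongrightarrow> h i" .
  \<comment> \<open>For the recursion itself any exhaustion serves; initial segments are the
    simplest.\<close>
  define Ts where "Ts N = T \<inter> {..<N}" for N
  have Ts: "finite (Ts N)" "Ts N \<subseteq> T" for N by (auto simp: Ts_def)
  have lim: "filterlim Ts (finite_subsets_at_top T) sequentially"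
    unfolding filterlim_finite_subsets_at_top
  proof safe
    fix U assume U: "finite U" "U \<subseteq> T"
    then obtain M where "\<forall>m\<in>U. m < M" using finite_nat_set_iff_bounded by blast
    with U show "\<forall>\<^sub>F N in sequentially. finite (Ts N) \<and> U \<subseteq> Ts N \<and> Ts N \<subseteq> T"
      by (intro eventually_sequentiallyI[of M]) (auto simp: Ts_def)
  qed
  have l_nth: "fps_nth (?l m) i = (if odd i then 2 / fact i * moment_series i (q ^ m) else 0)" for m i
    by (auto simp: moment_fps_def minus_one_power_iff algebra_simps)
  have lim_l: "(\<lambda>N. fps_nth (\<Sum>m\<in>Ts N. ?l m) i) \<longlonglongrightarrow> log_deriv_coeff T i \<tau>" for i
  proof (cases "odd i")
    case True
    hence i: "i > 0" by (auto intro!: Nat.gr0I)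
    have "q ^ m = exp (2 * of_real pi * \<i> * (of_nat m * \<tau>))" for m
      by (simp add: q_def exp_of_nat_mult[symmetric] mult_ac)
    hence "((\<lambda>m. moment_series i (q ^ m)) has_sum lambert T i \<tau>) T"
      using lambert_outer_has_sum[OF T0 \<tau> i] by simp
    hence "((\<lambda>U. \<Sum>m\<in>U. moment_series i (q ^ m)) \<longlongrightarrow> lambert T i \<tau>) (finite_subsets_at_top T)"
      by (simp add: has_sum_def)
    from filterlim_compose[OF this lim]
    have "(\<lambda>N. 2 / fact i * (\<Sum>m\<in>Ts N. moment_series i (q ^ m))) \<longlonglongrightarrow> 2 / fact i * lambert T i \<tau>"
      by (intro tendsto_intros)
    thus ?thesis using True unfolding fps_sum_nth l_nth by (simp add: log_deriv_coeff_def sum_distrib_left)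
  qed (unfold fps_sum_nth l_nth, simp add: log_deriv_coeff_def)
  have "fps_deriv (\<Prod>m\<in>Ts N. ?p m) = - ((\<Prod>m\<in>Ts N. ?p m) * (\<Sum>m\<in>Ts N. ?l m))" for N
  proof (rule fps_deriv_prod_logarithmic[OF Ts(1)])
    fix m assume "m \<in> Ts N"
    hence "m > 0" using Ts(2)[of N] T by auto
    hence "norm (q ^ m) < 1" using q by (simp add: norm_power power_less_one_iff)
    thus "fps_deriv (?p m) = - (?p m * ?l m)" by (rule fps_deriv_X_factor)
  qed
  hence "fps_nth (fps_deriv (\<Prod>m\<in>Ts N. ?p m)) i = fps_nth (- ((\<Prod>m\<in>Ts N. ?p m) * (\<Sum>m\<in>Ts N. ?l m))) i" for N
    by (simp only:)
  hence eq: "of_nat (Suc i) * fps_nth (\<Prod>m\<in>Ts N. ?p m) (Suc i) =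
        - (\<Sum>j\<le>i. fps_nth (\<Prod>m\<in>Ts N. ?p m) j * fps_nth (\<Sum>m\<in>Ts N. ?l m) (i - j))" for N
    by (simp add: fps_mult_nth atLeast0AtMost)
  have "(\<lambda>N. of_nat (Suc i) * fps_nth (\<Prod>m\<in>Ts N. ?p m) (Suc i)) \<longlonglongrightarrow> of_nat (Suc i) * h (Suc i)"
    by (intro tendsto_mult tendsto_const lim_h[OF lim])
  moreover have "(\<lambda>N. - (\<Sum>j\<le>i. fps_nth (\<Prod>m\<in>Ts N. ?p m) j * fps_nth (\<Sum>m\<in>Ts N. ?l m) (i - j))) \<longlonglongrightarrow>
                   - (\<Sum>j\<le>i. h j * log_deriv_coeff T (i - j) \<tau>)"
    by (intro tendsto_minus tendsto_sum tendsto_mult lim_h[OF lim] lim_l)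
  ultimately show "of_nat (Suc i) * h (Suc i) = - (\<Sum>j\<le>i. h j * log_deriv_coeff T (i - j) \<tau>)"
    unfolding eq by (rule LIMSEQ_unique)
qed

text \<open>Strong induction along the recursion, starting from A_0 = 1. Weights are consistent
  because the logarithmic coefficient of order i has weight i + 1.\<close>

lemma quasi_modular_form_A_generating:
  assumes n: "n > 0" and S: "symmetric_representatives n S" "n \<notin> S"
  shows "quasi_modular_form (principal_congruence_subgroup n) i
           (\<lambda>\<tau>. \<Sum>k\<le>i. fps_nth (X_fps ^ k) i * A_series S n k (exp (2 * of_real pi * \<i> * \<tau>)))"
proof -
  define Z where "Z = {m::int. \<exists>s\<in>S. [m = int s] (mod int n)}"
  define T where "T = {m. 0 < m \<and> (\<exists>s\<in>S. [m = s] (mod n))}"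
  \<comment> \<open>The only multiple of n in {1..n} is n itself, which is not in S.\<close>
  have zero: "0 \<notin> Z"
  proof
    assume "0 \<in> Z"
    then obtain s where s: "s \<in> S" "[0 = int s] (mod int n)" by (auto simp: Z_def)
    hence "n dvd s" by (simp add: cong_iff_dvd_diff)
    with s S have "s = n" by (auto simp: symmetric_representatives_def dest!: dvd_imp_le)
    with s S show False by simp
  qed
  interpret symmetric_periodic_set n Z
  proof
    show "m + int n * t \<in> Z" if "m \<in> Z" for m t
      using that by (auto simp: Z_def cong_def)
    show "- m \<in> Z" if m: "m \<in> Z" for m
    proof -
      obtain s where s: "s \<in> S" "[m = int s] (mod int n)" using m by (auto simp: Z_def)
      then obtain s' where s': "s' \<in> S" "[int s' = - int s] (mod int n)"
        using S by (auto simp: symmetric_representatives_def)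
      have "[- m = - int s] (mod int n)" using s(2) by (simp add: cong_minus_minus_iff)
      hence "[- m = int s'] (mod int n)" using cong_sym[OF s'(2)] by (rule cong_trans)
      with s'(1) show ?thesis unfolding Z_def by blast
    qed
  qed (use n zero in auto)
  have T_eq: "{m. int m \<in> Z} = T"
  proof -
    have "T = {m. 0 < m \<and> int m \<in> Z}" by (simp add: T_def Z_def cong_int_iff)
    thus ?thesis using zero by (auto intro!: Nat.gr0I)
  qed
  have l: "quasi_modular_form (principal_congruence_subgroup n) (Suc i) (log_deriv_coeff T i)" for i
    using quasi_modular_form_cmult[OF quasi_modular_form_lambert[of i], of "2 / fact i"] quasi_modular_form_0
    by (cases "odd i") (auto simp: log_deriv_coeff_def[abs_def] T_eq)
  let ?h = "\<lambda>i \<tau>. \<Sum>k\<le>i. fps_nth (X_fps ^ k) i * A_series S n k (exp (2 * of_real pi * \<i> * \<tau>))"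
  show ?thesis
  proof (induction i rule: less_induct)
    case (less i)
    show ?case
    proof (cases i)
      case 0
      \<comment> \<open>The empty set is the only finite set of cardinality 0, and the empty product
        is 1.\<close>
      have "?h 0 = (\<lambda>\<tau>. 1)"
        by (simp add: fun_eq_iff A_series_eq_infsum_sets[OF T_def] card_eq_0_iff cong: conj_cong)
      thus ?thesis using quasi_modular_form_const[of _ 1] by (simp add: 0)
    next
      case (Suc i')
      have "quasi_modular_form (principal_congruence_subgroup n) i
              (\<lambda>\<tau>. (- 1 / of_nat (Suc i')) * (\<Sum>j\<le>i'. ?h j \<tau> * log_deriv_coeff T (i' - j) \<tau>))"
      proof (intro quasi_modular_form_cmult quasi_modular_form_sum)
        fix j assume j: "j \<in> {..i'}"
        \<comment> \<open>The weight j of the earlier coefficient and i' - j + 1 of the Lambert part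
          add up to i.\<close>
        have "quasi_modular_form (principal_congruence_subgroup n) (j + Suc (i' - j)) (\<lambda>\<tau>. ?h j \<tau> * log_deriv_coeff T (i' - j) \<tau>)"
          using j Suc by (intro quasi_modular_form_mult less.IH l) auto
        also have "j + Suc (i' - j) = i" using j Suc by simp
        finally show "quasi_modular_form (principal_congruence_subgroup n) i (\<lambda>\<tau>. ?h j \<tau> * log_deriv_coeff T (i' - j) \<tau>)" .
      qed
      also have "?this \<longleftrightarrow> ?thesis"
      proof (rule quasi_modular_form_cong)
        fix \<tau> assume "\<tau> \<in> upper_half_plane"
        hence \<tau>: "Im \<tau> > 0" by (simp add: upper_half_plane_def)
        have "(- 1 / c) * s = x" if "c * x = - s" "c \<noteq> 0" for c s x :: complex
          using that by (simp add: field_simps)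
        from this[OF A_generating_recursion(1)[OF \<tau> T_def]]
        show "(- 1 / of_nat (Suc i')) * (\<Sum>j\<le>i'. ?h j \<tau> * log_deriv_coeff T (i' - j) \<tau>) = ?h i \<tau>"
          unfolding Suc by (simp del: of_nat_Suc)
      qed
      finally show ?thesis .
    qed
  qed
qed

subsection \<open>The Jacobi triple product\<close>

text \<open>A convergent infinite product vanishes only if a factor does. The nonzero limit is the
  source of every later nonvanishing claim, in particular that of theta.\<close>

lemma prod_one_minus_LIMSEQ_nonzero:
  fixes u :: "nat \<Rightarrow> complex"
  assumes "summable (\<lambda>i. norm (u i))" "\<And>i. u i \<noteq> 1"
  obtains L where "L \<noteq> 0" "(\<lambda>N. \<Prod>i<N. 1 - u i) \<longlonglongrightarrow> L"
proof -
  have "abs_convergent_prod (\<lambda>i. 1 - u i)"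
    using assms(1) by (simp add: abs_convergent_prod_conv_summable)
  hence conv: "convergent_prod (\<lambda>i. 1 - u i)" by (rule abs_convergent_prod_imp_convergent_prod)
  have "prodinf (\<lambda>i. 1 - u i) \<noteq> 0"
    using assms(2) by (intro prodinf_nonzero[OF conv]) (metis eq_iff_diff_eq_0)
  moreover have "(\<lambda>N. \<Prod>i<N. 1 - u i) \<longlonglongrightarrow> prodinf (\<lambda>i. 1 - u i)"
    using convergent_prod_LIMSEQ[OF conv] by (simp add: LIMSEQ_lessThan_iff_atMost)
  ultimately show ?thesis by (rule that)
qed

text \<open>The reciprocal 1 / (Q; Q)_m of the q-Pochhammer symbol, set to 0 for negative m like a
  reciprocal factorial.\<close>

definition qpoch_inv :: "complex \<Rightarrow> int \<Rightarrow> complex" where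
  "qpoch_inv Q m = (if m < 0 then 0 else 1 / (\<Prod>i<nat m. 1 - Q ^ Suc i))"

text \<open>The Gaussian binomial coefficient of 2 * N over N - j in base Q, vanishing for |j| > N
  by the convention for negative indices.\<close>

definition triple_coeff :: "complex \<Rightarrow> nat \<Rightarrow> int \<Rightarrow> complex" where
  "triple_coeff Q N j = (\<Prod>i<2 * N. 1 - Q ^ Suc i) * qpoch_inv Q (int N - j) * qpoch_inv Q (int N + j)"

context
  fixes Q :: complex
  assumes Q: "norm Q < 1" "Q \<noteq> 0"
begin

lemma Q_power_neq_1: "Q ^ Suc i \<noteq> 1"
proof
  assume "Q ^ Suc i = 1"
  hence "norm Q ^ Suc i = 1" by (simp only: norm_power[symmetric] norm_one)
  thus False using Q power_Suc_less_one[of "norm Q" i] by simp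
qed

text \<open>The zero convention makes this hold for every integer m; at m = 0 the factor 1 - Q^0
  vanishes.\<close>

lemma qpoch_inv_pred: "qpoch_inv Q (m - 1) = (1 - Q powi m) * qpoch_inv Q m"
proof -
  consider "m < 0" | "m = 0" | "m = int (Suc (nat (m - 1)))"
    by linarith
  thus ?thesis
  proof cases
    case 3
    define k where "k = nat (m - 1)"
    with 3 have m: "m = int (Suc k)" by simp
    have "1 - Q ^ Suc k \<noteq> 0" using Q_power_neq_1[of k] by (metis eq_iff_diff_eq_0)
    moreover have "Q powi int (Suc k) = Q ^ Suc k" by (rule power_int_of_nat)
    moreover have "m - 1 = int k" using m by simp
    moreover have "qpoch_inv Q (int k) = 1 / (\<Prod>i<k. 1 - Q ^ Suc i)"
      "qpoch_inv Q (int (Suc k)) = 1 / ((\<Prod>i<k. 1 - Q ^ Suc i) * (1 - Q ^ Suc k))"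
      by (simp_all add: qpoch_inv_def nat_add_distrib)
    ultimately show ?thesis by (simp only: m) simp
  qed (auto simp: qpoch_inv_def)
qed

lemma triple_coeff_eq_0: "\<bar>j\<bar> > int N \<Longrightarrow> triple_coeff Q N j = 0"
  by (auto simp: triple_coeff_def qpoch_inv_def)

text \<open>The effect of the two factors that N + 1 adds to the product, compared at exp (j * z)
  after dividing by the weight b j: a constant term, a shift up and a shift down.\<close>

lemma triple_coeff_Suc:
  "triple_coeff Q (Suc N) j = (1 + Q ^ (2 * N + 1)) * triple_coeff Q N j +
     Q powi (int N + 1 - j) * triple_coeff Q N (j - 1) + Q powi (int N + 1 + j) * triple_coeff Q N (j + 1)"
proof -
  \<comment> \<open>All q-Pochhammer reciprocals are multiples of g or h, with factors in u, v and 1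
    / Q. Since u * v = Q^(2 * N + 2), the claim becomes a polynomial identity in u, v and 1 /
    Q.\<close>
  define u v g h where "u = Q powi (int N + 1 - j)" and "v = Q powi (int N + 1 + j)"
    and "g = qpoch_inv Q (int N + 1 - j)" and "h = qpoch_inv Q (int N + 1 + j)"
  have uv: "u * v = Q ^ (2 * N + 2)"
  proof -
    have "u * v = Q powi ((int N + 1 - j) + (int N + 1 + j))"
      unfolding u_def v_def using Q by (intro power_int_add[symmetric]) auto
    also have "(int N + 1 - j) + (int N + 1 + j) = int (2 * N + 2)" by simp
    finally have "u * v = Q powi int (2 * N + 2)" .
    thus ?thesis by (simp only: power_int_of_nat)
  qed
  have g1: "qpoch_inv Q (int N - j) = (1 - u) * g"
    using qpoch_inv_pred[of "int N + 1 - j"] by (simp add: u_def g_def algebra_simps)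
  have g2: "qpoch_inv Q (int N - j - 1) = (1 - u / Q) * ((1 - u) * g)"
    using qpoch_inv_pred[of "int N - j"] Q power_int_diff[of Q "int N + 1 - j" 1] unfolding g1
    by (simp add: u_def algebra_simps)
  have h1: "qpoch_inv Q (int N + j) = (1 - v) * h"
    using qpoch_inv_pred[of "int N + 1 + j"] by (simp add: v_def h_def algebra_simps)
  have h2: "qpoch_inv Q (int N + j - 1) = (1 - v / Q) * ((1 - v) * h)"
    using qpoch_inv_pred[of "int N + j"] Q power_int_diff[of Q "int N + 1 + j" 1] unfolding h1
    by (simp add: v_def algebra_simps)
  define P where "P = (\<Prod>i<2 * N. 1 - Q ^ Suc i)"
  have odd_pow: "Q ^ (2 * N + 1) = u * v / Q" using Q by (simp add: uv)
  have "triple_coeff Q (Suc N) j = P * (1 - Q ^ (2 * N + 1)) * (1 - Q ^ (2 * N + 2)) * g * h"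
    by (simp add: triple_coeff_def P_def g_def h_def algebra_simps)
  also have "\<dots> = P * (1 - u * v / Q) * (1 - u * v) * g * h"
    by (simp only: odd_pow uv)
  also have "\<dots> = (1 + u * v / Q) * (P * ((1 - u) * g) * ((1 - v) * h)) + u * (P * g * ((1 - v / Q) * ((1 - v) * h))) +
       v * (P * ((1 - u / Q) * ((1 - u) * g)) * h)"
    using Q by (simp add: field_simps)
  also have "P * ((1 - u) * g) * ((1 - v) * h) = triple_coeff Q N j"
    by (simp add: triple_coeff_def P_def g1 h1)
  also have "P * g * ((1 - v / Q) * ((1 - v) * h)) = triple_coeff Q N (j - 1)"
    unfolding h2[symmetric] by (simp add: triple_coeff_def P_def g_def algebra_simps)
  also have "P * ((1 - u / Q) * ((1 - u) * g)) * h = triple_coeff Q N (j + 1)"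
    unfolding g2[symmetric] by (simp add: triple_coeff_def P_def h_def algebra_simps)
  finally show ?thesis by (simp only: odd_pow u_def v_def)
qed

text \<open>The recurrence forces b j = b 0 * (-x)^j * Q^(j * (j - 1) / 2). Stating it as a
  recurrence with free b 0 lets the theta summands themselves serve as b.\<close>

lemma finite_Jacobi_triple_product:
  fixes b :: "int \<Rightarrow> complex" and x :: complex
  assumes x: "x \<noteq> 0" and b: "\<And>j. b (j + 1) = - x * Q powi j * b j"
  shows "fps_const (b 0) * (\<Prod>i<N. (1 - fps_const (x * Q ^ i) * fps_exp 1) * (1 - fps_const (Q ^ Suc i / x) * fps_exp (- 1))) =
           (\<Sum>j=-int N..int N. fps_const (b j * triple_coeff Q N j) * fps_exp (of_int j))"
proof (induction N)
  case 0
  thus ?case by (simp add: triple_coeff_def qpoch_inv_def)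
next
  case (Suc N)
  let ?B = "triple_coeff Q N" and ?e = "\<lambda>j::int. fps_exp (of_int j) :: complex fps"
  let ?I = "{- int (Suc N)..int (Suc N)}"
  have e: "?e j * fps_exp 1 = ?e (j + 1)" "?e j * fps_exp (- 1) = ?e (j - 1)" for j
    by (simp_all add: fps_exp_add_mult[symmetric])
  have ee: "fps_exp 1 * fps_exp (- 1) = (1 :: complex fps)" by (simp add: fps_exp_add_mult[symmetric])
  have x1: "x * Q ^ N * (Q ^ Suc N / x) = Q ^ (2 * N + 1)"
    using x by (simp add: power_add[symmetric] mult_2)
  have "(1 - fps_const (x * Q ^ N) * fps_exp 1) * (1 - fps_const (Q ^ Suc N / x) * fps_exp (- 1)) =
        1 + fps_const (x * Q ^ N) * fps_const (Q ^ Suc N / x) * (fps_exp 1 * fps_exp (- 1))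
          - fps_const (x * Q ^ N) * fps_exp 1 - fps_const (Q ^ Suc N / x) * fps_exp (- 1)"
    by (simp only: algebra_simps mult_1_left mult_1_right)
  also have "fps_const (x * Q ^ N) * fps_const (Q ^ Suc N / x) * (fps_exp 1 * fps_exp (- 1)) = fps_const (Q ^ (2 * N + 1))"
    by (simp only: ee fps_const_mult x1 mult_1_right)
  finally have factor: "(1 - fps_const (x * Q ^ N) * fps_exp 1) * (1 - fps_const (Q ^ Suc N / x) * fps_exp (- 1)) =
        fps_const (1 + Q ^ (2 * N + 1)) - fps_const (x * Q ^ N) * fps_exp 1 - fps_const (Q ^ Suc N / x) * fps_exp (- 1)"
    by (simp flip: fps_const_add)
  let ?S = "\<Sum>j=-int N..int N. fps_const (b j * ?B j) * ?e j"
  have scale: "fps_const c * f * ?S = (\<Sum>j=-int N..int N. fps_const (c * (b j * ?B j)) * (?e j * f))" for c f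
    unfolding sum_distrib_left by (intro sum.cong refl) (simp only: fps_const_mult[symmetric] mult_ac)
  have neg_const: "- (fps_const c * f * ?S) = fps_const (- c) * f * ?S" for c f
    by (simp only: fps_const_neg[symmetric] mult_minus_left)
  have S0: "fps_const (1 + Q ^ (2 * N + 1)) * ?S = (\<Sum>j\<in>?I. fps_const (b j * ((1 + Q ^ (2 * N + 1)) * ?B j)) * ?e j)"
  proof -
    have "fps_const (1 + Q ^ (2 * N + 1)) * ?S = (\<Sum>j=-int N..int N. fps_const (b j * ((1 + Q ^ (2 * N + 1)) * ?B j)) * ?e j)"
      using scale[of "1 + Q ^ (2 * N + 1)" 1] by (simp only: mult_1_right mult.left_commute)
    also have "\<dots> = (\<Sum>j\<in>?I. fps_const (b j * ((1 + Q ^ (2 * N + 1)) * ?B j)) * ?e j)"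
      by (intro sum.mono_neutral_left) (auto simp: triple_coeff_eq_0)
    finally show ?thesis .
  qed
  \<comment> \<open>Multiplying by exp z moves j up by one, and the recurrence for b rewrites b (j -
    1) in terms of b j. The range may be enlarged since coefficients outside vanish.\<close>
  have S1: "- (fps_const (x * Q ^ N) * fps_exp 1 * ?S) = (\<Sum>j\<in>?I. fps_const (b j * (Q powi (int N + 1 - j) * ?B (j - 1))) * ?e j)"
  proof -
    have "- (fps_const (x * Q ^ N) * fps_exp 1 * ?S) =
            (\<Sum>j=-int N..int N. fps_const (- (x * Q ^ N) * (b j * ?B j)) * (?e j * fps_exp 1))"
      unfolding neg_const by (rule scale)
    also have "\<dots> = (\<Sum>j=-int N + 1..int N + 1. fps_const (- (x * Q ^ N) * (b (j - 1) * ?B (j - 1))) * ?e j)"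
      unfolding e by (intro sum.reindex_bij_witness[of _ "\<lambda>j. j - 1" "\<lambda>j. j + 1"]) auto
    also have "\<dots> = (\<Sum>j=-int N + 1..int N + 1. fps_const (b j * (Q powi (int N + 1 - j) * ?B (j - 1))) * ?e j)"
    proof (intro sum.cong refl arg_cong[of _ _ "\<lambda>c. fps_const c * _"])
      fix j :: int
      have "Q powi (j - 1) * Q powi (int N + 1 - j) = Q powi int N"
        using Q by (subst power_int_add[symmetric]) auto
      hence "b j * Q powi (int N + 1 - j) = - (x * Q ^ N) * b (j - 1)"
        using b[of "j - 1"] by (simp add: mult_ac)
      thus "- (x * Q ^ N) * (b (j - 1) * ?B (j - 1)) = b j * (Q powi (int N + 1 - j) * ?B (j - 1))"
        by (simp only: mult.assoc[symmetric])
    qed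
    also have "\<dots> = (\<Sum>j\<in>?I. fps_const (b j * (Q powi (int N + 1 - j) * ?B (j - 1))) * ?e j)"
      by (intro sum.mono_neutral_left) (auto simp: triple_coeff_eq_0)
    finally show ?thesis .
  qed
  have S2: "- (fps_const (Q ^ Suc N / x) * fps_exp (- 1) * ?S) = (\<Sum>j\<in>?I. fps_const (b j * (Q powi (int N + 1 + j) * ?B (j + 1))) * ?e j)"
  proof -
    have "- (fps_const (Q ^ Suc N / x) * fps_exp (- 1) * ?S) =
            (\<Sum>j=-int N..int N. fps_const (- (Q ^ Suc N / x) * (b j * ?B j)) * (?e j * fps_exp (- 1)))"
      unfolding neg_const by (rule scale)
    also have "\<dots> = (\<Sum>j=-int N - 1..int N - 1. fps_const (- (Q ^ Suc N / x) * (b (j + 1) * ?B (j + 1))) * ?e j)"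
      unfolding e by (intro sum.reindex_bij_witness[of _ "\<lambda>j. j + 1" "\<lambda>j. j - 1"]) auto
    also have "\<dots> = (\<Sum>j=-int N - 1..int N - 1. fps_const (b j * (Q powi (int N + 1 + j) * ?B (j + 1))) * ?e j)"
    proof (intro sum.cong refl arg_cong[of _ _ "\<lambda>c. fps_const c * _"])
      fix j :: int
      have "Q powi (int N + 1 + j) = Q powi (int N + 1) * Q powi j"
        using Q by (subst power_int_add[symmetric]) auto
      also have "Q powi (int N + 1) = Q ^ Suc N" by (metis power_int_of_nat of_nat_Suc add.commute)
      finally have "b j * Q powi (int N + 1 + j) = - (Q ^ Suc N / x) * b (j + 1)"
        using b[of j] x by (simp add: mult_ac)
      thus "- (Q ^ Suc N / x) * (b (j + 1) * ?B (j + 1)) = b j * (Q powi (int N + 1 + j) * ?B (j + 1))"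
        by (simp only: mult.assoc[symmetric])
    qed
    also have "\<dots> = (\<Sum>j\<in>?I. fps_const (b j * (Q powi (int N + 1 + j) * ?B (j + 1))) * ?e j)"
      by (intro sum.mono_neutral_left) (auto simp: triple_coeff_eq_0)
    finally show ?thesis .
  qed
  have "fps_const (b 0) * (\<Prod>i<Suc N. (1 - fps_const (x * Q ^ i) * fps_exp 1) * (1 - fps_const (Q ^ Suc i / x) * fps_exp (- 1))) =
        ?S * ((1 - fps_const (x * Q ^ N) * fps_exp 1) * (1 - fps_const (Q ^ Suc N / x) * fps_exp (- 1)))"
    unfolding prod.lessThan_Suc Suc.IH[symmetric] by (simp only: mult.assoc)
  also have "\<dots> = fps_const (1 + Q ^ (2 * N + 1)) * ?S + (- (fps_const (x * Q ^ N) * fps_exp 1 * ?S)) + (- (fps_const (Q ^ Suc N / x) * fps_exp (- 1) * ?S))"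
    unfolding factor by (simp only: mult.commute[of ?S] diff_conv_add_uminus distrib_right mult_minus_left)
  also have "\<dots> = (\<Sum>j\<in>?I. fps_const (b j * triple_coeff Q (Suc N) j) * ?e j)"
    unfolding S0 S1 S2 triple_coeff_Suc by (simp add: sum.distrib distrib_left distrib_right flip: fps_const_add)
  finally show ?case .
qed

text \<open>For each j the limit is the same number 1 / (Q; Q)_infinity, and the bound is uniform in
  N and j, as dominated convergence requires.\<close>

lemma triple_coeff_limit:
  obtains L C where "L \<noteq> 0" "\<And>j. (\<lambda>N. triple_coeff Q N j) \<longlonglongrightarrow> L" "\<And>N j. norm (triple_coeff Q N j) \<le> C" "C > 0"
proof -
  let ?P = "\<lambda>N. \<Prod>i<N. 1 - Q ^ Suc i"
  have "summable (\<lambda>i. norm (Q ^ Suc i))"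
    using Q by (subst summable_Suc_iff) (simp add: norm_power summable_geometric)
  then obtain L where L: "L \<noteq> 0" "?P \<longlonglongrightarrow> L"
    using prod_one_minus_LIMSEQ_nonzero[of "\<lambda>i. Q ^ Suc i"] Q_power_neq_1 by blast
  have inv: "(\<lambda>N. 1 / ?P N) \<longlonglongrightarrow> 1 / L" using L by (intro tendsto_intros)
  obtain K1 where K1: "K1 > 0" "\<And>N. norm (?P N) \<le> K1"
    using convergent_imp_Bseq[OF convergentI[OF L(2)]] by (auto simp: Bseq_def)
  obtain K2 where K2: "K2 > 0" "\<And>N. norm (1 / ?P N) \<le> K2"
    using convergent_imp_Bseq[OF convergentI[OF inv]] by (auto simp: Bseq_def)
  have g: "norm (qpoch_inv Q m) \<le> K2" for m
    using K2 by (auto simp: qpoch_inv_def)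
  have g_lim: "(\<lambda>N. qpoch_inv Q (int N + j)) \<longlonglongrightarrow> 1 / L" for j
  proof -
    have "filterlim (\<lambda>N. nat (int N + j)) at_top sequentially"
      unfolding filterlim_at_top
    proof
      fix Z show "\<forall>\<^sub>F N in sequentially. Z \<le> nat (int N + j)"
        by (intro eventually_sequentiallyI[of "Z + nat \<bar>j\<bar>"]) auto
    qed
    from filterlim_compose[OF inv this] have "(\<lambda>N. 1 / ?P (nat (int N + j))) \<longlonglongrightarrow> 1 / L" .
    moreover have "eventually (\<lambda>N. 1 / ?P (nat (int N + j)) = qpoch_inv Q (int N + j)) sequentially"
      by (intro eventually_sequentiallyI[of "nat \<bar>j\<bar>"]) (auto simp: qpoch_inv_def)
    ultimately show ?thesis by (rule Lim_transform_eventually)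
  qed
  have "filterlim (\<lambda>N. 2 * N) at_top (sequentially :: nat filter)"
    by (intro filterlim_subseq) (auto simp: strict_mono_def)
  from filterlim_compose[OF L(2) this] have P2: "(\<lambda>N. ?P (2 * N)) \<longlonglongrightarrow> L" .
  have "(\<lambda>N. triple_coeff Q N j) \<longlonglongrightarrow> L * (1 / L) * (1 / L)" for j
    unfolding triple_coeff_def using g_lim[of "- j"] by (intro tendsto_mult P2 g_lim) simp
  moreover have "norm (triple_coeff Q N j) \<le> K1 * K2 * K2" for N j
    unfolding triple_coeff_def norm_mult using K1 K2 g
    by (intro mult_mono) (auto intro: mult_nonneg_nonneg)
  moreover have "L * (1 / L) * (1 / L) \<noteq> 0" "K1 * K2 * K2 > 0" using L K1 K2 by auto
  ultimately show ?thesis by (intro that[of "L * (1 / L) * (1 / L)" "K1 * K2 * K2"])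
qed

end

section \<open>Theta series as limits of finite products\<close>

lemma summable_on_gaussian_moments:
  fixes a u :: real
  assumes u: "u > 0" and a: "\<bar>a\<bar> \<le> 1"
  shows "(\<lambda>j::int. \<bar>of_int j + a\<bar> ^ t * exp (- u * (of_int j + a)\<^sup>2)) summable_on UNIV"
proof (rule summable_on_comparison_test)
  let ?C = "exp u * fact (t + 1) / u ^ (t + 1) * 8"
  show "(\<lambda>j::int. ?C * (1 + \<bar>real_of_int j\<bar>) powr (- 2)) summable_on UNIV"
    by (rule summable_on_cmult_right[OF summable_on_int_powr]) simp
  fix j :: int
  define s where "s = \<bar>of_int j + a\<bar>"
  \<comment> \<open>One quantity serves twice: s <= 1 + s^2 = v bounds the moment by v^t, and the
    exponential bound of order t + 1 then leaves a single factor 1 / v.\<close>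
  define v where "v = 1 + s\<^sup>2"
  have s: "s \<ge> 0" by (simp add: s_def)
  have v: "v \<ge> 1" by (simp add: v_def)
  have "s \<le> v"
  proof -
    have "0 \<le> (s - 1)\<^sup>2" by simp
    thus ?thesis using s unfolding v_def by (simp add: power2_eq_square algebra_simps)
  qed
  hence "s ^ t \<le> v ^ t" using s by (intro power_mono)
  moreover have "exp (- u * s\<^sup>2) \<le> exp u * (fact (t + 1) / (u * v) ^ (t + 1))"
  proof -
    have "- u * s\<^sup>2 = u + - (u * v)" by (simp add: v_def algebra_simps)
    hence "exp (- u * s\<^sup>2) = exp u * exp (- (u * v))" by (simp only: exp_add)
    also have "\<dots> \<le> exp u * (fact (t + 1) / (u * v) ^ (t + 1))"
      using u v by (intro mult_left_mono exp_minus_le_fact_divide_power) auto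
    finally show ?thesis .
  qed
  ultimately have "s ^ t * exp (- u * s\<^sup>2) \<le> v ^ t * (exp u * (fact (t + 1) / (u * v) ^ (t + 1)))"
    using v by (intro mult_mono) auto
  also have "\<dots> = exp u * fact (t + 1) / u ^ (t + 1) * (1 / v)"
    using u v by (simp add: power_mult_distrib)
  finally have le: "s ^ t * exp (- u * s\<^sup>2) \<le> exp u * fact (t + 1) / u ^ (t + 1) * (1 / v)" .
  \<comment> \<open>The constant 8 comes from 8 * (1 + s^2) - (2 + s)^2 = 6 * s^2 + (s -
    2)^2.\<close>
  have "1 / v \<le> 8 * (1 / (1 + \<bar>real_of_int j\<bar>)\<^sup>2)"
  proof -
    have "1 + \<bar>real_of_int j\<bar> \<le> 2 + s" using a by (simp add: s_def)
    hence "(1 + \<bar>real_of_int j\<bar>)\<^sup>2 \<le> (2 + s)\<^sup>2" by (intro power_mono) auto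
    also have "\<dots> \<le> 8 * v"
    proof -
      have "8 * v - (2 + s)\<^sup>2 = 6 * s\<^sup>2 + (s - 2)\<^sup>2"
        by (simp add: v_def power2_eq_square algebra_simps)
      also have "\<dots> \<ge> 0" by (intro add_nonneg_nonneg) auto
      finally show ?thesis by simp
    qed
    finally have "(1 + \<bar>real_of_int j\<bar>)\<^sup>2 \<le> 8 * v" .
    moreover have "0 < (1 + \<bar>real_of_int j\<bar>)\<^sup>2" by (intro zero_less_power) linarith
    ultimately show ?thesis using v by (simp add: field_simps)
  qed
  also have "1 / (1 + \<bar>real_of_int j\<bar>)\<^sup>2 = (1 + \<bar>real_of_int j\<bar>) powr (- 2)"
    by (simp add: powr_minus_divide powr_numeral add_pos_nonneg)
  finally have "exp u * fact (t + 1) / u ^ (t + 1) * (1 / v) \<le> exp u * fact (t + 1) / u ^ (t + 1) * (8 * (1 + \<bar>real_of_int j\<bar>) powr (- 2))"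
    using u by (intro mult_left_mono) auto
  with le have "s ^ t * exp (- u * s\<^sup>2) \<le> ?C * (1 + \<bar>real_of_int j\<bar>) powr (- 2)"
    by simp
  thus "\<bar>of_int j + a\<bar> ^ t * exp (- u * (of_int j + a)\<^sup>2) \<le> ?C * (1 + \<bar>real_of_int j\<bar>) powr (- 2)"
    by (simp add: s_def)
qed auto

text \<open>The part of the theta summand common to all t, with m = j + alpha; it will play the role
  of b in the triple product.\<close>

definition theta_term :: "nat \<Rightarrow> nat \<Rightarrow> complex \<Rightarrow> int \<Rightarrow> complex" where
  "theta_term n l \<tau> j = exp (of_real pi * \<i> * (of_int j + of_rat (\<alpha> n l))) *
     exp (of_real pi * \<i> * (of_int j + of_rat (\<alpha> n l))\<^sup>2 * (of_nat n * \<tau>))"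

lemma theta_eq_infsum_int:
  "theta t (\<alpha> n l) (of_nat n * \<tau>) = (\<Sum>\<^sub>\<infinity>j\<in>UNIV. theta_term n l \<tau> j * (of_int j + of_rat (\<alpha> n l)) ^ t)"
proof -
  let ?f = "\<lambda>m. exp (of_real pi * \<i> * of_rat m) * of_rat m ^ t * exp (of_real pi * \<i> * (of_rat m)\<^sup>2 * (of_nat n * \<tau>))"
  let ?g = "\<lambda>j::int. of_int j + \<alpha> n l"
  have "theta t (\<alpha> n l) (of_nat n * \<tau>) = infsum ?f (range ?g)"
    unfolding theta_def by (rule arg_cong[of _ _ "infsum _"]) auto
  also have "\<dots> = infsum (?f \<circ> ?g) UNIV"
    by (rule infsum_reindex) (auto simp: inj_def)
  also have "\<dots> = (\<Sum>\<^sub>\<infinity>j\<in>UNIV. theta_term n l \<tau> j * (of_int j + of_rat (\<alpha> n l)) ^ t)"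
    by (rule infsum_cong) (simp add: theta_term_def of_rat_add)
  finally show ?thesis .
qed

lemma of_rat_alpha: "(of_rat (\<alpha> n l) :: complex) = of_real (real l / real n - 1 / 2)"
  by (simp add: \<alpha>_def of_rat_diff of_rat_divide)

text \<open>The recurrence of the triple product with x = q^l and Q = q^n. Raising j by one changes
  the exponent of q by n * j + n * alpha + n / 2 = n * j + l, which is why alpha is l/n - 1/2; the
  sign is exp (pi * i).\<close>

lemma theta_term_Suc:
  assumes "n > 0"
  defines "q \<equiv> (\<lambda>\<tau>. exp (2 * of_real pi * \<i> * \<tau>))"
  shows "theta_term n l \<tau> (j + 1) = - (q \<tau> ^ l) * (q \<tau> ^ n) powi j * theta_term n l \<tau> j"
proof -
  define a where "a = (of_rat (\<alpha> n l) :: complex)"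
  have na: "of_nat n * a = of_nat l - of_nat n / 2"
    using assms(1) by (simp add: a_def of_rat_alpha field_simps)
  define z where "z = of_real pi * \<i>"
  have "theta_term n l \<tau> (j + 1) = exp (z * (of_int j + a + 1) + z * (of_int j + a + 1)\<^sup>2 * (of_nat n * \<tau>))"
    by (simp add: theta_term_def a_def z_def exp_add add_ac)
  also have "z * (of_int j + a + 1) + z * (of_int j + a + 1)\<^sup>2 * (of_nat n * \<tau>) =
      (z * (of_int j + a) + z * (of_int j + a)\<^sup>2 * (of_nat n * \<tau>)) + z + 2 * z * \<tau> * (of_int j * of_nat n) +
      z * \<tau> * (2 * (of_nat n * a) + of_nat n)"
    by (simp add: power2_eq_square algebra_simps)
  also have "2 * (of_nat n * a) + of_nat n = 2 * of_nat l" unfolding na by simp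
  also have "exp ((z * (of_int j + a) + z * (of_int j + a)\<^sup>2 * (of_nat n * \<tau>)) + z + 2 * z * \<tau> * (of_int j * of_nat n) +
      z * \<tau> * (2 * of_nat l)) =
      theta_term n l \<tau> j * exp z * exp (2 * z * \<tau> * (of_int j * of_nat n)) * exp (z * \<tau> * (2 * of_nat l))"
    by (simp only: exp_add theta_term_def a_def z_def)
  also have "exp z = -1" unfolding z_def by (rule exp_pi_i)
  also have "exp (z * \<tau> * (2 * of_nat l)) = q \<tau> ^ l"
    by (simp add: q_def z_def exp_of_nat_mult[symmetric] mult_ac)
  also have "exp (2 * z * \<tau> * (of_int j * of_nat n)) = (q \<tau> ^ n) powi j"
    by (simp add: q_def z_def exp_of_nat_mult[symmetric] exp_power_int mult_ac)
  finally show ?thesis by simp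
qed

lemma norm_theta_term:
  assumes "n > 0"
  shows "norm (theta_term n l \<tau> j) = exp (- (pi * real n * Im \<tau>) * (of_int j + (real l / real n - 1 / 2))\<^sup>2)"
proof -
  define c where "c = of_int j + (real l / real n - 1 / 2)"
  have "of_int j + of_rat (\<alpha> n l) = (of_real c :: complex)" by (simp add: of_rat_alpha c_def)
  hence "theta_term n l \<tau> j = exp (of_real (pi * c) * \<i>) * exp (of_real (pi * c\<^sup>2 * real n) * (\<i> * \<tau>))"
    by (simp add: theta_term_def mult_ac)
  also have "norm \<dots> = exp (- (pi * real n * Im \<tau>) * c\<^sup>2)"
    unfolding norm_mult norm_exp_eq_Re by (simp add: mult_ac)
  finally show ?thesis by (simp add: c_def)
qed

text \<open>The last factor shifts the exponents j of the triple product to j + alpha, so that the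
  coefficient of z^t becomes a moment of order t. The second kind of factor belongs to the residue
  class of -l.\<close>

definition theta_product :: "nat \<Rightarrow> nat \<Rightarrow> complex \<Rightarrow> nat \<Rightarrow> complex fps" where
  "theta_product n l q N =
     (\<Prod>i<N. (1 - fps_const (q ^ (l + n * i)) * fps_exp 1) * (1 - fps_const (q ^ (n - l + n * i)) * fps_exp (- 1))) *
       fps_exp (of_rat (\<alpha> n l))"

text \<open>The finite triple product and dominated convergence give the limit. The factor kappa,
  which is the limit of the \<open>triple_coeff\<close> divided by b 0, is the same for all t and
  will cancel in quotients.\<close>

lemma theta_product_nth_LIMSEQ:
  assumes \<tau>: "Im \<tau> > 0" and l: "0 < l" "l < n"
  obtains \<kappa> where "\<kappa> \<noteq> 0"
    "\<And>t. (\<lambda>N. fps_nth (theta_product n l (exp (2 * of_real pi * \<i> * \<tau>)) N) t) \<longlonglongrightarrow> \<kappa> * theta t (\<alpha> n l) (of_nat n * \<tau>) / fact t"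
proof -
  define q where "q = exp (2 * of_real pi * \<i> * \<tau>)"
  define Q where "Q = q ^ n"
  define x where "x = q ^ l"
  define a where "a = (of_rat (\<alpha> n l) :: complex)"
  define b where "b = theta_term n l \<tau>"
  have q: "norm q < 1" "q \<noteq> 0" unfolding q_def by (rule norm_exp_2pi_i[OF \<tau>]) simp
  have Q: "norm Q < 1" "Q \<noteq> 0" using q l by (auto simp: Q_def norm_power power_less_one_iff)
  have x: "x \<noteq> 0" using q by (simp add: x_def)
  have b_rec: "b (j + 1) = - x * Q powi j * b j" for j
    unfolding b_def x_def Q_def q_def using l by (intro theta_term_Suc) auto
  have b0: "b 0 \<noteq> 0" by (simp add: b_def theta_term_def)
  obtain L C where L: "L \<noteq> 0" "\<And>j. (\<lambda>N. triple_coeff Q N j) \<longlonglongrightarrow> L" "\<And>N j. norm (triple_coeff Q N j) \<le> C" "C > 0"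
    by (rule triple_coeff_limit[OF Q]) blast
  have prod: "fps_const (b 0) * theta_product n l q N = (\<Sum>j=-int N..int N. fps_const (b j * triple_coeff Q N j) * fps_exp (of_int j + a))" for N
  proof -
    have "theta_product n l q N = (\<Prod>i<N. (1 - fps_const (x * Q ^ i) * fps_exp 1) * (1 - fps_const (Q ^ Suc i / x) * fps_exp (- 1))) * fps_exp a"
    proof -
      have "q ^ (l + n * i) = x * Q ^ i" for i by (simp add: x_def Q_def power_add power_mult)
      moreover have "q ^ (n - l + n * i) = Q ^ Suc i / x" for i
      proof -
        have "q ^ (n - l + n * i) * x = q ^ (n - l + n * i + l)" by (simp add: x_def power_add)
        also have "n - l + n * i + l = n * Suc i" using l by simp
        also have "q ^ (n * Suc i) = Q ^ Suc i" by (simp only: Q_def power_mult)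
        finally show ?thesis using x by (simp add: field_simps)
      qed
      ultimately show ?thesis by (simp only: theta_product_def a_def)
    qed
    hence "fps_const (b 0) * theta_product n l q N = (\<Sum>j=-int N..int N. fps_const (b j * triple_coeff Q N j) * fps_exp (of_int j)) * fps_exp a"
      using finite_Jacobi_triple_product[OF Q x b_rec, of N] by (simp only: mult.assoc[symmetric])
    thus ?thesis by (simp add: sum_distrib_right mult.assoc fps_exp_add_mult)
  qed
  \<comment> \<open>Because \<open>triple_coeff\<close> vanishes for |j| > N, the sum extends to all
    integers, a fixed index set on which N can tend to infinity.\<close>
  have nth: "fps_nth (theta_product n l q N) t = 1 / (b 0 * fact t) * (\<Sum>\<^sub>\<infinity>j\<in>UNIV. triple_coeff Q N j * (b j * (of_int j + a) ^ t))" for N t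
  proof -
    have "b 0 * fps_nth (theta_product n l q N) t = (\<Sum>j=-int N..int N. b j * triple_coeff Q N j * ((of_int j + a) ^ t / fact t))"
      using arg_cong[OF prod[of N], of "\<lambda>f. fps_nth f t"] by (simp add: fps_sum_nth)
    also have "\<dots> = 1 / fact t * (\<Sum>j=-int N..int N. triple_coeff Q N j * (b j * (of_int j + a) ^ t))"
      by (simp add: sum_distrib_left mult_ac)
    also have "(\<Sum>j=-int N..int N. triple_coeff Q N j * (b j * (of_int j + a) ^ t)) = (\<Sum>\<^sub>\<infinity>j\<in>{-int N..int N}. triple_coeff Q N j * (b j * (of_int j + a) ^ t))"
      by simp
    also have "\<dots> = (\<Sum>\<^sub>\<infinity>j\<in>UNIV. triple_coeff Q N j * (b j * (of_int j + a) ^ t))"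
      by (intro infsum_cong_neutral) (auto simp: triple_coeff_eq_0[OF Q])
    finally show ?thesis using b0 by (simp add: field_simps)
  qed
  have lim: "(\<lambda>N. fps_nth (theta_product n l q N) t) \<longlonglongrightarrow> (L / b 0) * theta t (\<alpha> n l) (of_nat n * \<tau>) / fact t" for t
  proof -
    define r where "r = real l / real n - 1 / 2"
    have a: "a = of_real r" by (simp add: a_def r_def of_rat_alpha)
    have "0 < real l / real n" "real l / real n < 1" using l by auto
    hence r: "\<bar>r\<bar> \<le> 1" unfolding r_def by linarith
    have norm_b: "norm (b j * (of_int j + a) ^ t) = \<bar>of_int j + r\<bar> ^ t * exp (- (pi * real n * Im \<tau>) * (of_int j + r)\<^sup>2)" for j
    proof -
      have "of_int j + a = of_real (of_int j + r)" by (simp add: a)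
      hence "norm ((of_int j + a) ^ t) = \<bar>of_int j + r\<bar> ^ t" by (simp only: norm_power norm_of_real)
      moreover have "norm (b j) = exp (- (pi * real n * Im \<tau>) * (of_int j + r)\<^sup>2)"
        unfolding b_def r_def by (rule norm_theta_term) (use l in auto)
      ultimately show ?thesis by (simp only: norm_mult mult.commute)
    qed
    have "(\<lambda>N. \<Sum>\<^sub>\<infinity>j\<in>UNIV. triple_coeff Q N j * (b j * (of_int j + a) ^ t)) \<longlonglongrightarrow> (\<Sum>\<^sub>\<infinity>j\<in>UNIV. L * (b j * (of_int j + a) ^ t))"
    proof (rule tendsto_infsum_dominated)
      show "(\<lambda>j::int. C * (\<bar>of_int j + r\<bar> ^ t * exp (- (pi * real n * Im \<tau>) * (of_int j + r)\<^sup>2))) summable_on UNIV"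
        by (rule summable_on_cmult_right[OF summable_on_gaussian_moments]) (use r \<tau> l in \<open>auto intro!: mult_pos_pos\<close>)
      show "norm (triple_coeff Q N j * (b j * (of_int j + a) ^ t)) \<le> C * (\<bar>of_int j + r\<bar> ^ t * exp (- (pi * real n * Im \<tau>) * (of_int j + r)\<^sup>2))" for N j
        unfolding norm_b[symmetric] norm_mult[of "triple_coeff Q N j"] using L(3) by (intro mult_right_mono) auto
    qed (intro tendsto_mult tendsto_const L)
    also have "(\<Sum>\<^sub>\<infinity>j\<in>UNIV. L * (b j * (of_int j + a) ^ t)) = L * theta t (\<alpha> n l) (of_nat n * \<tau>)"
      unfolding theta_eq_infsum_int b_def a_def by (rule infsum_cmult_right')
    finally have "(\<lambda>N. 1 / (b 0 * fact t) * (\<Sum>\<^sub>\<infinity>j\<in>UNIV. triple_coeff Q N j * (b j * (of_int j + a) ^ t))) \<longlonglongrightarrow>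
        1 / (b 0 * fact t) * (L * theta t (\<alpha> n l) (of_nat n * \<tau>))"
      by (intro tendsto_mult tendsto_const)
    thus ?thesis unfolding nth by (simp add: mult_ac)
  qed
  show ?thesis by (rule that[of "L / b 0"]) (use L(1) b0 lim in \<open>auto simp: q_def\<close>)
qed

text \<open>At z = 0 the product splits into two convergent products without zero factors. Together
  with the previous limit this shows that theta has no zero here.\<close>

lemma theta_product_nth_0_LIMSEQ:
  assumes q: "norm q < 1" and l: "0 < l" "l < n"
  obtains L where "L \<noteq> 0" "(\<lambda>N. fps_nth (theta_product n l q N) 0) \<longlonglongrightarrow> L"
proof -
  have part: "\<exists>L. L \<noteq> 0 \<and> (\<lambda>N. \<Prod>i<N. 1 - q ^ (m + n * i)) \<longlonglongrightarrow> L" if m: "m > 0" for m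
  proof -
    have "norm (q ^ n) < 1" using q l by (simp add: norm_power power_less_one_iff)
    hence "summable (\<lambda>i. norm (q ^ m) * norm (q ^ n) ^ i)" by (intro summable_mult summable_geometric) simp
    hence "summable (\<lambda>i. norm (q ^ (m + n * i)))" by (simp add: power_add power_mult norm_mult norm_power)
    moreover have "q ^ (m + n * i) \<noteq> 1" for i
    proof -
      have "norm (q ^ (m + n * i)) < 1" using q m by (simp add: norm_power power_less_one_iff)
      thus ?thesis by auto
    qed
    ultimately show ?thesis using prod_one_minus_LIMSEQ_nonzero[of "\<lambda>i. q ^ (m + n * i)"] by metis
  qed
  obtain L1 where L1: "L1 \<noteq> 0" "(\<lambda>N. \<Prod>i<N. 1 - q ^ (l + n * i)) \<longlonglongrightarrow> L1" using part[OF l(1)] by blast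
  obtain L2 where L2: "L2 \<noteq> 0" "(\<lambda>N. \<Prod>i<N. 1 - q ^ (n - l + n * i)) \<longlonglongrightarrow> L2" using part[of "n - l"] l by auto
  have "fps_nth (theta_product n l q N) 0 = (\<Prod>i<N. 1 - q ^ (l + n * i)) * (\<Prod>i<N. 1 - q ^ (n - l + n * i))" for N
    by (induction N) (auto simp: theta_product_def mult_ac)
  thus ?thesis using that[of "L1 * L2"] tendsto_mult[OF L1(2) L2(2)] L1(1) L2(1) by simp
qed

lemma theta_quotient_LIMSEQ:
  assumes \<tau>: "Im \<tau> > 0" and l: "0 < l" "l < n"
  defines "\<Psi> \<equiv> theta_product n l (exp (2 * of_real pi * \<i> * \<tau>))"
  shows "(\<lambda>N. fps_nth (\<Psi> N) t / fps_nth (\<Psi> N) 0) \<longlonglongrightarrow>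
           theta t (\<alpha> n l) (of_nat n * \<tau>) / theta 0 (\<alpha> n l) (of_nat n * \<tau>) / fact t"
proof -
  obtain \<kappa> where \<kappa>: "\<kappa> \<noteq> 0" "\<And>t. (\<lambda>N. fps_nth (\<Psi> N) t) \<longlonglongrightarrow> \<kappa> * theta t (\<alpha> n l) (of_nat n * \<tau>) / fact t"
    unfolding \<Psi>_def by (rule theta_product_nth_LIMSEQ[OF \<tau> l]) blast
  obtain L where L: "L \<noteq> 0" "(\<lambda>N. fps_nth (\<Psi> N) 0) \<longlonglongrightarrow> L"
    unfolding \<Psi>_def by (rule theta_product_nth_0_LIMSEQ[OF norm_exp_2pi_i[OF \<tau>] l]) blast
  \<comment> \<open>Two evaluations of the limit of the constant term; since L is nonzero, so is
    theta.\<close>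
  have eq: "L = \<kappa> * theta 0 (\<alpha> n l) (of_nat n * \<tau>)"
    using LIMSEQ_unique[OF L(2) \<kappa>(2)[of 0]] by simp
  hence nz: "theta 0 (\<alpha> n l) (of_nat n * \<tau>) \<noteq> 0" using L(1) by auto
  have "(\<lambda>N. fps_nth (\<Psi> N) t / fps_nth (\<Psi> N) 0) \<longlonglongrightarrow> (\<kappa> * theta t (\<alpha> n l) (of_nat n * \<tau>) / fact t) / L"
    by (intro tendsto_divide \<kappa>(2) L)
  thus ?thesis using \<kappa>(1) nz by (simp add: eq mult.commute)
qed

section \<open>The product over residue classes and the conclusion\<close>

lemma fps_nth_prod:
  fixes f :: "'b \<Rightarrow> 'a :: comm_ring_1 fps"
  assumes "finite S"
  shows "fps_nth (\<Prod>l\<in>S. f l) k = (\<Sum>i | i \<in> S \<rightarrow>\<^sub>E UNIV \<and> (\<Sum>l\<in>S. i l) = k. \<Prod>l\<in>S. fps_nth (f l) (i l))"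
  using assms
proof (induction S arbitrary: k rule: finite_induct)
  case empty
  have "{i :: 'b \<Rightarrow> nat. i \<in> {} \<rightarrow>\<^sub>E UNIV \<and> 0 = k} = (if k = 0 then {\<lambda>_. undefined} else {})" by auto
  thus ?case by simp
next
  case (insert x S)
  let ?D = "\<lambda>S k. {i :: 'b \<Rightarrow> nat. i \<in> S \<rightarrow>\<^sub>E UNIV \<and> (\<Sum>l\<in>S. i l) = k}"
  have fin: "finite (?D S k)" for k
  proof (rule finite_subset)
    show "?D S k \<subseteq> S \<rightarrow>\<^sub>E {..k}"
    proof
      fix i assume i: "i \<in> ?D S k"
      have "i l \<le> k" if "l \<in> S" for l
        using member_le_sum[of l S i] that insert.hyps(1) i by auto
      with i show "i \<in> S \<rightarrow>\<^sub>E {..k}" by (auto simp: PiE_iff)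
    qed
    show "finite (S \<rightarrow>\<^sub>E {..k})" using insert.hyps(1) by (intro finite_PiE) auto
  qed
  have "fps_nth (\<Prod>l\<in>insert x S. f l) k = (\<Sum>a\<in>{..k}. \<Sum>i\<in>?D S (k - a). fps_nth (f x) a * (\<Prod>l\<in>S. fps_nth (f l) (i l)))"
    using insert by (simp add: fps_mult_nth atLeast0AtMost sum_distrib_left)
  also have "\<dots> = (\<Sum>(a, i)\<in>(SIGMA a:{..k}. ?D S (k - a)). fps_nth (f x) a * (\<Prod>l\<in>S. fps_nth (f l) (i l)))"
    by (rule sum.Sigma) (use fin in auto)
  also have "\<dots> = (\<Sum>i\<in>?D (insert x S) k. \<Prod>l\<in>insert x S. fps_nth (f l) (i l))"
  \<comment> \<open>A tuple on the larger index set is split into its value at x and the rest, reset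
    to \<open>undefined\<close> at x so that it is again extensional.\<close>
  proof (rule sum.reindex_bij_witness[of _ "\<lambda>i. (i x, i(x := undefined))" "\<lambda>(a, i). i(x := a)"])
    fix p assume p: "p \<in> (SIGMA a:{..k}. ?D S (k - a))"
    obtain a i where ai: "p = (a, i)" by force
    have i: "a \<le> k" "i \<in> S \<rightarrow>\<^sub>E UNIV" "(\<Sum>l\<in>S. i l) = k - a" using p by (auto simp: ai)
    have upd: "(\<Sum>l\<in>S. (i(x := a)) l) = (\<Sum>l\<in>S. i l)" "(\<Prod>l\<in>S. fps_nth (f l) ((i(x := a)) l)) = (\<Prod>l\<in>S. fps_nth (f l) (i l))"
      using insert.hyps(2) by (auto intro!: sum.cong prod.cong)
    have "i x = undefined" using i(2) insert.hyps(2) by (auto simp: PiE_iff extensional_def)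
    thus "((case p of (a, i) \<Rightarrow> i(x := a)) x, (case p of (a, i) \<Rightarrow> i(x := a))(x := undefined)) = p"
      by (auto simp: ai)
    show "(case p of (a, i) \<Rightarrow> i(x := a)) \<in> ?D (insert x S) k"
      using i insert.hyps upd by (auto simp: ai PiE_iff extensional_def)
    show "(\<Prod>l\<in>insert x S. fps_nth (f l) ((case p of (a, i) \<Rightarrow> i(x := a)) l)) =
            (case p of (a, i) \<Rightarrow> fps_nth (f x) a * (\<Prod>l\<in>S. fps_nth (f l) (i l)))"
      using insert.hyps upd by (simp add: ai)
  next
    fix i assume i: "i \<in> ?D (insert x S) k"
    have upd: "(\<Sum>l\<in>S. (i(x := undefined)) l) = (\<Sum>l\<in>S. i l)"
      using insert.hyps(2) by (auto intro!: sum.cong)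
    show "(case (i x, i(x := undefined)) of (a, i) \<Rightarrow> i(x := a)) = i" by simp
    show "(i x, i(x := undefined)) \<in> (SIGMA a:{..k}. ?D S (k - a))"
      using i insert.hyps upd by (auto simp: PiE_iff extensional_def)
  qed
  finally show ?case .
qed

lemma prod_symmetric_representatives:
  fixes S :: "nat set" and g :: "nat \<Rightarrow> 'a :: comm_monoid_mult"
  assumes S: "S \<subseteq> {1..<n}" "\<And>l. l \<in> S \<Longrightarrow> n - l \<in> S"
  shows "(\<Prod>l\<in>S. g (n - l)) = (\<Prod>l\<in>S. g l)"
proof -
  have "n - (n - l) = l" if "l \<in> S" for l
      using subsetD[OF S(1) that] by simp
  thus ?thesis
    using S(2) by (intro prod.reindex_bij_witness[of _ "\<lambda>l. n - l" "\<lambda>l. n - l"]) auto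
qed

text \<open>Since l -> n - l permutes S, the factors with exp (-z) can be reassigned to the class of
  l. They pair with those with exp z into (1 - q^m)^2 times the factor in \<open>X_fps\<close>, and
  dividing by constant terms removes the squares.\<close>

lemma prod_theta_product:
  fixes q :: complex
  assumes S: "S \<subseteq> {1..<n}" "\<And>l. l \<in> S \<Longrightarrow> n - l \<in> S" and q: "norm q < 1"
  shows "(\<Prod>l\<in>S. fps_const (1 / fps_nth (theta_product n l q N) 0) * theta_product n l q N) =
           (\<Prod>m\<in>(\<lambda>(l, i). l + n * i) ` (S \<times> {..<N}). 1 + fps_const (q ^ m / (1 - q ^ m)\<^sup>2) * X_fps)"
proof -
  let ?E = "\<lambda>m. 1 - fps_const (q ^ m) * fps_exp 1" and ?F = "\<lambda>m. 1 - fps_const (q ^ m) * fps_exp (- 1)"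
  let ?I = "S \<times> {..<N}" and ?g = "\<lambda>(l, i). l + n * i"
  let ?p = "\<lambda>m. 1 + fps_const (q ^ m / (1 - q ^ m)\<^sup>2) * X_fps"
  have fin: "finite S" using S(1) by (rule finite_subset) auto
  have inj: "inj_on ?g ?I"
  proof (rule inj_onI, clarify)
    fix l i l' i' assume "l \<in> S" "l' \<in> S" and eq: "l + n * i = l' + n * i'"
    hence l: "l < n" "l' < n" using S(1) by auto
    hence "l = (l + n * i) mod n" "l' = (l' + n * i') mod n" by simp_all
    hence "l = l'" using eq by metis
    with eq l show "l = l' \<and> i = i'" by simp
  qed
  have norm_lt: "q ^ m \<noteq> 1" if "m \<in> ?g ` ?I" for m
  proof -
    have "m > 0" using that S(1) by fastforce
    hence "norm (q ^ m) < 1" using q by (simp add: norm_power power_less_one_iff)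
    thus ?thesis by auto
  qed
  define C where "C = (\<Prod>m\<in>?g ` ?I. (1 - q ^ m)\<^sup>2)"
  have C: "C \<noteq> 0" unfolding C_def using fin norm_lt by (auto simp: prod_zero_iff)
  \<comment> \<open>\<open>\<alpha> n (n - l)\<close> is the negative of
    \<open>\<alpha> n l\<close>, so the sum over the symmetric set equals its own negative.\<close>
  have alpha_sum: "(\<Prod>l\<in>S. fps_exp (of_rat (\<alpha> n l) :: complex)) = 1"
  proof -
    have exp_prod: "(\<Prod>l\<in>S. fps_exp (c l :: complex)) = fps_exp (\<Sum>l\<in>S. c l)" for c
      using fin by (induction S rule: finite_induct) (auto simp: fps_exp_add_mult)
    have "(\<Sum>l\<in>S. of_rat (\<alpha> n l) :: complex) = (\<Sum>l\<in>S. of_rat (\<alpha> n (n - l)))"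
    proof -
      have "n - (n - l) = l" if "l \<in> S" for l
      using subsetD[OF S(1) that] by simp
      thus ?thesis
        using S(2) by (intro sum.reindex_bij_witness[of _ "\<lambda>l. n - l" "\<lambda>l. n - l"]) auto
    qed
    also have "\<dots> = (\<Sum>l\<in>S. - of_rat (\<alpha> n l))"
    proof (rule sum.cong)
      fix l assume "l \<in> S"
      hence "l < n" "l > 0" using S(1) by auto
      thus "of_rat (\<alpha> n (n - l)) = (- of_rat (\<alpha> n l) :: complex)"
        by (simp add: of_rat_alpha of_nat_diff field_simps)
    qed auto
    finally have "(\<Sum>l\<in>S. of_rat (\<alpha> n l) :: complex) = 0" by (simp add: sum_negf)
    thus ?thesis by (simp add: exp_prod)
  qed
  have "(\<Prod>l\<in>S. theta_product n l q N) = (\<Prod>l\<in>S. \<Prod>i<N. ?E (l + n * i)) * (\<Prod>l\<in>S. \<Prod>i<N. ?F (n - l + n * i))"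
    by (simp add: theta_product_def prod.distrib alpha_sum)
  also have "(\<Prod>l\<in>S. \<Prod>i<N. ?F (n - l + n * i)) = (\<Prod>l\<in>S. \<Prod>i<N. ?F (l + n * i))"
    by (rule prod_symmetric_representatives[OF S])
  also have "(\<Prod>l\<in>S. \<Prod>i<N. ?E (l + n * i)) * \<dots> = (\<Prod>x\<in>?I. ?E (?g x) * ?F (?g x))"
    by (simp add: prod.cartesian_product prod.distrib case_prod_unfold)
  also have "\<dots> = (\<Prod>m\<in>?g ` ?I. ?E m * ?F m)"
    using inj by (simp add: prod.reindex o_def)
  also have "\<dots> = (\<Prod>m\<in>?g ` ?I. fps_const ((1 - q ^ m)\<^sup>2) * ?p m)"
    by (intro prod.cong refl X_factor_product[symmetric] norm_lt)
  also have "\<dots> = fps_const C * (\<Prod>m\<in>?g ` ?I. ?p m)"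
    by (simp only: prod.distrib prod_fps_const C_def)
  finally have prod: "(\<Prod>l\<in>S. theta_product n l q N) = fps_const C * (\<Prod>m\<in>?g ` ?I. ?p m)" .
  have nth0: "fps_nth (\<Prod>x\<in>A. f x) 0 = (\<Prod>x\<in>A. fps_nth (f x) 0)" for A :: "nat set" and f :: "nat \<Rightarrow> complex fps"
    by (induction A rule: infinite_finite_induct) auto
  \<comment> \<open>\<open>X_fps\<close> has no constant term, so only C survives in the coefficient
    0.\<close>
  have "(\<Prod>l\<in>S. fps_nth (theta_product n l q N) 0) = C"
    using arg_cong[OF prod, of "\<lambda>f. fps_nth f 0"] by (simp add: nth0 X_fps_def)
  hence "(\<Prod>l\<in>S. 1 / fps_nth (theta_product n l q N) 0) = 1 / C" by (simp add: prod_dividef)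
  hence "(\<Prod>l\<in>S. fps_const (1 / fps_nth (theta_product n l q N) 0) * theta_product n l q N) =
         fps_const (1 / C) * (fps_const C * (\<Prod>m\<in>?g ` ?I. ?p m))"
    by (simp only: prod.distrib prod prod_fps_const)
  also have "\<dots> = (\<Prod>m\<in>?g ` ?I. ?p m)"
    using C by (simp add: mult.assoc[symmetric])
  finally show ?thesis .
qed

text \<open>The same finite products have two coefficientwise limits, one through theta quotients
  and one through the A_k. The multinomial coefficient consists of the factorials that the power
  series coefficients of the theta quotients carry.\<close>

lemma weight_part_form_eq_A_generating:
  assumes n: "n > 0" and S: "symmetric_representatives n S" "n \<notin> S" and \<tau>: "Im \<tau> > 0"
  shows "weight_part_form S n w \<tau> = fact (2 * w) *
    (\<Sum>k\<le>2 * w. fps_nth (X_fps ^ k) (2 * w) * A_series S n k (exp (2 * of_real pi * \<i> * \<tau>)))"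
proof -
  define q where "q = exp (2 * of_real pi * \<i> * \<tau>)"
  define T where "T = {m. 0 < m \<and> (\<exists>s\<in>S. [m = s] (mod n))}"
  \<comment> \<open>The first N members of every residue class, matching the N-th partial theta
    products.\<close>
  define Ts where "Ts = (\<lambda>N. (\<lambda>(l, i). l + n * i) ` (S \<times> {..<N}))"
  have S1: "S \<subseteq> {1..<n}"
  proof
    fix l assume "l \<in> S"
    moreover from this have "l \<noteq> n" using S(2) by auto
    ultimately show "l \<in> {1..<n}" using S(1) by (force simp: symmetric_representatives_def)
  qed
  \<comment> \<open>The congruent representative s satisfies 0 < s + l < 2 * n with n dividing s +
    l, which forces s = n - l.\<close>
  have S2: "n - l \<in> S" if l: "l \<in> S" for l
  proof -
    obtain s where s: "s \<in> S" "[int s = - int l] (mod int n)"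
      using S(1) l by (auto simp: symmetric_representatives_def)
    have ln: "l < n" "1 \<le> l" "s < n" "1 \<le> s" using S1 l s by auto
    have "[int s + int l = - int l + int l] (mod int n)" using s(2) by (rule cong_add) auto
    hence "n dvd s + l" by (simp add: cong_iff_dvd_diff flip: of_nat_add)
    then obtain c where c: "s + l = n * c" by (elim dvdE)
    have "c < 2"
    proof (rule ccontr)
      assume "\<not> c < 2"
      hence "n * 2 \<le> n * c" by (intro mult_le_mono2) auto
      thus False using c ln by linarith
    qed
    moreover have "c \<noteq> 0" using c ln by (intro notI) simp
    ultimately have "c = 1" by simp
    hence "s = n - l" using c by simp
    with s show ?thesis by simp
  qed
  have fin: "finite S" using S1 by (rule finite_subset) auto
  have lim: "filterlim Ts (finite_subsets_at_top T) sequentially"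
    unfolding filterlim_finite_subsets_at_top
  proof safe
    fix U assume U: "finite U" "U \<subseteq> T"
    obtain M where M: "\<forall>m\<in>U. m < M" using U(1) finite_nat_set_iff_bounded by blast
    show "\<forall>\<^sub>F N in sequentially. finite (Ts N) \<and> U \<subseteq> Ts N \<and> Ts N \<subseteq> T"
    proof (intro eventually_sequentiallyI[of M] conjI)
      fix N assume N: "N \<ge> M"
      show "finite (Ts N)" unfolding Ts_def using fin by auto
      show "Ts N \<subseteq> T"
      proof
        fix m assume "m \<in> Ts N"
        then obtain l i where l: "m = l + n * i" "l \<in> S" by (auto simp: Ts_def)
        have "0 < m" using subsetD[OF S1 l(2)] by (simp add: l(1))
        moreover have "[m = l] (mod n)" by (simp add: l(1) cong_def)
        ultimately show "m \<in> T" using l(2) unfolding T_def by blast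
      qed
      show "U \<subseteq> Ts N"
      proof
        fix m assume m: "m \<in> U"
        then obtain s where s: "s \<in> S" "[m = s] (mod n)" using U by (auto simp: T_def)
        hence "s = m mod n" using S1 by (auto simp: cong_def)
        hence eq: "m = s + n * (m div n)" by simp
        have "m div n \<le> m" by simp
        also have "m < N" using m M N by auto
        finally show "m \<in> Ts N" unfolding Ts_def using s(1) by (intro image_eqI[of _ _ "(s, m div n)"]) (use eq in auto)
      qed
    qed
  qed
  let ?\<Psi> = "\<lambda>N l. fps_const (1 / fps_nth (theta_product n l q N) 0) * theta_product n l q N"
  let ?D = "{i. i \<in> S \<rightarrow>\<^sub>E (UNIV :: nat set) \<and> (\<Sum>l\<in>S. i l) = 2 * w}"
  have "(\<lambda>N. \<Sum>i\<in>?D. \<Prod>l\<in>S. fps_nth (?\<Psi> N l) (i l)) \<longlonglongrightarrow>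
          (\<Sum>i\<in>?D. \<Prod>l\<in>S. theta (i l) (\<alpha> n l) (of_nat n * \<tau>) / theta 0 (\<alpha> n l) (of_nat n * \<tau>) / fact (i l))"
  proof (intro tendsto_sum tendsto_prod)
    fix i l assume "l \<in> S"
    hence "0 < l" "l < n" using S1 by auto
    from theta_quotient_LIMSEQ[OF \<tau> this, of "i l"]
    show "(\<lambda>N. fps_nth (?\<Psi> N l) (i l)) \<longlonglongrightarrow> theta (i l) (\<alpha> n l) (of_nat n * \<tau>) / theta 0 (\<alpha> n l) (of_nat n * \<tau>) / fact (i l)"
      by (simp add: q_def)
  qed
  also have "(\<Sum>i\<in>?D. \<Prod>l\<in>S. theta (i l) (\<alpha> n l) (of_nat n * \<tau>) / theta 0 (\<alpha> n l) (of_nat n * \<tau>) / fact (i l)) =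
             weight_part_form S n w \<tau> / fact (2 * w)"
    unfolding weight_part_form_def sum_divide_distrib by (intro sum.cong refl) (simp add: prod_dividef prod.distrib mult.commute)
  also have "(\<lambda>N. \<Sum>i\<in>?D. \<Prod>l\<in>S. fps_nth (?\<Psi> N l) (i l)) =
             (\<lambda>N. fps_nth (\<Prod>m\<in>Ts N. 1 + fps_const (q ^ m / (1 - q ^ m)\<^sup>2) * X_fps) (2 * w))"
    unfolding fps_nth_prod[OF fin, symmetric] Ts_def
    using norm_exp_2pi_i[OF \<tau>] unfolding q_def by (subst prod_theta_product[OF S1 S2]) simp_all
  finally have "(\<Sum>k\<le>2 * w. fps_nth (X_fps ^ k) (2 * w) * A_series S n k q) = weight_part_form S n w \<tau> / fact (2 * w)"
    using A_generating_recursion(2)[OF \<tau> T_def lim, of "2 * w"] unfolding q_def by (rule LIMSEQ_unique[rotated])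
  thus ?thesis by (simp add: q_def)
qed

text \<open>The constants are quantified outermost, which expresses that they depend on k and w
  alone.\<close>

theorem theorem1p11:
  shows "\<exists>c :: nat \<Rightarrow> nat \<Rightarrow> complex. \<forall>(n::nat) (S::nat set) (k::nat).
    n > 0 \<longrightarrow> symmetric_representatives n S \<longrightarrow> n \<notin> S \<longrightarrow>
    (\<exists>(\<Gamma> :: (int^2^2) set) (f :: nat \<Rightarrow> complex \<Rightarrow> complex).
       congruence_subgroup \<Gamma> \<and>
       (\<forall>w\<le>k. quasi_modular_form \<Gamma> (2 * w) (f w)) \<and>
       (\<forall>\<tau>\<in>upper_half_plane. A_series S n k (exp (2 * of_real pi * \<i> * \<tau>)) = (\<Sum>w\<le>k. f w \<tau>)) \<and>
       (\<forall>w\<le>k. \<forall>\<tau>\<in>upper_half_plane. f w \<tau> = c k w * weight_part_form S n w \<tau>))"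
proof -
  \<comment> \<open>A universal matrix: its entries come from powers of \<open>X_fps\<close> only,
    and its diagonal is (2 * k)! * (-1)^k.\<close>
  define M where "M = (\<lambda>w j. fact (2 * w) * fps_nth (X_fps ^ j) (2 * w))"
  have "M k k \<noteq> 0" for k by (simp add: M_def X_fps_power_nth)
  then obtain c where c: "\<And>A W k. (\<And>w. W w = (\<Sum>j\<le>w. M w j * A j)) \<Longrightarrow> A k = (\<Sum>w\<le>k. c k w * W w)"
    using triangular_inverse[of M] by metis
  show ?thesis
  proof (intro exI[of _ c] allI impI)
    fix n :: nat and S :: "nat set" and k :: nat
    assume n: "n > 0" and S: "symmetric_representatives n S" "n \<notin> S"
    let ?\<Gamma> = "principal_congruence_subgroup n"
    let ?A = "\<lambda>\<tau> j. A_series S n j (exp (2 * of_real pi * \<i> * \<tau>))"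
    have W: "weight_part_form S n w \<tau> = (\<Sum>j\<le>w. M w j * ?A \<tau> j)" if "\<tau> \<in> upper_half_plane" for w \<tau>
    proof -
      \<comment> \<open>Terms with j > w vanish because the j-th power of \<open>X_fps\<close> has
        order 2 * j; this makes the system lower triangular.\<close>
      have "(\<Sum>j\<le>2 * w. fps_nth (X_fps ^ j) (2 * w) * ?A \<tau> j) = (\<Sum>j\<le>w. fps_nth (X_fps ^ j) (2 * w) * ?A \<tau> j)"
        by (intro sum.mono_neutral_right) (auto simp: X_fps_power_nth)
      thus ?thesis
        using weight_part_form_eq_A_generating[OF n S, of \<tau> w] that
        by (simp add: upper_half_plane_def M_def sum_distrib_left mult.assoc)
    qed
    have "quasi_modular_form ?\<Gamma> (2 * w) (\<lambda>\<tau>. c k w * weight_part_form S n w \<tau>)" for w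
    proof -
      have "quasi_modular_form ?\<Gamma> (2 * w) (\<lambda>\<tau>. c k w * (fact (2 * w) * (\<Sum>j\<le>2 * w. fps_nth (X_fps ^ j) (2 * w) * ?A \<tau> j)))"
        by (intro quasi_modular_form_cmult quasi_modular_form_A_generating[OF n S])
      thus ?thesis
        by (rule quasi_modular_form_cong[THEN iffD1, rotated])
           (simp add: weight_part_form_eq_A_generating[OF n S] upper_half_plane_def)
    qed
    moreover have "?A \<tau> k = (\<Sum>w\<le>k. c k w * weight_part_form S n w \<tau>)" if "\<tau> \<in> upper_half_plane" for \<tau>
      by (rule c[OF W[OF that]])
    ultimately show "\<exists>\<Gamma> f. congruence_subgroup \<Gamma> \<and> (\<forall>w\<le>k. quasi_modular_form \<Gamma> (2 * w) (f w)) \<and>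
       (\<forall>\<tau>\<in>upper_half_plane. A_series S n k (exp (2 * of_real pi * \<i> * \<tau>)) = (\<Sum>w\<le>k. f w \<tau>)) \<and>
       (\<forall>w\<le>k. \<forall>\<tau>\<in>upper_half_plane. f w \<tau> = c k w * weight_part_form S n w \<tau>)"
      using congruence_subgroup_principal[OF n]
      by (intro exI[of _ ?\<Gamma>] exI[of _ "\<lambda>w \<tau>. c k w * weight_part_form S n w \<tau>"]) auto
  qed
qed

end
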